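(* Let $F$ be a free group and let $R$ be a normal subgroup of $F$. Then $$R\cap \bigl(1+\Delta^{5}(R)+\Delta^{3}(R)\Delta(R\cap F')+\Delta^{2}(R)\Delta([R,R\cap F'])\bigr)=\gamma_{5}(R)[R,R\cap F',R\cap F',R\cap F']\,[\,[R,R\cap F'],[R,R\cap F']\,].$$
   Context: For a group $G$, $\mathbb{Z}G$ is its integral group ring, $\Delta(G)$ is the augmentation ideal of $\mathbb{Z}G$, and $\Delta^n(G)$ is the $n$-th associative power of $\Delta(G)$. For a subgroup $H$ of $R$, $\Delta(H)$ is the augmentation ideal of $\mathbb{Z}H$, regarded as a subset of $\mathbb{Z}R$; a product such as $\Delta^n(R)\Delta(H)$ is the additive subgroup of $\mathbb{Z}R$ generated by all products $xy$ with $x\in\Delta^n(R)$, $y\in\Delta(H)$, and sums are sums of additive subgroups. For an additive subgroup $J$ of $\mathbb{Z}R$, $R\cap(1+J)=\{w\in R: w-1\in J\}$. $\{\gamma_n(G)\}_{n\ge1}$ is the lower central series of $G$ (with $\gamma_1(G)=G$) and $G'=\gamma_2(G)=[G,G]$. For subgroups $A,B$ of a group, $[A,B]$ is the subgroup generated by all commutators $[a,b]$ with $a\in A$, $b\in B$, and longer commutators are left-normed: $[A,B,C]=[[A,B],C]$ and $[A,B,C,D]=[[[A,B],C],D]$. The right-hand side of the claim is a product of subgroups. *)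

theory Defs
  imports "HOL-Algebra.Algebra"
begin

section \<open>Free groups\<close>

text \<open>
  A word over \<open>B\<close> is a list of signed elements of \<open>B\<close>; the sign \<^const>\<open>False\<close> marks an
  inverse. \<open>B\<close> is a basis of \<open>G\<close> when every element of \<open>G\<close> is the value of exactly one
  reduced word over \<open>B\<close>. No condition is put on the cardinality of \<open>B\<close>.
\<close>

definition letter_value :: "('a, 'b) monoid_scheme \<Rightarrow> bool \<times> 'a \<Rightarrow> 'a" where
  "letter_value G l = (if fst l then snd l else inv\<^bsub>G\<^esub> (snd l))"

definition word_value :: "('a, 'b) monoid_scheme \<Rightarrow> (bool \<times> 'a) list \<Rightarrow> 'a" where
  "word_value G w = foldr (\<lambda>l g. letter_value G l \<otimes>\<^bsub>G\<^esub> g) w \<one>\<^bsub>G\<^esub>"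

definition reduced_word :: "(bool \<times> 'a) list \<Rightarrow> bool" where
  "reduced_word w \<longleftrightarrow> successively (\<lambda>k l. snd k = snd l \<longrightarrow> fst k = fst l) w"

definition free_basis :: "('a, 'b) monoid_scheme \<Rightarrow> 'a set \<Rightarrow> bool" where
  "free_basis G B \<longleftrightarrow> B \<subseteq> carrier G \<and>
     bij_betw (word_value G) {w \<in> lists (UNIV \<times> B). reduced_word w} (carrier G)"

definition free_group :: "('a, 'b) monoid_scheme \<Rightarrow> bool" where
  "free_group G \<longleftrightarrow> group G \<and> (\<exists>B. free_basis G B)"


section \<open>Commutator subgroups and the lower central series\<close>

text \<open>
  The commutator convention is that of \<^const>\<open>derived\<close>, namely $a b a^{-1} b^{-1}$. For subgroups
  \<open>A\<close> and \<open>B\<close> the convention $a^{-1} b^{-1} a b$ yields the same set of commutators, since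
  \<open>A\<close> and \<open>B\<close> are closed under inverses.
\<close>

definition commutator_subgroup ::
    "('a, 'b) monoid_scheme \<Rightarrow> 'a set \<Rightarrow> 'a set \<Rightarrow> 'a set" where
  "commutator_subgroup G A B =
     generate G (\<Union>a\<in>A. \<Union>b\<in>B. {a \<otimes>\<^bsub>G\<^esub> b \<otimes>\<^bsub>G\<^esub> inv\<^bsub>G\<^esub> a \<otimes>\<^bsub>G\<^esub> inv\<^bsub>G\<^esub> b})"

lemma commutator_subgroup_self: "commutator_subgroup G A A = derived G A"
  by (simp add: commutator_subgroup_def derived_def)

text \<open>Indexed from 1, as in \<open>\<gamma>\<^sub>1(G) = G\<close>; the value at 0 is a dummy.\<close>

fun lower_central :: "('a, 'b) monoid_scheme \<Rightarrow> nat \<Rightarrow> 'a set" where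
  "lower_central G 0 = carrier G"
| "lower_central G (Suc 0) = carrier G"
| "lower_central G (Suc (Suc n)) =
     commutator_subgroup G (lower_central G (Suc n)) (carrier G)"

lemma lower_central_2: "lower_central G 2 = derived G (carrier G)"
  by (simp add: numeral_2_eq_2 commutator_subgroup_self)


section \<open>The integral group ring\<close>

text \<open>
  Elements are the finitely supported functions \<^typ>\<open>'a \<Rightarrow>\<^sub>0 int\<close> whose support lies in the
  carrier of \<open>G\<close>; \<open>g\<close> in \<open>G\<close> is identified with \<^term>\<open>frag_of g\<close>. Multiplication is the
  bilinear extension of that of \<open>G\<close>. With this representation the group ring of a
  subgroup \<open>H\<close>, that is of \<^term>\<open>G\<lparr>carrier := H\<rparr>\<close>, is literally a subset of that of \<open>G\<close>.
\<close>

definition group_ring :: "('a, 'b) monoid_scheme \<Rightarrow> ('a \<Rightarrow>\<^sub>0 int) ring" where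
  "group_ring G = \<lparr>carrier = {x. Poly_Mapping.keys x \<subseteq> carrier G},
     monoid.mult = (\<lambda>x y. frag_extend (\<lambda>g. frag_extend (\<lambda>h. frag_of (g \<otimes>\<^bsub>G\<^esub> h)) y) x),
     one = frag_of \<one>\<^bsub>G\<^esub>, ring.zero = 0, ring.add = (+)\<rparr>"

lemma group_ring_simps [simp]:
  "x \<in> carrier (group_ring G) \<longleftrightarrow> Poly_Mapping.keys x \<subseteq> carrier G"
  "x \<otimes>\<^bsub>group_ring G\<^esub> y = frag_extend (\<lambda>g. frag_extend (\<lambda>h. frag_of (g \<otimes>\<^bsub>G\<^esub> h)) y) x"
  "\<one>\<^bsub>group_ring G\<^esub> = frag_of \<one>\<^bsub>G\<^esub>"
  "\<zero>\<^bsub>group_ring G\<^esub> = 0"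
  "x \<oplus>\<^bsub>group_ring G\<^esub> y = x + y"
  by (simp_all add: group_ring_def)

lemma frag_extend_fun_add:
  "frag_extend (\<lambda>g. f g + f' g) x = frag_extend f x + frag_extend f' x"
  by (simp add: frag_extend_def frag_cmul_distrib2 sum.distrib)

lemma frag_extend_fun_diff:
  "frag_extend (\<lambda>g. f g - f' g) x = frag_extend f x - frag_extend f' x"
  using frag_extend_fun_add [of "\<lambda>g. f g - f' g" f' x] by simp

lemma ring_group_ring:
  assumes "group G"
  shows "ring (group_ring G)"
proof -
  interpret group G by fact
  have mult_closed: "Poly_Mapping.keys
      (frag_extend (\<lambda>g. frag_extend (\<lambda>h. frag_of (g \<otimes>\<^bsub>G\<^esub> h)) y) x) \<subseteq> carrier G"
    if "Poly_Mapping.keys x \<subseteq> carrier G" "Poly_Mapping.keys y \<subseteq> carrier G" for x y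
  proof
    fix k assume "k \<in> Poly_Mapping.keys
      (frag_extend (\<lambda>g. frag_extend (\<lambda>h. frag_of (g \<otimes>\<^bsub>G\<^esub> h)) y) x)"
    then obtain g where g: "g \<in> Poly_Mapping.keys x"
      "k \<in> Poly_Mapping.keys (frag_extend (\<lambda>h. frag_of (g \<otimes>\<^bsub>G\<^esub> h)) y)"
      using keys_frag_extend by fastforce
    then obtain h where "h \<in> Poly_Mapping.keys y" "k \<in> Poly_Mapping.keys (frag_of (g \<otimes>\<^bsub>G\<^esub> h))"
      using keys_frag_extend by fastforce
    with g that show "k \<in> carrier G" by auto
  qed
  let ?m = "\<lambda>x y. frag_extend (\<lambda>g. frag_extend (\<lambda>h. frag_of (g \<otimes>\<^bsub>G\<^esub> h)) y) x"
  have assoc: "?m (?m x y) z = ?m x (?m y z)"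
    if x: "Poly_Mapping.keys x \<subseteq> carrier G" and y: "Poly_Mapping.keys y \<subseteq> carrier G"
      and z: "Poly_Mapping.keys z \<subseteq> carrier G" for x y z
    using x
  proof (induction x rule: frag_induction)
    case (one g)
    show ?case using y
    proof (induction y rule: frag_induction)
      case (one h)
      show ?case using z
        by (induction z rule: frag_induction)
          (use \<open>g \<in> carrier G\<close> \<open>h \<in> carrier G\<close> in
            \<open>auto simp: m_assoc frag_extend_diff frag_extend_fun_diff\<close>)
    qed (auto simp: frag_extend_diff frag_extend_fun_diff)
  qed (auto simp: frag_extend_diff frag_extend_fun_diff)
  have one_l: "?m (frag_of \<one>\<^bsub>G\<^esub>) x = x" and one_r: "?m x (frag_of \<one>\<^bsub>G\<^esub>) = x"
    if "Poly_Mapping.keys x \<subseteq> carrier G" for x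
    using that
    by (induction x rule: frag_induction) (auto simp: frag_extend_diff)
  show ?thesis
  proof (intro ringI abelian_groupI monoidI)
    fix x assume "x \<in> carrier (group_ring G)"
    then show "\<exists>y\<in>carrier (group_ring G). y \<oplus>\<^bsub>group_ring G\<^esub> x = \<zero>\<^bsub>group_ring G\<^esub>"
      by (intro bexI [of _ "- x"]) auto
  next
    fix x y assume "x \<in> carrier (group_ring G)" "y \<in> carrier (group_ring G)"
    then show "x \<oplus>\<^bsub>group_ring G\<^esub> y \<in> carrier (group_ring G)"
      using Poly_Mapping.keys_add [of x y] by auto
  qed (use mult_closed assoc one_l one_r in
      \<open>simp_all add: frag_extend_add frag_extend_fun_add algebra_simps\<close>)
qed

definition augmentation :: "('a \<Rightarrow>\<^sub>0 int) \<Rightarrow> int" where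
  "augmentation x = (\<Sum>g\<in>Poly_Mapping.keys x. Poly_Mapping.lookup x g)"

definition aug_ideal :: "('a, 'b) monoid_scheme \<Rightarrow> ('a \<Rightarrow>\<^sub>0 int) set" where
  "aug_ideal G = {x \<in> carrier (group_ring G). augmentation x = 0}"

definition additive_prod :: "('a, 'b) ring_scheme \<Rightarrow> 'a set \<Rightarrow> 'a set \<Rightarrow> 'a set" where
  "additive_prod Z I J = generate (add_monoid Z) {x \<otimes>\<^bsub>Z\<^esub> y | x y. x \<in> I \<and> y \<in> J}"

primrec aug_power :: "('a, 'b) monoid_scheme \<Rightarrow> nat \<Rightarrow> ('a \<Rightarrow>\<^sub>0 int) set" where
  "aug_power G 0 = carrier (group_ring G)"
| "aug_power G (Suc n) = additive_prod (group_ring G) (aug_power G n) (aug_ideal G)"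

end

theory Submission
  imports Defs
begin

text \<open>
  Put $S = R \cap F'$ and $C = [R,S]$. The group $R$ is free, so $\gamma_4(R)/\gamma_5(R)$ is the
  degree four part of the free Lie ring on $M = R/R'$ and lies in $M^{\otimes 4}$, the degree four
  part of the graded ring of $\mathbb{Z}R$. The quotient $R/S$ embeds in the free abelian group
  $F/F'$, so it is free abelian and $M = A \oplus B$ with $A = S/R'$ and $B \cong R/S$. Modulo
  $\Delta^5(R)$ the sum of ideals in the theorem is $M^{\otimes 3} \otimes A + M^{\otimes 2} \otimes [M,A]$,
  the kernel of the projection of $M^{\otimes 4}$ onto $M \otimes M \otimes B \otimes B$. Hence $w$
  lies in the left hand side if and only if $w \in \gamma_4(R)$ and the Lie element of $w$ has
  coefficient zero at every word whose last two letters belong to \<open>B\<close>. Grade Lie elements by the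
  number of letters from \<open>A\<close>. With three or four such letters they belong to
  $[M,A,A,A] + [[M,A],[M,A]]$. With two, modulo this sum they are combinations of the $[a,b,b',a']$,
  which are told apart by the words $a'abb'$. With one, they are combinations of the
  $[a,b,b',b'']$, told apart by the words $abb'b''$; and a Lie element in letters from \<open>B\<close> alone is
  determined by its coefficients. So exactly the elements of the right hand side survive.

  Two facts about $R$ are used instead of a free basis. First, \<open>subgroup_of_free_group_projective\<close>:
  homomorphisms defined on $R$ lift along surjections. Lifting to unitriangular integer matrices
  (\<open>unitriangular_representation\<close>) produces, for any four homomorphisms $R \to \mathbb{Z}$, a
  representation whose superdiagonal consists of them; its upper right entry on $\gamma_4(R)$ is the
  coefficient functional of a word, and it vanishes on the appropriate ideals
  (\<open>entry_augmentation_sum\<close>). Second, \<open>basis_modulo_kernel\<close>: subgroups of free abelian groups are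
  free, which yields the splitting of $M$ with a dual basis (\<open>split_basis_exists\<close>).

  The group theory is the inclusion of the left hand side in the right hand side. Working down the
  series, an element of $\gamma_n(R)$ with vanishing coefficients is shown to lie in
  $\gamma_{n+1}(R)$ for $n < 4$ and in the right hand side for $n = 4$
  (\<open>mem_target_factors_if_coef_zero\<close>). Each step combines a spanning set of commutators with words
  on which these commutators are dual to each other, and
  \<open>mem_generate_if_dual_functionals_vanish\<close>. The opposite inclusion is a computation in
  $\mathbb{Z}R$ (\<open>target_factors_imp_augmentation_sum\<close>).
\<close>

section \<open>Commutators and the lower central series\<close>

text \<open>Unfolding $\gamma_{n+2}$ would remove the shape that the lemmas on the series match.\<close>

declare lower_central.simps(3) [simp del]

context group
begin

abbreviation gamma :: "nat \<Rightarrow> 'a set" ("\<gamma>") where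
  "\<gamma> \<equiv> lower_central G"

definition commutator :: "'a \<Rightarrow> 'a \<Rightarrow> 'a" ("[_;/ _]") where
  "[x; y] = x \<otimes> y \<otimes> inv x \<otimes> inv y"

lemma commutator_closed [simp, intro]:
  "x \<in> carrier G \<Longrightarrow> y \<in> carrier G \<Longrightarrow> [x; y] \<in> carrier G"
  by (simp add: commutator_def)

lemma mult_inv_cancel_left [simp]:
  assumes "x \<in> carrier G" "y \<in> carrier G"
  shows "x \<otimes> (inv x \<otimes> y) = y" "inv x \<otimes> (x \<otimes> y) = y"
  using assms by (simp_all flip: m_assoc)

lemma inv_commutator:
  "x \<in> carrier G \<Longrightarrow> y \<in> carrier G \<Longrightarrow> inv [x; y] = [y; x]"
  by (simp add: commutator_def inv_mult_group m_assoc)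

lemma commutator_self: "x \<in> carrier G \<Longrightarrow> [x; x] = \<one>"
  by (simp add: commutator_def m_assoc)

lemma commutator_conj:
  assumes "g \<in> carrier G" "x \<in> carrier G" "y \<in> carrier G"
  shows "g \<otimes> [x; y] \<otimes> inv g = [g \<otimes> x \<otimes> inv g; g \<otimes> y \<otimes> inv g]"
  using assms by (simp add: commutator_def inv_mult_group m_assoc)

lemma conj_eq_commutator_mult:
  assumes "g \<in> carrier G" "x \<in> carrier G"
  shows "g \<otimes> x \<otimes> inv g = [g; x] \<otimes> x"
  using assms by (simp add: commutator_def m_assoc)

text \<open>
  In the next identities the deviation from bilinearity is a single commutator of higher weight,
  which disappears when one computes modulo the next term of the lower central series.
\<close>

lemma commutator_mult_left:
  assumes "x \<in> carrier G" "x' \<in> carrier G" "y \<in> carrier G"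
  shows "[x \<otimes> x'; y] = [x; [x'; y]] \<otimes> [x'; y] \<otimes> [x; y]"
  using assms by (simp add: commutator_def inv_mult_group m_assoc)

lemma commutator_mult_right:
  assumes "x \<in> carrier G" "y \<in> carrier G" "y' \<in> carrier G"
  shows "[x; y \<otimes> y'] = [x; y] \<otimes> [y; [x; y']] \<otimes> [x; y']"
  using assms by (simp add: commutator_def inv_mult_group m_assoc)

lemma commutator_inv_left:
  assumes "x \<in> carrier G" "y \<in> carrier G"
  shows "[inv x; y] = [inv x; [y; x]] \<otimes> [y; x]"
  using assms by (simp add: commutator_def inv_mult_group m_assoc)

lemma commutator_inv_right:
  assumes "x \<in> carrier G" "y \<in> carrier G"
  shows "[x; inv y] = [inv y; [y; x]] \<otimes> [y; x]"
  using assms by (simp add: commutator_def inv_mult_group m_assoc)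

text \<open>
  The source of the Jacobi identity in the graded Lie ring of the lower central series. The
  conjugations are those that belong to the convention $[x,y] = x y x^{-1} y^{-1}$.
\<close>

lemma Hall_Witt:
  assumes "a \<in> carrier G" "b \<in> carrier G" "c \<in> carrier G"
  shows "(b \<otimes> [[inv b; a]; c] \<otimes> inv b) \<otimes> (c \<otimes> [[inv c; b]; a] \<otimes> inv c)
           \<otimes> (a \<otimes> [[inv a; c]; b] \<otimes> inv a) = \<one>"
  using assms by (simp add: commutator_def inv_mult_group m_assoc)

lemma commutator_subgroup_eq:
  "commutator_subgroup G A B = generate G {[a; b] | a b. a \<in> A \<and> b \<in> B}"
  unfolding commutator_subgroup_def commutator_def by (rule arg_cong [where f = "generate G"]) blast

lemma commutator_in_commutator_subgroup:
  "a \<in> A \<Longrightarrow> b \<in> B \<Longrightarrow> [a; b] \<in> commutator_subgroup G A B"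
  unfolding commutator_subgroup_eq by (blast intro: generate.incl)

lemma commutator_subgroup_least:
  assumes "subgroup H G" "\<And>a b. a \<in> A \<Longrightarrow> b \<in> B \<Longrightarrow> [a; b] \<in> H"
  shows "commutator_subgroup G A B \<subseteq> H"
  unfolding commutator_subgroup_eq using assms by (intro generate_subgroup_incl) auto

lemma commutator_subgroup_normal:
  assumes "A \<lhd> G" "B \<lhd> G"
  shows "commutator_subgroup G A B \<lhd> G"
  unfolding commutator_subgroup_eq
proof (rule normal_generateI)
  have A: "A \<subseteq> carrier G" and B: "B \<subseteq> carrier G"
    using assms normal_imp_subgroup subgroup.subset by blast+
  show "{[a; b] |a b. a \<in> A \<and> b \<in> B} \<subseteq> carrier G"
    using A B by auto
  fix h g assume "h \<in> {[a; b] |a b. a \<in> A \<and> b \<in> B}" and g: "g \<in> carrier G"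
  then obtain a b where ab: "a \<in> A" "b \<in> B" "h = [a; b]" by auto
  moreover have "g \<otimes> a \<otimes> inv g \<in> A" "g \<otimes> b \<otimes> inv g \<in> B"
    using ab g assms by (simp_all add: normal.inv_op_closed2)
  moreover have "g \<otimes> h \<otimes> inv g = [g \<otimes> a \<otimes> inv g; g \<otimes> b \<otimes> inv g]"
    using A B g ab commutator_conj[of g a b] by auto
  ultimately show "g \<otimes> h \<otimes> inv g \<in> {[a; b] |a b. a \<in> A \<and> b \<in> B}"
    by blast
qed

lemma carrier_normal: "carrier G \<lhd> G"
  by (auto simp: normal_inv_iff subgroup_self)

lemma lower_central_Suc:
  "n \<ge> 1 \<Longrightarrow> \<gamma> (Suc n) = commutator_subgroup G (\<gamma> n) (carrier G)"
  by (cases n) (auto simp: lower_central.simps(3))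

lemma lower_central_normal: "\<gamma> n \<lhd> G"
proof (induction n)
  case (Suc n)
  then show ?case
    by (cases n) (simp_all add: carrier_normal commutator_subgroup_normal lower_central.simps(3))
qed (simp add: carrier_normal)

lemma lower_central_subgroup: "subgroup (\<gamma> n) G"
  by (simp add: lower_central_normal normal_imp_subgroup)

lemma lower_central_closed [intro, simp]: "x \<in> \<gamma> n \<Longrightarrow> x \<in> carrier G"
  using lower_central_subgroup subgroup.subset by blast

lemma lower_central_inv: "u \<in> \<gamma> n \<Longrightarrow> inv u \<in> \<gamma> n"
  by (rule subgroup.m_inv_closed [OF lower_central_subgroup])

lemma commutator_lower_central:
  "n \<ge> 1 \<Longrightarrow> u \<in> \<gamma> n \<Longrightarrow> g \<in> carrier G \<Longrightarrow> [u; g] \<in> \<gamma> (Suc n)"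
  by (simp add: lower_central_Suc commutator_in_commutator_subgroup)

lemma commutator_lower_central':
  assumes "n \<ge> 1" "u \<in> \<gamma> n" "g \<in> carrier G"
  shows "[g; u] \<in> \<gamma> (Suc n)"
proof -
  have "inv [u; g] \<in> \<gamma> (Suc n)"
    using assms by (intro lower_central_inv commutator_lower_central)
  then show ?thesis using assms by (simp add: inv_commutator)
qed

lemma commutator_commutator_lower_central:
  assumes "n \<ge> 1" "u \<in> \<gamma> n" "g \<in> carrier G" "h \<in> carrier G"
  shows "[h; [u; g]] \<in> \<gamma> (Suc (Suc n))" "[h; [g; u]] \<in> \<gamma> (Suc (Suc n))"
  using assms
  by (intro commutator_lower_central' commutator_lower_central; simp)+

lemma normal_commutator_closed:
  assumes "N \<lhd> G" "x \<in> N" "g \<in> carrier G"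
  shows "[x; g] \<in> N" "[g; x] \<in> N"
proof -
  interpret normal N G by fact
  have x: "x \<in> carrier G" using assms subset by blast
  have "[g; x] = (g \<otimes> x \<otimes> inv g) \<otimes> inv x"
    by (simp add: commutator_def)
  then show 1: "[g; x] \<in> N" using assms inv_op_closed2 by simp
  then show "[x; g] \<in> N" using assms x inv_commutator[of g x] m_inv_closed by metis
qed

lemma lower_central_Suc_subset: "\<gamma> (Suc n) \<subseteq> \<gamma> n"
proof (cases "n = 0")
  case False
  then show ?thesis
    using commutator_subgroup_least[OF lower_central_subgroup[of n],
        of "\<gamma> n" "carrier G"]
      normal_commutator_closed(1)[OF lower_central_normal[of n]]
    by (simp add: lower_central_Suc)
qed simp

lemma lower_central_antimono: "m \<le> n \<Longrightarrow> \<gamma> n \<subseteq> \<gamma> m"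
  by (induction rule: inc_induct) (use lower_central_Suc_subset in auto)

lemma commutator_swap_iff:
  assumes "subgroup P G" "x \<in> carrier G" "y \<in> carrier G"
  shows "[x; y] \<in> P \<longleftrightarrow> [y; x] \<in> P"
  using assms by (metis inv_commutator subgroup.m_inv_closed)

text \<open>
  Working modulo $\gamma_{n+2}$, the commutator $[u,g]$ with $u \in \gamma_n$ is additive in each
  argument. Stated as closure properties of a subgroup \<open>P\<close> that contains $\gamma_{n+2}$, this
  avoids computations in quotient groups and can be iterated: \<open>{u \<in> \<gamma>\<^sub>n. [u, g] \<in> P}\<close> is again
  such a subgroup, one step up in the series.
\<close>

lemma subgroup_commutator_left:
  assumes n: "n \<ge> 1" and P: "subgroup P G" "\<gamma> (Suc (Suc n)) \<subseteq> P"
    and g: "g \<in> carrier G"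
  shows "subgroup {u \<in> \<gamma> n. [u; g] \<in> P} G"
proof -
  interpret P: subgroup P G by fact
  interpret L: subgroup "\<gamma> n" G by (rule lower_central_subgroup)
  show ?thesis
  proof (rule subgroupI)
    show "{u \<in> \<gamma> n. [u; g] \<in> P} \<subseteq> carrier G" by auto
    have "\<one> \<in> {u \<in> \<gamma> n. [u; g] \<in> P}"
      using g by (simp add: commutator_def)
    then show "{u \<in> \<gamma> n. [u; g] \<in> P} \<noteq> {}" by blast
  next
    fix u assume "u \<in> {u \<in> \<gamma> n. [u; g] \<in> P}"
    then have u: "u \<in> \<gamma> n" "[u; g] \<in> P" by auto
    then have gu: "[g; u] \<in> P" using g using commutator_swap_iff[OF P(1)] by blast
    have "[inv u; [g; u]] \<in> P"
      using u g n P commutator_commutator_lower_central by auto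
    with gu have "[inv u; g] \<in> P" using u g by (simp add: commutator_inv_left [of u g])
    then show "inv u \<in> {u \<in> \<gamma> n. [u; g] \<in> P}" using u by simp
  next
    fix u v assume "u \<in> {u \<in> \<gamma> n. [u; g] \<in> P}" "v \<in> {u \<in> \<gamma> n. [u; g] \<in> P}"
    then have u: "u \<in> \<gamma> n" "[u; g] \<in> P" and v: "v \<in> \<gamma> n" "[v; g] \<in> P"
      by auto
    have "[u; [v; g]] \<in> P"
      using u v g n P commutator_commutator_lower_central by auto
    then show "u \<otimes> v \<in> {u \<in> \<gamma> n. [u; g] \<in> P}"
      using u v g by (simp add: commutator_mult_left)
  qed
qed

lemma subgroup_commutator_right:
  assumes n: "n \<ge> 1" and P: "subgroup P G" "\<gamma> (Suc (Suc n)) \<subseteq> P"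
    and u: "u \<in> \<gamma> n"
  shows "subgroup {g \<in> carrier G. [u; g] \<in> P} G"
proof -
  interpret P: subgroup P G by fact
  show ?thesis
  proof (rule subgroupI)
    have "\<one> \<in> {g \<in> carrier G. [u; g] \<in> P}"
      using u by (simp add: commutator_def)
    then show "{g \<in> carrier G. [u; g] \<in> P} \<noteq> {}" by blast
  next
    fix g assume "g \<in> {g \<in> carrier G. [u; g] \<in> P}"
    then have g: "g \<in> carrier G" "[u; g] \<in> P" by auto
    then have gu: "[g; u] \<in> P" using u using commutator_swap_iff[OF P(1)] by blast
    have "[inv g; [g; u]] \<in> P"
      using u g n P commutator_commutator_lower_central by auto
    with gu have "[u; inv g] \<in> P" using u g by (simp add: commutator_inv_right [of u g])
    then show "inv g \<in> {g \<in> carrier G. [u; g] \<in> P}" using g by simp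
  next
    fix g h assume "g \<in> {g \<in> carrier G. [u; g] \<in> P}" "h \<in> {g \<in> carrier G. [u; g] \<in> P}"
    then have g: "g \<in> carrier G" "[u; g] \<in> P" and h: "h \<in> carrier G" "[u; h] \<in> P" by auto
    have "[g; [u; h]] \<in> P"
      using u h g n P commutator_commutator_lower_central by auto
    then show "g \<otimes> h \<in> {g \<in> carrier G. [u; g] \<in> P}"
      using u h g by (simp add: commutator_mult_right)
  qed auto
qed

lemma lower_central_subset_commutator_left:
  assumes "n \<ge> 1" "\<gamma> (Suc (Suc n)) \<subseteq> P" "g \<in> carrier G"
  shows "\<gamma> (Suc n) \<subseteq> {u \<in> \<gamma> n. [u; g] \<in> P}"
  using assms commutator_lower_central[of "Suc n"] lower_central_Suc_subset[of n] by auto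

lemma commutator_inv_left_iff:
  assumes "n \<ge> 1" "subgroup P G" "\<gamma> (Suc (Suc n)) \<subseteq> P"
    "u \<in> \<gamma> n" "g \<in> carrier G"
  shows "[inv u; g] \<in> P \<longleftrightarrow> [u; g] \<in> P"
proof -
  have u: "inv u \<in> \<gamma> n"
    using assms(4) by (rule lower_central_inv)
  show ?thesis
    using subgroup.m_inv_closed[OF subgroup_commutator_left[OF assms(1-3,5)], of u]
      subgroup.m_inv_closed[OF subgroup_commutator_left[OF assms(1-3,5)], of "inv u"] u assms by auto
qed

lemma commutator_inv_right_iff:
  assumes "n \<ge> 1" "subgroup P G" "\<gamma> (Suc (Suc n)) \<subseteq> P"
    "u \<in> \<gamma> n" "g \<in> carrier G"
  shows "[u; inv g] \<in> P \<longleftrightarrow> [u; g] \<in> P"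
  using subgroup.m_inv_closed[OF subgroup_commutator_right[OF assms(1-4)], of g]
    subgroup.m_inv_closed[OF subgroup_commutator_right[OF assms(1-4)], of "inv g"] assms by auto

lemma conj_mem_iff:
  assumes P: "subgroup P G" "\<gamma> (Suc n) \<subseteq> P" and n: "n \<ge> 1"
    and x: "x \<in> \<gamma> n" and g: "g \<in> carrier G"
  shows "g \<otimes> x \<otimes> inv g \<in> P \<longleftrightarrow> x \<in> P"
proof -
  interpret P: subgroup P G by fact
  have *: "[g; x] \<in> P" using assms commutator_lower_central' by blast
  have "inv [g; x] \<otimes> ([g; x] \<otimes> x) = x" using x g by simp
  then show ?thesis
    unfolding conj_eq_commutator_mult[OF g lower_central_closed[OF x]]
    using * by (metis P.m_closed P.m_inv_closed)
qed

lemma mult3_one_iff: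
  assumes "subgroup P G" "x \<otimes> y \<otimes> z = \<one>" "x \<in> carrier G" "y \<in> carrier G" "z \<in> carrier G"
  shows "x \<in> P \<Longrightarrow> y \<in> P \<Longrightarrow> z \<in> P" "x \<in> P \<Longrightarrow> z \<in> P \<Longrightarrow> y \<in> P" "y \<in> P \<Longrightarrow> z \<in> P \<Longrightarrow> x \<in> P"
proof -
  interpret P: subgroup P G by fact
  have z: "z = inv (x \<otimes> y)" using assms inv_equality[of z] by (metis inv_comm inv_equality m_closed)
  show "z \<in> P" if "x \<in> P" "y \<in> P" using that z by simp
  have y: "y = inv x \<otimes> inv z" using assms z by (simp add: inv_mult_group m_assoc)
  show "y \<in> P" if "x \<in> P" "z \<in> P" using that y by (metis P.m_closed P.m_inv_closed)
  have x: "x = inv z \<otimes> inv y" using assms z by (simp add: inv_mult_group m_assoc)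
  show "x \<in> P" if "y \<in> P" "z \<in> P" using that x by (metis P.m_closed P.m_inv_closed)
qed

text \<open>
  For $u \in \gamma_p$, two of the three factors of the Hall-Witt identity lie in $\gamma_{p+2}$
  by definition of the series; hence so does the third, which gives
  $[\gamma_2, \gamma_p] \subseteq \gamma_{p+2}$.
\<close>

lemma commutator_lower_central_2:
  assumes p: "p \<ge> 1" and u: "u \<in> \<gamma> p" and d: "d \<in> \<gamma> 2"
  shows "[d; u] \<in> \<gamma> (Suc (Suc p))"
proof -
  let ?L = "\<gamma> (Suc (Suc p))"
  interpret L: normal ?L G by (rule lower_central_normal)
  have uc: "u \<in> carrier G" using u by blast
  have base: "[[c; b]; u] \<in> ?L" if c: "c \<in> carrier G" and b: "b \<in> carrier G" for b c
  proof -
    have uL: "inv u \<in> \<gamma> p"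
      using u by (rule lower_central_inv)
    have 1: "b \<otimes> [[inv b; u]; inv c] \<otimes> inv b \<in> ?L"
      using u p b c commutator_lower_central[of "Suc p" "[inv b; u]" "inv c"]
        commutator_lower_central'[of p u "inv b"]
      by (intro L.inv_op_closed2) auto
    have 3: "u \<otimes> [[inv u; inv c]; b] \<otimes> inv u \<in> ?L"
      using uL uc p b c commutator_lower_central[of "Suc p" "[inv u; inv c]" b]
        commutator_lower_central[of p "inv u" "inv c"]
      by (intro L.inv_op_closed2) auto
    have "inv c \<otimes> [[c; b]; u] \<otimes> inv (inv c) \<in> ?L"
      using mult3_one_iff(2)[OF L.is_subgroup Hall_Witt[of u b "inv c"] _ _ _ 1 3] uc b c by simp
    from L.inv_op_closed2[OF c this] show ?thesis
      using uc b c by (simp add: m_assoc)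
  qed
  have "\<gamma> 2 \<subseteq> {d \<in> carrier G. [d; u] \<in> ?L}"
    unfolding lower_central_2 commutator_subgroup_self[symmetric]
  proof (rule commutator_subgroup_least)
    show "subgroup {d \<in> carrier G. [d; u] \<in> ?L} G"
    proof (rule subgroupI)
      have "\<one> \<in> {d \<in> carrier G. [d; u] \<in> ?L}"
        using uc L.one_closed by (simp add: commutator_def del: lower_central.simps)
      then show "{d \<in> carrier G. [d; u] \<in> ?L} \<noteq> {}" by blast
    next
      fix d assume "d \<in> {d \<in> carrier G. [d; u] \<in> ?L}"
      then have d: "d \<in> carrier G" "[d; u] \<in> ?L" by auto
      then have "[u; d] \<in> ?L" using commutator_swap_iff[OF L.is_subgroup] uc by blast
      then show "inv d \<in> {d \<in> carrier G. [d; u] \<in> ?L}"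
        using d uc normal_commutator_closed[OF lower_central_normal]
        by (simp add: commutator_inv_left [of d u])
    next
      fix d e assume "d \<in> {d \<in> carrier G. [d; u] \<in> ?L}" "e \<in> {d \<in> carrier G. [d; u] \<in> ?L}"
      then show "d \<otimes> e \<in> {d \<in> carrier G. [d; u] \<in> ?L}"
        using uc normal_commutator_closed[OF lower_central_normal]
        by (simp add: commutator_mult_left)
    qed auto
  qed (use base in auto)
  with d show ?thesis by auto
qed

text \<open>
  The Jacobi identity for $u \in \gamma_p$ modulo $\gamma_{p+3}$, extracted from the Hall-Witt
  identity: each of its three factors is, up to inverses and conjugation, one of the three
  commutators below.
\<close>

lemma Jacobi_mem:
  assumes p: "p \<ge> 1" and P: "subgroup P G" "\<gamma> (Suc (Suc (Suc p))) \<subseteq> P"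
    and u: "u \<in> \<gamma> p" and b: "b \<in> carrier G" and c: "c \<in> carrier G"
  shows "[[u; c]; b] \<in> P \<Longrightarrow> [[u; b]; c] \<in> P \<Longrightarrow> [u; [c; b]] \<in> P"
    and "[u; [c; b]] \<in> P \<Longrightarrow> [[u; b]; c] \<in> P \<Longrightarrow> [[u; c]; b] \<in> P"
proof -
  have uc: "u \<in> carrier G" using u by blast
  have uL: "inv u \<in> \<gamma> p"
    using u by (rule lower_central_inv)
  let ?Q = "\<lambda>g. {v \<in> \<gamma> (Suc p). [v; g] \<in> P}"
  have Q: "subgroup (?Q g) G" "\<gamma> (Suc (Suc p)) \<subseteq> ?Q g" if "g \<in> carrier G" for g
    using subgroup_commutator_left[of "Suc p" P g] lower_central_subset_commutator_left[of "Suc p" P g]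
      that P p by auto
  have ug: "[u; g] \<in> \<gamma> (Suc p)" "[g; u] \<in> \<gamma> (Suc p)"
    "[inv u; g] \<in> \<gamma> (Suc p)" if "g \<in> carrier G" for g
    using that u uL p commutator_lower_central commutator_lower_central' by blast+
  have X1: "b \<otimes> [[inv b; u]; inv c] \<otimes> inv b \<in> P \<longleftrightarrow> [[u; b]; c] \<in> P"
  proof -
    have "b \<otimes> [[inv b; u]; inv c] \<otimes> inv b \<in> P \<longleftrightarrow> [[inv b; u]; inv c] \<in> P"
      using b c p ug by (intro conj_mem_iff[of _ "Suc (Suc p)"] commutator_lower_central[of "Suc p"] P) auto
    also have "\<dots> \<longleftrightarrow> [[inv b; u]; c] \<in> P"
      using b c p ug by (intro commutator_inv_right_iff[of "Suc p"] P) auto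
    also have "\<dots> \<longleftrightarrow> [inv b; u] \<in> ?Q c"
      using b c ug by simp
    also have "\<dots> \<longleftrightarrow> [u; inv b] \<in> ?Q c"
      using b c uc Q by (intro commutator_swap_iff) auto
    also have "\<dots> \<longleftrightarrow> [u; b] \<in> ?Q c"
      using b c u Q p by (intro commutator_inv_right_iff[of p]) auto
    finally show ?thesis using b ug by simp
  qed
  have X2: "inv c \<otimes> [[inv (inv c); b]; u] \<otimes> inv (inv c) \<in> P \<longleftrightarrow> [u; [c; b]] \<in> P"
  proof -
    have cb: "[c; b] \<in> \<gamma> 2"
      using b c commutator_lower_central[of 1 c b] by (simp add: numeral_2_eq_2)
    have "inv c \<otimes> [[c; b]; u] \<otimes> inv (inv c) \<in> P \<longleftrightarrow> [[c; b]; u] \<in> P"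
      using b c p u cb by (intro conj_mem_iff[of _ "Suc (Suc p)"] P commutator_lower_central_2) auto
    then show ?thesis using commutator_swap_iff[OF P(1)] b c uc by simp
  qed
  have X3: "u \<otimes> [[inv u; inv c]; b] \<otimes> inv u \<in> P \<longleftrightarrow> [[u; c]; b] \<in> P"
  proof -
    have "u \<otimes> [[inv u; inv c]; b] \<otimes> inv u \<in> P \<longleftrightarrow> [[inv u; inv c]; b] \<in> P"
      using b c uc p ug by (intro conj_mem_iff[of _ "Suc (Suc p)"] commutator_lower_central[of "Suc p"] P) auto
    also have "\<dots> \<longleftrightarrow> [inv u; inv c] \<in> ?Q b"
      using c ug by simp
    also have "\<dots> \<longleftrightarrow> [inv u; c] \<in> ?Q b"
      using b c uL Q p by (intro commutator_inv_right_iff[of p]) auto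
    also have "\<dots> \<longleftrightarrow> [u; c] \<in> ?Q b"
      using b c u Q p by (intro commutator_inv_left_iff[of p]) auto
    finally show ?thesis using c ug by simp
  qed
  note W = mult3_one_iff[OF P(1) Hall_Witt[of u b "inv c"]]
  show "[u; [c; b]] \<in> P" if "[[u; c]; b] \<in> P" "[[u; b]; c] \<in> P"
    using W(2) X1 X2 X3 that uc b c by simp
  show "[[u; c]; b] \<in> P" if "[u; [c; b]] \<in> P" "[[u; b]; c] \<in> P"
    using W(1) X1 X2 X3 that uc b c by simp
qed

text \<open>
  Consequently $\gamma_{n+1}$ is generated, modulo $\gamma_{n+2}$, by the commutators of generators
  of $\gamma_n$ modulo $\gamma_{n+1}$ with generators of $G$ modulo $\gamma_2$.
\<close>

lemma lower_central_Suc_subsetI: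
  assumes n: "n \<ge> 1" and P: "subgroup P G" "\<gamma> (Suc (Suc n)) \<subseteq> P"
    and U: "\<gamma> n \<subseteq> generate G (U \<union> \<gamma> (Suc n))" "U \<subseteq> \<gamma> n"
    and Y: "carrier G \<subseteq> generate G (Y \<union> \<gamma> 2)" "Y \<subseteq> carrier G"
    and UY: "\<And>u y. u \<in> U \<Longrightarrow> y \<in> Y \<Longrightarrow> [u; y] \<in> P"
  shows "\<gamma> (Suc n) \<subseteq> P"
proof -
  have 1: "[u; g] \<in> P" if u: "u \<in> U" and g: "g \<in> carrier G" for u g
  proof -
    have uL: "u \<in> \<gamma> n" using u U by blast
    have "generate G (Y \<union> \<gamma> 2) \<subseteq> {g \<in> carrier G. [u; g] \<in> P}"
    proof (intro generate_subgroup_incl subgroup_commutator_right[OF n P uL] Un_least)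
      show "Y \<subseteq> {g \<in> carrier G. [u; g] \<in> P}" using UY u Y by auto
      have "[u; d] \<in> P" if "d \<in> \<gamma> 2" for d
      proof -
        have "[d; u] \<in> P" using commutator_lower_central_2[OF n uL that] P by blast
        then show ?thesis using commutator_swap_iff[OF P(1)] that uL by blast
      qed
      then show "\<gamma> 2 \<subseteq> {g \<in> carrier G. [u; g] \<in> P}" by auto
    qed
    then show ?thesis using g Y by blast
  qed
  have "[u; g] \<in> P" if u: "u \<in> \<gamma> n" and g: "g \<in> carrier G" for u g
  proof -
    have "generate G (U \<union> \<gamma> (Suc n)) \<subseteq> {u \<in> \<gamma> n. [u; g] \<in> P}"
      using 1 g U lower_central_subset_commutator_left[OF n P(2) g]
      by (intro generate_subgroup_incl subgroup_commutator_left[OF n P g] Un_least) auto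
    then show ?thesis using u U by blast
  qed
  then show ?thesis
    unfolding lower_central_Suc[OF n] by (intro commutator_subgroup_least P) 
qed

end

section \<open>Independence modulo a subgroup\<close>

context group
begin

lemma generate_lower_central: "generate G (\<gamma> n) = \<gamma> n"
  by (rule generate_subgroup_incl[OF subset_refl lower_central_subgroup, THEN antisym]) (auto intro: generate.incl)

text \<open>
  Membership in a generated subgroup involves finitely many generators, which permits induction on them.
\<close>

lemma generate_finite_support:
  assumes "w \<in> generate G (s ` I \<union> T)"
  obtains J where "finite J" "J \<subseteq> I" "w \<in> generate G (s ` J \<union> T)"
proof -
  have "\<exists>J. finite J \<and> J \<subseteq> I \<and> w \<in> generate G (s ` J \<union> T)"
    using assms
  proof (induction rule: generate.induct)
    case one
    then show ?case by (intro exI[of _ "{}"]) (auto intro: generate.one)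
  next
    case (incl h)
    then consider i where "i \<in> I" "h = s i" | "h \<in> T" by blast
    then show ?case
    proof cases
      case 1
      then show ?thesis by (intro exI[of _ "{i}"]) (auto intro: generate.incl)
    next
      case 2
      then show ?thesis by (intro exI[of _ "{}"]) (auto intro: generate.incl)
    qed
  next
    case (inv h)
    then consider i where "i \<in> I" "h = s i" | "h \<in> T" by blast
    then show ?case
    proof cases
      case 1
      then show ?thesis by (intro exI[of _ "{i}"]) (auto intro: generate.inv)
    next
      case 2
      then show ?thesis by (intro exI[of _ "{}"]) (auto intro: generate.inv)
    qed
  next
    case (eng h1 h2)
    then obtain J1 J2 where J: "finite J1" "J1 \<subseteq> I" "h1 \<in> generate G (s ` J1 \<union> T)"
      "finite J2" "J2 \<subseteq> I" "h2 \<in> generate G (s ` J2 \<union> T)" by blast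
    have "h1 \<in> generate G (s ` (J1 \<union> J2) \<union> T)" "h2 \<in> generate G (s ` (J1 \<union> J2) \<union> T)"
      using J mono_generate[of "s ` J1 \<union> T" "s ` (J1 \<union> J2) \<union> T"]
        mono_generate[of "s ` J2 \<union> T" "s ` (J1 \<union> J2) \<union> T"] by blast+
    then show ?case
      using J by (intro exI[of _ "J1 \<union> J2"]) (auto intro: generate.eng)
  qed
  then show ?thesis using that by blast
qed

lemma additive_int_pow:
  fixes e :: "'a \<Rightarrow> int"
  assumes "subgroup \<Gamma> G" "\<And>x y. x \<in> \<Gamma> \<Longrightarrow> y \<in> \<Gamma> \<Longrightarrow> e (x \<otimes> y) = e x + e y" "x \<in> \<Gamma>"
  shows "e (x [^] (n::int)) = n * e x"
proof -
  interpret \<Gamma>: subgroup \<Gamma> G by fact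
  have one: "e \<one> = 0" using assms(2)[of \<one> \<one>] by simp
  have inv: "e (inv y) = - e y" if "y \<in> \<Gamma>" for y
    using assms(2)[of "inv y" y] that one by simp
  have xc: "x \<in> carrier G" using assms(3) \<Gamma>.subset by blast
  have pow: "x [^] (k::nat) \<in> \<Gamma> \<and> e (x [^] k) = int k * e x" for k
    by (induction k) (use assms one in \<open>simp_all add: algebra_simps\<close>)
  show ?thesis
  proof (cases n)
    case (nonneg k)
    then show ?thesis using pow by (simp add: int_pow_int)
  next
    case (neg k)
    then have "x [^] n = inv (x [^] Suc k)" by (simp only: int_pow_neg_int[OF xc])
    moreover have "n = - int (Suc k)" using neg by simp
    ultimately show ?thesis using inv[of "x [^] Suc k"] pow[of "Suc k"] by (simp only: mult_minus_left)
  qed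
qed

lemma additive_generate_zero:
  fixes e :: "'a \<Rightarrow> int"
  assumes "subgroup \<Gamma> G" "\<And>x y. x \<in> \<Gamma> \<Longrightarrow> y \<in> \<Gamma> \<Longrightarrow> e (x \<otimes> y) = e x + e y" "T \<subseteq> \<Gamma>"
    "\<And>x. x \<in> T \<Longrightarrow> e x = 0"
  shows "w \<in> generate G T \<Longrightarrow> e w = 0"
proof -
  interpret \<Gamma>: subgroup \<Gamma> G by fact
  have one: "e \<one> = 0" using assms(2)[of \<one> \<one>] by simp
  have inv: "e (inv y) = - e y" if "y \<in> \<Gamma>" for y
    using assms(2)[of "inv y" y] that one by simp
  have \<Gamma>: "generate G T \<subseteq> \<Gamma>"
    using assms generate_subgroup_incl by blast
  assume "w \<in> generate G T"
  then show ?thesis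
  proof (induction rule: generate.induct)
    case (eng h1 h2)
    then show ?case using assms(2)[of h1 h2] \<Gamma> by auto
  qed (use one inv assms in auto)
qed

text \<open>
  Since the subgroup generated by \<open>T\<close> contains all commutators of \<open>\<Gamma>\<close>, the element \<open>w\<close> is a product
  of powers of the \<open>s i\<close> and of an element of that subgroup. The functionals \<open>e i\<close>, which are dual to
  the \<open>s i\<close> up to nonzero factors, read off the exponents; when they all vanish on \<open>w\<close>, only the factor
  from the subgroup is left.
\<close>

lemma mem_generate_if_dual_functionals_vanish:
  fixes e :: "'i \<Rightarrow> 'a \<Rightarrow> int"
  assumes \<Gamma>: "subgroup \<Gamma> G"
    and add: "\<And>i x y. i \<in> I \<Longrightarrow> x \<in> \<Gamma> \<Longrightarrow> y \<in> \<Gamma> \<Longrightarrow> e i (x \<otimes> y) = e i x + e i y"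
    and T: "T \<subseteq> \<Gamma>" "\<And>i x. i \<in> I \<Longrightarrow> x \<in> T \<Longrightarrow> e i x = 0"
    and s: "\<And>i. i \<in> I \<Longrightarrow> s i \<in> \<Gamma>" "\<And>i j. i \<in> I \<Longrightarrow> j \<in> I \<Longrightarrow> i \<noteq> j \<Longrightarrow> e i (s j) = 0"
      "\<And>i. i \<in> I \<Longrightarrow> e i (s i) \<noteq> 0"
    and comm: "\<And>x y. x \<in> \<Gamma> \<Longrightarrow> y \<in> \<Gamma> \<Longrightarrow> [x; y] \<in> generate G T"
    and w: "w \<in> generate G (s ` I \<union> T)" "\<And>i. i \<in> I \<Longrightarrow> e i w = 0"
  shows "w \<in> generate G T"
proof -
  interpret \<Gamma>: subgroup \<Gamma> G by fact
  obtain J where J: "finite J" "J \<subseteq> I" "w \<in> generate G (s ` J \<union> T)"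
    using generate_finite_support[OF w(1)] .
  from J show ?thesis
  proof (induction J rule: finite_induct)
    case (insert j J)
    let ?H = "generate G (s ` J \<union> T)"
    have sub: "s ` J \<union> T \<subseteq> \<Gamma>" using insert.prems T s by auto
    have H\<Gamma>: "?H \<subseteq> \<Gamma>" using sub \<Gamma> generate_subgroup_incl by blast
    interpret H: subgroup ?H G
      using sub \<Gamma>.subset by (intro generate_is_subgroup) auto
    have TH: "generate G T \<subseteq> ?H" by (rule mono_generate) auto
    have j: "j \<in> I" "s j \<in> \<Gamma>" using insert.prems s by auto
    have sc: "s j \<in> carrier G" using j by auto
    \<comment> \<open>since \<open>H\<close> contains all commutators, the products \<open>s\<^sub>j\<^sup>n v\<close> form a subgroup\<close>
    let ?M = "{s j [^] (n::int) \<otimes> v | n v. v \<in> ?H}"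
    have pow\<Gamma>: "s j [^] (n::int) \<in> \<Gamma>" for n
      using j \<Gamma> subgroup_int_pow_closed by blast
    have swap: "v \<otimes> x = x \<otimes> ([inv x; v] \<otimes> v)" "[inv x; v] \<otimes> v \<in> ?H" if "v \<in> ?H" "x \<in> \<Gamma>" for v x
    proof -
      have "v \<in> \<Gamma>" using that H\<Gamma> by auto
      then have "v \<in> carrier G" "x \<in> carrier G" "[inv x; v] \<in> ?H"
        using that comm[of "inv x" v] TH by auto
      then show "v \<otimes> x = x \<otimes> ([inv x; v] \<otimes> v)" "[inv x; v] \<otimes> v \<in> ?H"
        using that H.m_closed[of "[inv x; v]" v] by (simp_all add: commutator_def m_assoc del: H.m_closed)
    qed
    have "subgroup ?M G"
    proof (rule subgroupI)
      show "?M \<subseteq> carrier G" using sc by auto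
      show "?M \<noteq> {}" by (auto intro: generate.one)
    next
      fix a assume "a \<in> ?M"
      then obtain n v where a: "a = s j [^] (n::int) \<otimes> v" "v \<in> ?H" by blast
      have "inv a = inv v \<otimes> s j [^] (- n)"
        using a sc by (simp add: inv_mult_group int_pow_neg)
      then show "inv a \<in> ?M"
        using swap[of "inv v" "s j [^] (- n)"] a pow\<Gamma> by auto
    next
      fix a b assume "a \<in> ?M" "b \<in> ?M"
      then obtain n v m u where a: "a = s j [^] (n::int) \<otimes> v" "v \<in> ?H"
        and b: "b = s j [^] (m::int) \<otimes> u" "u \<in> ?H" by blast
      let ?v = "[inv (s j [^] m); v] \<otimes> v"
      have "a \<otimes> b = s j [^] n \<otimes> ((v \<otimes> s j [^] m) \<otimes> u)"
        using a b sc by (simp add: m_assoc)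
      also have "\<dots> = s j [^] n \<otimes> ((s j [^] m \<otimes> ?v) \<otimes> u)"
        using swap(1)[OF a(2) pow\<Gamma>[of m]] by (rule arg_cong)
      also have "\<dots> = s j [^] (n + m) \<otimes> (?v \<otimes> u)"
        using a b sc by (simp add: m_assoc int_pow_mult)
      finally show "a \<otimes> b \<in> ?M"
        using swap(2)[OF a(2) pow\<Gamma>[of m]] b by blast
    qed
    moreover have "s ` insert j J \<union> T \<subseteq> ?M"
    proof -
      have "?H \<subseteq> ?M"
      proof
        fix v assume "v \<in> ?H"
        then have "v = s j [^] (0::int) \<otimes> v" "v \<in> ?H" by auto
        then show "v \<in> ?M" by blast
      qed
      moreover have "s ` J \<union> T \<subseteq> ?H" by (auto intro: generate.incl)
      moreover have "s j = s j [^] (1::int) \<otimes> \<one>" using sc by (simp add: int_pow_1)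
      then have "s j \<in> ?M" using H.one_closed by blast
      ultimately show ?thesis by auto
    qed
    ultimately have "generate G (s ` insert j J \<union> T) \<subseteq> ?M"
      by (rule generate_subgroup_incl[rotated])
    then obtain n v where nv: "w = s j [^] (n::int) \<otimes> v" "v \<in> ?H"
      using insert.prems by blast
    have zero: "e j x = 0" if "x \<in> s ` J \<union> T" for x
      using that T(2)[OF j(1)] s(2)[OF j(1)] insert.hyps insert.prems by blast
    have "e j v = 0"
      by (rule additive_generate_zero[OF \<Gamma> add[OF j(1)] sub zero nv(2)])
    then have "n * e j (s j) = 0"
      using w(2)[OF j(1)] nv H\<Gamma> pow\<Gamma> add[OF j(1), of "s j [^] n" v]
        additive_int_pow[OF \<Gamma> add[OF j(1)] j(2)] by auto
    then have "w = v" using s(3)[OF j(1)] nv by simp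
    then show ?case using insert.IH insert.prems nv by simp
  qed simp
qed

end

section \<open>Spanning sets of commutators of weight at most four\<close>

context group
begin

text \<open>
  The rules of the Lie algebra $\bigoplus \gamma_n/\gamma_{n+1}$ in weights three and four, in the
  form needed here: for a subgroup \<open>P\<close> containing the next term of the series.
\<close>

lemma commutator_in_lower_central_2:
  "x \<in> carrier G \<Longrightarrow> y \<in> carrier G \<Longrightarrow> [x; y] \<in> \<gamma> 2"
  using commutator_lower_central[of 1 x y] by (simp add: numeral_2_eq_2)

lemma commutator_in_lower_central_3:
  "x \<in> carrier G \<Longrightarrow> y \<in> carrier G \<Longrightarrow> z \<in> carrier G \<Longrightarrow> [[x; y]; z] \<in> \<gamma> 3"
  using commutator_lower_central[of 2 "[x; y]" z] commutator_in_lower_central_2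
  by (simp add: eval_nat_numeral)

lemma commutator_in_lower_central_4:
  "x \<in> carrier G \<Longrightarrow> y \<in> carrier G \<Longrightarrow> z \<in> carrier G \<Longrightarrow> t \<in> carrier G \<Longrightarrow>
    [[[x; y]; z]; t] \<in> \<gamma> 4"
  using commutator_lower_central[of 3 "[[x; y]; z]" t] commutator_in_lower_central_3
  by (simp add: eval_nat_numeral)

lemma commutator_commutator_in_lower_central_4:
  "x \<in> carrier G \<Longrightarrow> y \<in> carrier G \<Longrightarrow> z \<in> carrier G \<Longrightarrow> t \<in> carrier G \<Longrightarrow>
    [[x; y]; [z; t]] \<in> \<gamma> 4"
  using commutator_lower_central_2[of 2 "[z; t]" "[x; y]"] commutator_in_lower_central_2
  by (simp add: eval_nat_numeral)

lemma swap_3: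
  assumes "subgroup P G" "\<gamma> 4 \<subseteq> P"
    "x \<in> carrier G" "y \<in> carrier G" "z \<in> carrier G"
  shows "[[y; x]; z] \<in> P \<longleftrightarrow> [[x; y]; z] \<in> P"
  using commutator_inv_left_iff[of 2 P "[x; y]" z] commutator_in_lower_central_2[of x y] assms
  by (simp add: eval_nat_numeral inv_commutator)

lemma Jacobi_3:
  assumes P: "subgroup P G" "\<gamma> 4 \<subseteq> P"
    and c: "x \<in> carrier G" "y \<in> carrier G" "z \<in> carrier G"
    and "[[x; y]; z] \<in> P" "[[y; z]; x] \<in> P"
  shows "[[z; x]; y] \<in> P"
proof -
  have "[[z; y]; x] \<in> P" using assms swap_3 by simp
  then have "[x; [z; y]] \<in> P" using c commutator_swap_iff[OF P(1)] by simp
  then have "[[x; z]; y] \<in> P"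
    using Jacobi_mem(2)[of 1 P x y z] assms by (simp add: eval_nat_numeral)
  then show ?thesis using assms swap_3 by simp
qed

lemma weight_3_subgroup:
  assumes "subgroup P G" "\<gamma> 5 \<subseteq> P" "t \<in> carrier G"
  shows "subgroup {v \<in> \<gamma> 3. [v; t] \<in> P} G"
    "\<gamma> 4 \<subseteq> {v \<in> \<gamma> 3. [v; t] \<in> P}"
  using subgroup_commutator_left[of 3 P t] lower_central_subset_commutator_left[of 3 P t] assms
  by (simp_all add: eval_nat_numeral)

lemma swap_4:
  assumes "subgroup P G" "\<gamma> 5 \<subseteq> P"
    "x \<in> carrier G" "y \<in> carrier G" "z \<in> carrier G" "t \<in> carrier G"
  shows "[[[y; x]; z]; t] \<in> P \<longleftrightarrow> [[[x; y]; z]; t] \<in> P"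
  using swap_3[OF weight_3_subgroup[of P t], of x y z] assms commutator_in_lower_central_3 by auto

lemma Jacobi_4:
  assumes "subgroup P G" "\<gamma> 5 \<subseteq> P"
    "x \<in> carrier G" "y \<in> carrier G" "z \<in> carrier G" "t \<in> carrier G"
    "[[[x; y]; z]; t] \<in> P" "[[[y; z]; x]; t] \<in> P"
  shows "[[[z; x]; y]; t] \<in> P"
  using Jacobi_3[OF weight_3_subgroup[of P t], of x y z] assms commutator_in_lower_central_3 by auto

lemma exchange_4:
  assumes "subgroup P G" "\<gamma> 5 \<subseteq> P"
    "x \<in> carrier G" "y \<in> carrier G" "z \<in> carrier G" "t \<in> carrier G"
    "[[[x; y]; t]; z] \<in> P" "[[x; y]; [z; t]] \<in> P"
  shows "[[[x; y]; z]; t] \<in> P"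
  using Jacobi_mem(2)[of 2 P "[x; y]" t z] assms commutator_in_lower_central_2
  by (simp add: eval_nat_numeral)

lemma commutator_22_mem:
  assumes "subgroup P G" "\<gamma> 5 \<subseteq> P"
    "x \<in> carrier G" "y \<in> carrier G" "z \<in> carrier G" "t \<in> carrier G"
    "[[[x; y]; z]; t] \<in> P" "[[[x; y]; t]; z] \<in> P"
  shows "[[x; y]; [z; t]] \<in> P" "[[z; t]; [x; y]] \<in> P"
proof -
  show "[[x; y]; [z; t]] \<in> P"
    using Jacobi_mem(1)[of 2 P "[x; y]" t z] assms commutator_in_lower_central_2
    by (simp add: eval_nat_numeral)
  then show "[[z; t]; [x; y]] \<in> P"
    using assms commutator_swap_iff[OF assms(1)] by simp
qed

lemma swap_22:
  assumes P: "subgroup P G" and c: "x \<in> carrier G" "y \<in> carrier G" "z \<in> carrier G" "t \<in> carrier G"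
    and "\<gamma> 5 \<subseteq> P"
  shows "[[y; x]; [z; t]] \<in> P \<longleftrightarrow> [[x; y]; [z; t]] \<in> P"
    "[[x; y]; [t; z]] \<in> P \<longleftrightarrow> [[x; y]; [z; t]] \<in> P"
proof -
  \<comment> \<open>$[u,v]$ with $u, v \in \gamma_2$ is bilinear modulo $\gamma_5$\<close>
  have 1: "[inv d; u] \<in> P" if d: "d \<in> \<gamma> 2" and u: "u \<in> \<gamma> 2"
    and du: "[d; u] \<in> P" for d u
  proof -
    have "[u; d] \<in> P" using du d u commutator_swap_iff[OF P] by auto
    moreover have "[u; d] \<in> \<gamma> 4"
      using commutator_lower_central_2[of 2 d u] d u by (simp add: eval_nat_numeral)
    then have "[inv d; [u; d]] \<in> P"
      using commutator_lower_central'[of 4 "[u; d]" "inv d"] d assms by auto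
    ultimately show ?thesis
      using d u subgroup.m_closed[OF P] by (simp add: commutator_inv_left[of d u])
  qed
  have 2: "[inv d; u] \<in> P \<longleftrightarrow> [d; u] \<in> P" if "d \<in> \<gamma> 2" "u \<in> \<gamma> 2" for d u
    using 1[of d u] 1[of "inv d" u] that lower_central_inv by auto
  note L = commutator_in_lower_central_2
  show *: "[[y; x]; [z; t]] \<in> P \<longleftrightarrow> [[x; y]; [z; t]] \<in> P"
    using 2[of "[x; y]" "[z; t]"] c L by (simp add: inv_commutator)
  have "[[t; z]; [x; y]] \<in> P \<longleftrightarrow> [[z; t]; [x; y]] \<in> P"
    using 2[of "[z; t]" "[x; y]"] c L by (simp add: inv_commutator)
  then show "[[x; y]; [t; z]] \<in> P \<longleftrightarrow> [[x; y]; [z; t]] \<in> P"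
    using c commutator_swap_iff[OF P] by simp
qed

text \<open>
  Modulo $\gamma_4$, antisymmetry and the Jacobi identity bring a minimal letter to the front. The
  two families correspond to the multiplicity of the minimal letter, one or two; in this form each
  commutator is singled out by one word of its expansion.
\<close>

lemma spanning_weight_3:
  assumes P: "subgroup P G" "\<gamma> 4 \<subseteq> P" and Y: "Y \<subseteq> carrier G"
    and lt: "\<And>x y. x \<noteq> y \<Longrightarrow> lt x y \<or> lt y x" "\<And>x y z. lt x y \<Longrightarrow> lt y z \<Longrightarrow> lt x z"
    and 1: "\<And>m p q. m \<in> Y \<Longrightarrow> p \<in> Y \<Longrightarrow> q \<in> Y \<Longrightarrow> lt m p \<Longrightarrow> lt m q \<Longrightarrow> [[m; p]; q] \<in> P"
    and 2: "\<And>m p. m \<in> Y \<Longrightarrow> p \<in> Y \<Longrightarrow> lt m p \<Longrightarrow> [[p; m]; m] \<in> P"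
    and xyz: "x \<in> Y" "y \<in> Y" "z \<in> Y"
  shows "[[x; y]; z] \<in> P"
proof -
  have main: "[[x; y]; z] \<in> P" if Y': "x \<in> Y" "y \<in> Y" "z \<in> Y" and "lt x y" for x y z
  proof -
    have c: "x \<in> carrier G" "y \<in> carrier G" "z \<in> carrier G" using Y' Y by auto
    consider "z = x" | "lt x z" | "lt z x" using lt(1) by blast
    then show ?thesis
    proof cases
      case 1
      then show ?thesis using 2[of x y] swap_3[OF P] c Y' that by simp
    next
      case 2
      then show ?thesis using 1 that by blast
    next
      case 3
      then have "lt z y" using that lt(2) by blast
      then have "[[z; x]; y] \<in> P" "[[z; y]; x] \<in> P" using 3 1 that by blast+
      then show ?thesis using Jacobi_3[OF P, of y z x] swap_3[OF P] c by simp
    qed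
  qed
  have c: "x \<in> carrier G" "y \<in> carrier G" "z \<in> carrier G" using xyz Y by auto
  consider "x = y" | "lt x y" | "lt y x" using lt(1) by blast
  then show ?thesis
  proof cases
    case 1
    have "[\<one>; z] = \<one>" using c by (simp add: commutator_def)
    then show ?thesis using 1 c commutator_self subgroup.one_closed[OF P(1)] by simp
  qed (use main[of x y z] main[of y x z] xyz swap_3[OF P] c in auto)
qed

text \<open>
  As in weight three, the families are distinguished by the multiplicity of the minimal letter
  \<open>m\<close>: it is one in the first family, two in the next two and three in the last. All
  commutators are brought to this form by moving minimal letters to the front, at the cost of
  commutators $[[x,y],[z,t]]$.
\<close>

lemma spanning_weight_4:
  assumes P: "subgroup P G" "\<gamma> 5 \<subseteq> P" and Y: "Y \<subseteq> carrier G"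
    and lt: "\<And>x y. x \<noteq> y \<Longrightarrow> lt x y \<or> lt y x" "\<And>x y z. lt x y \<Longrightarrow> lt y z \<Longrightarrow> lt x z"
    and 1: "\<And>m p q r. \<lbrakk>m \<in> Y; p \<in> Y; q \<in> Y; r \<in> Y; lt m p; lt m q; lt m r\<rbrakk> \<Longrightarrow> [[[m; p]; q]; r] \<in> P"
    and 2: "\<And>m p q. \<lbrakk>m \<in> Y; p \<in> Y; q \<in> Y; lt m p; lt m q\<rbrakk> \<Longrightarrow> [[[p; m]; m]; q] \<in> P"
    and 3: "\<And>m p q. \<lbrakk>m \<in> Y; p \<in> Y; q \<in> Y; lt m p; lt m q; lt q p\<rbrakk> \<Longrightarrow> [[p; m]; [q; m]] \<in> P"
    and 4: "\<And>m p. \<lbrakk>m \<in> Y; p \<in> Y; lt m p\<rbrakk> \<Longrightarrow> [[[p; m]; m]; m] \<in> P"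
    and xyz: "x \<in> Y" "y \<in> Y" "z \<in> Y" "t \<in> Y"
  shows "[[[x; y]; z]; t] \<in> P"
proof -
  have c[simp]: "x \<in> carrier G" if "x \<in> Y" for x using that Y by auto
  \<comment> \<open>a strictly minimal last letter can be moved to the front\<close>
  have last: "[[[x; y]; z]; t] \<in> P"
    if Y': "x \<in> Y" "y \<in> Y" "z \<in> Y" "t \<in> Y" and "lt t x" "lt t y" "lt t z" for x y z t
  proof (rule exchange_4[OF P])
    have "[[[t; x]; y]; z] \<in> P" "[[[y; t]; x]; z] \<in> P"
      using 1 that swap_4[OF P] by auto
    then show "[[[x; y]; t]; z] \<in> P"
      using Jacobi_4[OF P, of y t x z] Y' by simp
    have "[[[z; t]; x]; y] \<in> P" "[[[z; t]; y]; x] \<in> P"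
      using 1 that swap_4[OF P] by auto
    then show "[[x; y]; [z; t]] \<in> P"
      using commutator_22_mem[OF P] Y' by simp
  qed (use Y' in auto)
  have pm: "[[p; m]; [q; m]] \<in> P" if "m \<in> Y" "p \<in> Y" "q \<in> Y" "lt m p" "lt m q" for m p q
  proof -
    consider "p = q" | "lt q p" | "lt p q" using lt(1) by blast
    then show ?thesis
    proof cases
      case 1
      then show ?thesis using that by (simp add: commutator_self subgroup.one_closed[OF P(1)])
    next
      case 2
      then show ?thesis using 3 that by blast
    next
      case 3
      then have "[[q; m]; [p; m]] \<in> P" using assms(8)[of m q p] that by blast
      then show ?thesis using commutator_swap_iff[OF P(1), of "[p; m]" "[q; m]"] that by simp
    qed
  qed
  have mpq: "[[[m; p]; q]; t] \<in> P" if Y': "m \<in> Y" "p \<in> Y" "q \<in> Y" "t \<in> Y" and "lt m p" "lt m q" for m p q t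
  proof -
    consider "t = m" | "lt m t" | "lt t m" using lt(1) by blast
    then show ?thesis
    proof cases
      case 1
      have "[[[m; p]; m]; q] \<in> P" using 2[of m p q] swap_4[OF P] that by simp
      moreover have "[[m; p]; [q; m]] \<in> P" using pm[of m p q] swap_22[OF P(1) _ _ _ _ P(2)] that by simp
      ultimately show ?thesis unfolding 1 using Y' by - (rule exchange_4[OF P], auto)
    next
      case 2
      then show ?thesis using 1 that by blast
    next
      case 3
      then show ?thesis using last that lt(2) by blast
    qed
  qed
  have pmm: "[[[p; m]; m]; t] \<in> P" if Y': "m \<in> Y" "p \<in> Y" "t \<in> Y" and "lt m p" for m p t
  proof -
    consider "t = m" | "lt m t" | "lt t m" using lt(1) by blast
    then show ?thesis
    proof cases
      case 1
      then show ?thesis using 4 that by blast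
    next
      case 2
      then show ?thesis using assms(7) that by blast
    next
      case 3
      then show ?thesis using last that lt(2) by blast
    qed
  qed
  have "[[x; y]; z] \<in> {v \<in> \<gamma> 3. [v; t] \<in> P}"
    by (rule spanning_weight_3[OF weight_3_subgroup[OF P c] Y, of t lt, OF xyz(4) xyz(4) lt])
       (use xyz in \<open>simp_all add: commutator_in_lower_central_3 mpq pmm\<close>)
  then show ?thesis by simp
qed

text \<open>
  Here \<open>P\<close> contains the commutators $[x,a,a',a'']$ and $[[x,a],[x',a']]$ with letters
  $a, a', a''$ from \<open>A\<close>. Modulo these, what remains of weight four is spanned by the commutators
  whose letters come, in this order, from $ABBA$, $ABBB$ and $BBBB$.
\<close>

lemma spanning_weight_4_relative:
  assumes P: "subgroup P G" "\<gamma> 5 \<subseteq> P" and AB: "A \<subseteq> carrier G" "B \<subseteq> carrier G"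
    and K1: "\<And>x a a' a''. \<lbrakk>x \<in> A \<union> B; a \<in> A; a' \<in> A; a'' \<in> A\<rbrakk> \<Longrightarrow> [[[x; a]; a']; a''] \<in> P"
    and K2: "\<And>x x' a a'. \<lbrakk>x \<in> A \<union> B; x' \<in> A \<union> B; a \<in> A; a' \<in> A\<rbrakk> \<Longrightarrow> [[x; a]; [x'; a']] \<in> P"
    and T2: "\<And>a b b' a'. \<lbrakk>a \<in> A; b \<in> B; b' \<in> B; a' \<in> A\<rbrakk> \<Longrightarrow> [[[a; b]; b']; a'] \<in> P"
    and T1: "\<And>a b b' b''. \<lbrakk>a \<in> A; b \<in> B; b' \<in> B; b'' \<in> B\<rbrakk> \<Longrightarrow> [[[a; b]; b']; b''] \<in> P"
    and T0: "\<And>b1 b2 b3 b4. \<lbrakk>b1 \<in> B; b2 \<in> B; b3 \<in> B; b4 \<in> B\<rbrakk> \<Longrightarrow> [[[b1; b2]; b3]; b4] \<in> P"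
    and xyzt: "x \<in> A \<union> B" "y \<in> A \<union> B" "z \<in> A \<union> B" "t \<in> A \<union> B"
  shows "[[[x; y]; z]; t] \<in> P"
proof -
  have c[simp]: "x \<in> carrier G" if "x \<in> A" for x using that AB by auto
  have c'[simp]: "x \<in> carrier G" if "x \<in> B" for x using that AB by auto
  note swap = swap_4[OF P] and Jacobi = Jacobi_4[OF P] and exchange = exchange_4[OF P]
  note swap22 = swap_22[OF P(1) _ _ _ _ P(2)]
  \<comment> \<open>the names of the facts record from which of the two sets the four letters are taken\<close>
  have ABAB: "[[[a; b]; a']; b'] \<in> P" if "a \<in> A" "b \<in> B" "a' \<in> A" "b' \<in> B" for a b a' b'
    using that T2[of a b b' a'] K2[of b b' a a'] swap22
    by - (rule exchange, auto)
  have ABAA: "[[[a; b]; a']; a''] \<in> P" if "a \<in> A" "b \<in> B" "a' \<in> A" "a'' \<in> A" for a b a' a''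
    using that K1[of b a a' a''] swap by auto
  have AABA: "[[[a; a']; b]; a''] \<in> P" if "a \<in> A" "b \<in> B" "a' \<in> A" "a'' \<in> A" for a b a' a''
    using that K1[of b a a' a''] ABAA[of a' b a a''] by - (rule Jacobi[of a' b a a''], auto)
  have AAAB: "[[[a; a']; a'']; b] \<in> P" if "a \<in> A" "b \<in> B" "a' \<in> A" "a'' \<in> A" for a b a' a''
    using that AABA[of a b a' a''] K2[of a b a' a''] swap22 by - (rule exchange, auto)
  have AABB: "[[[a; a']; b]; b'] \<in> P" if "a \<in> A" "b \<in> B" "a' \<in> A" "b' \<in> B" for a b a' b'
    using that ABAB[of a' b a b'] ABAB[of a b a' b'] swap by - (rule Jacobi[of a' b a b'], auto)
  have BBAB: "[[[b; b']; a]; b''] \<in> P" if "a \<in> A" "b \<in> B" "b' \<in> B" "b'' \<in> B" for a b b' b''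
    using that T1[of a b' b b''] T1[of a b b' b''] swap by - (rule Jacobi[of b' a b b''], auto)
  have BBAA: "[[[b; b']; a]; a'] \<in> P" if "a \<in> A" "b \<in> B" "b' \<in> B" "a' \<in> A" for a b b' a'
    using that T2[of a b' b a'] T2[of a b b' a'] swap by - (rule Jacobi[of b' a b a'], auto)
  have BBBA: "[[[b; b']; b'']; a] \<in> P" if "a \<in> A" "b \<in> B" "b' \<in> B" "b'' \<in> B" for a b b' b''
    using that BBAB[of a b b' b''] commutator_22_mem(2)[OF P, of a b'' b b']
      T1[of a b'' b b'] T1[of a b'' b' b] swap22
    by - (rule exchange, auto)
  have AB: "[[[a; b]; z]; t] \<in> P" if "a \<in> A" "b \<in> B" for a b
    using xyzt(3,4) that by (elim UnE) (simp_all add: T1 T2 ABAB ABAA)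
  consider "x \<in> A" "y \<in> A" | "x \<in> A" "y \<in> B" | "x \<in> B" "y \<in> A" | "x \<in> B" "y \<in> B"
    using xyzt by blast
  then show ?thesis
  proof cases
    case 1
    then show ?thesis using xyzt(3,4) by (elim UnE) (simp_all add: K1 AABA AAAB AABB)
  next
    case 2
    then show ?thesis by (rule AB)
  next
    case 3
    then have "[[[y; x]; z]; t] \<in> P" using AB by blast
    then show ?thesis using swap[of y x z t] 3 xyzt by auto
  next
    case 4
    then show ?thesis using xyzt(3,4) by (elim UnE) (simp_all add: T0 BBAB BBAA BBBA)
  qed
qed

end

section \<open>Subgroups of free groups are projective\<close>

text \<open>
  Evaluation of words twisted by an action: the point \<open>c\<close> moves along while the letters are read,
  so the values satisfy a cocycle identity instead of multiplicativity.
\<close>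

fun word_cocycle ::
    "('e, 'f) monoid_scheme \<Rightarrow> ('c \<Rightarrow> 'l \<Rightarrow> 'e) \<Rightarrow> ('c \<Rightarrow> 'l \<Rightarrow> 'c) \<Rightarrow> 'c \<Rightarrow> 'l list \<Rightarrow> 'e" where
  "word_cocycle E \<sigma> act c [] = \<one>\<^bsub>E\<^esub>"
| "word_cocycle E \<sigma> act c (l # w) = \<sigma> c l \<otimes>\<^bsub>E\<^esub> word_cocycle E \<sigma> act (act c l) w"

text \<open>
  Left multiplication by a letter in the free group, in terms of reduced words.
\<close>

fun cons_reduced :: "bool \<times> 'a \<Rightarrow> (bool \<times> 'a) list \<Rightarrow> (bool \<times> 'a) list" where
  "cons_reduced l [] = [l]"
| "cons_reduced l (m # w) = (if m = (\<not> fst l, snd l) then w else l # m # w)"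

lemma reduced_word_cons_reduced:
  "reduced_word w \<Longrightarrow> reduced_word (cons_reduced l w)"
proof (cases w)
  case (Cons m v)
  assume "reduced_word w"
  then show ?thesis
    by (cases v; cases l; cases m) (auto simp: Cons reduced_word_def)
qed (simp add: reduced_word_def)

lemma cons_reduced_lists:
  "l \<in> UNIV \<times> B \<Longrightarrow> w \<in> lists (UNIV \<times> B) \<Longrightarrow> cons_reduced l w \<in> lists (UNIV \<times> B)"
  by (cases w) auto

lemma word_value_simps [simp]:
  "word_value F [] = \<one>\<^bsub>F\<^esub>"
  "word_value F (l # w) = letter_value F l \<otimes>\<^bsub>F\<^esub> word_value F w"
  by (simp_all add: word_value_def)

text \<open>
  The universal property of a free basis, twisted by the right translation action of \<open>F\<close> on itself.
  A function with this cocycle identity is the same as a homomorphism from \<open>F\<close> to the unrestricted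
  wreath product of \<open>E\<close> with \<open>F\<close> that is the identity on \<open>F\<close>. It exists since multiplying a reduced
  word by a letter and cancelling does not change the twisted value.
\<close>

lemma free_basis_cocycle:
  fixes F :: "('a, 'b) monoid_scheme" (structure) and E :: "('e, 'f) monoid_scheme"
  assumes "group F" and basis: "free_basis F B" and "group E"
    and \<sigma>: "\<And>c x. c \<in> carrier F \<Longrightarrow> x \<in> B \<Longrightarrow> \<sigma> c x \<in> carrier E"
  obtains k where "\<And>c g. c \<in> carrier F \<Longrightarrow> g \<in> carrier F \<Longrightarrow> k c g \<in> carrier E"
    and "\<And>c g h. c \<in> carrier F \<Longrightarrow> g \<in> carrier F \<Longrightarrow> h \<in> carrier F \<Longrightarrow>
          k c (g \<otimes> h) = k c g \<otimes>\<^bsub>E\<^esub> k (c \<otimes> g) h"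
    and "\<And>c x. c \<in> carrier F \<Longrightarrow> x \<in> B \<Longrightarrow> k c x = \<sigma> c x"
proof -
  interpret F: group F by fact
  interpret E: group E by fact
  let ?L = "UNIV \<times> B :: (bool \<times> 'a) set"
  let ?W = "{w \<in> lists ?L. reduced_word w}"
  have B: "B \<subseteq> carrier F" and bij: "bij_betw (word_value F) ?W (carrier F)"
    using basis by (auto simp: free_basis_def)
  define nf where "nf = inv_into ?W (word_value F)"
  have nf: "nf g \<in> ?W" "word_value F (nf g) = g" if "g \<in> carrier F" for g
    using that bij bij_betw_inv_into_right[OF bij that]
      bij_betw_apply[OF bij_betw_inv_into[OF bij] that] unfolding nf_def by auto
  have nf_eq: "nf g = w" if "w \<in> ?W" "word_value F w = g" for g w
    using that bij bij_betw_inv_into_left[OF bij that(1)] unfolding nf_def by auto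
  have lv: "letter_value F l \<in> carrier F" if "l \<in> ?L" for l
    using that B by (auto simp: letter_value_def)
  have wv: "word_value F w \<in> carrier F" if "w \<in> lists ?L" for w
    using that by (induction w) (auto simp: lv)
  define s where "s c l = (if fst l then \<sigma> c (snd l) else inv\<^bsub>E\<^esub> \<sigma> (c \<otimes> inv snd l) (snd l))" for c l
  define ev where "ev = word_cocycle E s (\<lambda>c l. c \<otimes> letter_value F l)"
  have ev_simps [simp]: "ev c [] = \<one>\<^bsub>E\<^esub>" "ev c (l # w) = s c l \<otimes>\<^bsub>E\<^esub> ev (c \<otimes> letter_value F l) w" for c l w
    by (simp_all add: ev_def)
  have s: "s c l \<in> carrier E" if "c \<in> carrier F" "l \<in> ?L" for c l
    using that B \<sigma> by (auto simp: s_def)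
  have ev: "ev c w \<in> carrier E" if "c \<in> carrier F" "w \<in> lists ?L" for c w
    using that(2,1) by (induction w arbitrary: c) (auto simp: s lv)
  have cancel: "letter_value F l \<otimes> letter_value F (\<not> fst l, snd l) = \<one>"
      "s c l \<otimes>\<^bsub>E\<^esub> s (c \<otimes> letter_value F l) (\<not> fst l, snd l) = \<one>\<^bsub>E\<^esub>"
    if "c \<in> carrier F" "l \<in> ?L" for c l
    using that B \<sigma> by (auto simp: letter_value_def s_def F.m_assoc)
  have red: "word_value F (cons_reduced l w) = letter_value F l \<otimes> word_value F w"
      "ev c (cons_reduced l w) = ev c (l # w)"
    if "c \<in> carrier F" "l \<in> ?L" "w \<in> lists ?L" for c l w
  proof -
    have "word_value F (cons_reduced l w) = letter_value F l \<otimes> word_value F w \<and>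
      ev c (cons_reduced l w) = ev c (l # w)"
    proof (cases w)
      case (Cons m v)
      show ?thesis
      proof (cases "m = (\<not> fst l, snd l)")
        case True
        have mL: "m \<in> ?L" "v \<in> lists ?L" using that Cons by auto
        have "letter_value F l \<otimes> (letter_value F m \<otimes> word_value F v) = word_value F v"
          using cancel(1)[OF that(1,2)] True lv[OF that(2)] lv[OF mL(1)] wv[OF mL(2)]
          by (simp flip: F.m_assoc)
        moreover have "c \<otimes> letter_value F l \<otimes> letter_value F m = c"
          using cancel(1)[OF that(1,2)] True lv[OF that(2)] lv[OF mL(1)] that
          by (simp add: F.m_assoc)
        then have "s c l \<otimes>\<^bsub>E\<^esub> (s (c \<otimes> letter_value F l) m \<otimes>\<^bsub>E\<^esub>
            ev (c \<otimes> letter_value F l \<otimes> letter_value F m) v) = ev c v"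
          using cancel(2)[OF that(1,2)] True s[OF that(1,2)] s[of "c \<otimes> letter_value F l" m]
            lv[OF that(2)] mL ev[of c v] that
          by (simp flip: E.m_assoc)
        ultimately show ?thesis using True by (simp add: Cons)
      qed (simp add: Cons)
    qed simp
    then show "word_value F (cons_reduced l w) = letter_value F l \<otimes> word_value F w"
      "ev c (cons_reduced l w) = ev c (l # w)" by blast+
  qed
  define k where "k c g = ev c (nf g)" for c g
  have k: "k c g \<in> carrier E" if "c \<in> carrier F" "g \<in> carrier F" for c g
    using that nf ev by (auto simp: k_def)
  have k_letter: "k c (letter_value F l \<otimes> g) = s c l \<otimes>\<^bsub>E\<^esub> k (c \<otimes> letter_value F l) g"
    if "c \<in> carrier F" "l \<in> ?L" "g \<in> carrier F" for c l g
  proof -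
    have g: "nf g \<in> lists ?L" "reduced_word (nf g)" "word_value F (nf g) = g"
      using nf that by auto
    have "nf (letter_value F l \<otimes> g) = cons_reduced l (nf g)"
      using red(1)[OF that(1,2) g(1)] g reduced_word_cons_reduced[OF g(2), of l] cons_reduced_lists[OF that(2) g(1)]
      by (intro nf_eq) auto
    then show ?thesis using red(2)[OF that(1,2) g(1)] by (simp add: k_def)
  qed
  have k_word: "k c (word_value F w \<otimes> g) = ev c w \<otimes>\<^bsub>E\<^esub> k (c \<otimes> word_value F w) g"
    if "c \<in> carrier F" "w \<in> lists ?L" "g \<in> carrier F" for c w g
    using that(2,1)
  proof (induction w arbitrary: c)
    case Nil
    then show ?case using that k by simp
  next
    case (Cons l w)
    then have "k c (letter_value F l \<otimes> (word_value F w \<otimes> g)) =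
        s c l \<otimes>\<^bsub>E\<^esub> (ev (c \<otimes> letter_value F l) w \<otimes>\<^bsub>E\<^esub>
          k (c \<otimes> letter_value F l \<otimes> word_value F w) g)"
      using that lv wv by (simp add: k_letter)
    then show ?case
      using Cons that lv wv s ev k by (simp add: F.m_assoc E.m_assoc)
  qed
  show ?thesis
  proof (rule that)
    show "k c (g \<otimes> h) = k c g \<otimes>\<^bsub>E\<^esub> k (c \<otimes> g) h"
      if "c \<in> carrier F" "g \<in> carrier F" "h \<in> carrier F" for c g h
      using k_word[OF that(1) _ that(3), of "nf g"] nf[OF that(2)] by (simp add: k_def)
    show "k c x = \<sigma> c x" if "c \<in> carrier F" "x \<in> B" for c x
    proof -
      have "nf \<one> = []" by (rule nf_eq) (auto simp: reduced_word_def)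
      then show ?thesis
        using k_letter[of c "(True, x)" "\<one>"] that B \<sigma> by (auto simp: letter_value_def s_def k_def)
    qed
  qed (use k in auto)
qed

lemma free_basis_generates:
  assumes "group F" "free_basis F B"
  shows "generate F B = carrier F"
proof -
  interpret F: group F by fact
  have B: "B \<subseteq> carrier F" using assms by (auto simp: free_basis_def)
  have "word_value F w \<in> generate F B" if "w \<in> lists (UNIV \<times> B)" for w
    using that
    by (induction w) (auto simp: letter_value_def intro: generate.one generate.eng[OF generate.incl] generate.eng[OF generate.inv])
  then have "word_value F ` {w \<in> lists (UNIV \<times> B). reduced_word w} \<subseteq> generate F B" by auto
  then have "carrier F \<subseteq> generate F B"
    using assms by (simp add: free_basis_def bij_betw_def)
  then show ?thesis using F.generate_incl[OF B] by blast
qed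

text \<open>Used to identify a lifted cocycle from its values on a generating set.\<close>

lemma cocycle_unique:
  fixes F :: "('a, 'b) monoid_scheme" (structure) and E :: "('e, 'f) monoid_scheme"
  assumes "group F" "group E" and gen: "generate F B = carrier F" "B \<subseteq> carrier F"
    and k: "\<And>c g. c \<in> carrier F \<Longrightarrow> g \<in> carrier F \<Longrightarrow> k c g \<in> carrier E"
      "\<And>c g h. c \<in> carrier F \<Longrightarrow> g \<in> carrier F \<Longrightarrow> h \<in> carrier F \<Longrightarrow>
          k c (g \<otimes> h) = k c g \<otimes>\<^bsub>E\<^esub> k (c \<otimes> g) h"
    and k': "\<And>c g. c \<in> carrier F \<Longrightarrow> g \<in> carrier F \<Longrightarrow> k' c g \<in> carrier E"
      "\<And>c g h. c \<in> carrier F \<Longrightarrow> g \<in> carrier F \<Longrightarrow> h \<in> carrier F \<Longrightarrow>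
          k' c (g \<otimes> h) = k' c g \<otimes>\<^bsub>E\<^esub> k' (c \<otimes> g) h"
    and eq: "\<And>c x. c \<in> carrier F \<Longrightarrow> x \<in> B \<Longrightarrow> k c x = k' c x"
    and cg: "c \<in> carrier F" "g \<in> carrier F"
  shows "k c g = k' c g"
proof -
  interpret F: group F by fact
  interpret E: group E by fact
  have idem: "x = \<one>\<^bsub>E\<^esub>" if "x \<in> carrier E" "x = x \<otimes>\<^bsub>E\<^esub> x" for x
    using that E.l_cancel[of x x "\<one>\<^bsub>E\<^esub>"] by simp
  have k_one: "k c \<one> = \<one>\<^bsub>E\<^esub>" "k' c \<one> = \<one>\<^bsub>E\<^esub>" if "c \<in> carrier F" for c
    using k(2)[OF that F.one_closed F.one_closed] k'(2)[OF that F.one_closed F.one_closed]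
    unfolding F.r_one[OF that] F.l_one[OF F.one_closed]
    by (blast intro: idem k(1) k'(1) F.one_closed that)+
  have k_inv: "k c (inv g) = inv\<^bsub>E\<^esub> k (c \<otimes> inv g) g"
    "k' c (inv g) = inv\<^bsub>E\<^esub> k' (c \<otimes> inv g) g"
    if "c \<in> carrier F" "g \<in> carrier F" for c g
    using that k(2)[of c "inv g" g] k'(2)[of c "inv g" g] k_one k(1) k'(1)
    by (auto intro!: E.inv_equality[symmetric])
  have "g \<in> generate F B" using gen cg by simp
  then have "g \<in> carrier F \<and> (\<forall>c \<in> carrier F. k c g = k' c g)"
  proof (induction rule: generate.induct)
    case one
    then show ?case using k_one by simp
  next
    case (incl h)
    then show ?case using eq gen by blast
  next
    case (inv h)
    then have "h \<in> carrier F" using gen by blast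
    then show ?case using k_inv eq \<open>h \<in> B\<close> by simp
  next
    case (eng h1 h2)
    then show ?case using k(2) k'(2) by simp
  qed
  then show ?thesis using cg by blast
qed

corollary free_basis_extend_hom:
  fixes F :: "('a, 'b) monoid_scheme" (structure) and E :: "('e, 'f) monoid_scheme"
  assumes "group F" "free_basis F B" "group E" and \<sigma>: "\<And>x. x \<in> B \<Longrightarrow> \<sigma> x \<in> carrier E"
  obtains h where "h \<in> hom F E" "\<And>x. x \<in> B \<Longrightarrow> h x = \<sigma> x"
proof -
  interpret F: group F by fact
  interpret E: group E by fact
  have B: "B \<subseteq> carrier F" using assms by (auto simp: free_basis_def)
  obtain k where k: "\<And>c g. c \<in> carrier F \<Longrightarrow> g \<in> carrier F \<Longrightarrow> k c g \<in> carrier E"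
    "\<And>c g h. c \<in> carrier F \<Longrightarrow> g \<in> carrier F \<Longrightarrow> h \<in> carrier F \<Longrightarrow>
          k c (g \<otimes> h) = k c g \<otimes>\<^bsub>E\<^esub> k (c \<otimes> g) h"
    "\<And>c x. c \<in> carrier F \<Longrightarrow> x \<in> B \<Longrightarrow> k c x = \<sigma> x"
    by (rule free_basis_cocycle[OF assms(1,2,3), of "\<lambda>c x. \<sigma> x"]) (use \<sigma> in blast)+
  have const: "k c g = k (d \<otimes> c) g" if "c \<in> carrier F" "d \<in> carrier F" "g \<in> carrier F" for c d g
    by (rule cocycle_unique[OF assms(1,3) free_basis_generates[OF assms(1,2)] B, of k "\<lambda>c g. k (d \<otimes> c) g"])
       (use that k in \<open>auto simp: F.m_assoc\<close>)
  have "k \<one> \<in> hom F E"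
  proof (rule homI)
    fix g h assume "g \<in> carrier F" "h \<in> carrier F"
    then show "k \<one> (g \<otimes> h) = k \<one> g \<otimes>\<^bsub>E\<^esub> k \<one> h"
      using k(2)[of "\<one>" g h] const[of "\<one>" g h] by simp
  qed (simp add: k(1))
  then show ?thesis using that k by auto
qed

text \<open>
  A choice \<open>t\<close> of coset representatives turns \<open>F\<close> into a group of monomial matrices over \<open>R\<close>, with
  entries $\kappa(c,g) = t(c)\, g\, t(cg)^{-1}$, and $\kappa(1,r) = r$ for $r \in R$. Lift the values
  of $f \circ \kappa$ on a free basis through \<open>p\<close> and extend to a cocycle; its restriction to the
  coset of the identity is the required homomorphism. Any system of representatives
  will do, provided that \<open>R\<close> itself is represented by the identity.
\<close>

theorem subgroup_of_free_group_projective: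
  fixes F :: "('a, 'b) monoid_scheme" (structure) and E :: "('e, 'f) monoid_scheme" and Q :: "('q, 'r) monoid_scheme"
  assumes F: "free_group F" and R: "subgroup R F" and "group E" "group Q"
    and p: "p \<in> hom E Q" "p ` carrier E = carrier Q"
    and f: "f \<in> hom (F\<lparr>carrier := R\<rparr>) Q"
  obtains h where "h \<in> hom (F\<lparr>carrier := R\<rparr>) E" "\<And>r. r \<in> R \<Longrightarrow> p (h r) = f r"
proof -
  interpret F: group F using F by (simp add: free_group_def)
  interpret E: group E by fact
  interpret Q: group Q by fact
  interpret R: subgroup R F by fact
  interpret p: group_hom E Q p using p by unfold_locales
  obtain B where B: "free_basis F B" using F by (auto simp: free_group_def)
  have BF: "B \<subseteq> carrier F" using B by (auto simp: free_basis_def)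
  \<comment> \<open>\<open>t g\<close> is the chosen representative of the coset \<open>R g\<close>\<close>
  define t where "t g = (if g \<in> R then \<one> else SOME h. h \<in> R #> g)" for g
  have t: "t g \<in> R #> g" if "g \<in> carrier F" for g
  proof (cases "g \<in> R")
    case True
    then show ?thesis using F.coset_join2[OF that R] by (simp add: t_def)
  next
    case False
    have "g \<in> R #> g" using F.rcos_self[OF that R] .
    then show ?thesis using False by (auto simp: t_def intro: someI)
  qed
  have tF: "t g \<in> carrier F" if "g \<in> carrier F" for g
    using t[OF that] that F.r_coset_subset_G[OF R.subset] by blast
  have t_coset: "t (r \<otimes> g) = t g" if "r \<in> R" "g \<in> carrier F" for r g
  proof -
    have "R #> (r \<otimes> g) = R #> g"
      using that F.coset_mult_assoc[OF R.subset, of r g] F.coset_join2[OF _ R, of r] by auto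
    moreover have "r \<otimes> g \<in> R \<longleftrightarrow> g \<in> R"
    proof
      assume "r \<otimes> g \<in> R"
      then have "inv r \<otimes> (r \<otimes> g) \<in> R"
        by (rule R.m_closed[OF R.m_inv_closed[OF that(1)]])
      then show "g \<in> R" using that by simp
    qed (use that in auto)
    ultimately show ?thesis by (simp add: t_def)
  qed
  define \<kappa> where "\<kappa> c g = t c \<otimes> g \<otimes> inv t (c \<otimes> g)" for c g
  have \<kappa>: "\<kappa> c g \<in> R" if cg: "c \<in> carrier F" "g \<in> carrier F" for c g
  proof -
    obtain r where r: "r \<in> R" "t c = r \<otimes> c" using t[OF cg(1)] by (auto simp: r_coset_def)
    obtain r' where r': "r' \<in> R" "t (c \<otimes> g) = r' \<otimes> (c \<otimes> g)"
      using t[of "c \<otimes> g"] cg by (auto simp: r_coset_def)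
    have "\<kappa> c g = r \<otimes> inv r'"
      using r r' cg by (simp add: \<kappa>_def F.inv_mult_group F.m_assoc)
    then show ?thesis using r r' by simp
  qed
  have \<kappa>_cocycle: "\<kappa> c (g \<otimes> h) = \<kappa> c g \<otimes> \<kappa> (c \<otimes> g) h"
    if "c \<in> carrier F" "g \<in> carrier F" "h \<in> carrier F" for c g h
    using that tF by (simp add: \<kappa>_def F.m_assoc)
  have \<kappa>_coset: "\<kappa> (r \<otimes> c) g = \<kappa> c g" if "r \<in> R" "c \<in> carrier F" "g \<in> carrier F" for r c g
    using that t_coset by (simp add: \<kappa>_def F.m_assoc)
  have \<kappa>_R: "\<kappa> \<one> r = r" if "r \<in> R" for r
    using that by (simp add: \<kappa>_def t_def)
  define \<sigma> where "\<sigma> c x = (SOME e. e \<in> carrier E \<and> p e = f (\<kappa> c x))" for c x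
  have \<sigma>: "\<sigma> c x \<in> carrier E \<and> p (\<sigma> c x) = f (\<kappa> c x)" if "c \<in> carrier F" "x \<in> carrier F" for c x
  proof -
    have "f (\<kappa> c x) \<in> p ` carrier E"
      using p(2) f \<kappa>[OF that] by (auto simp: hom_def)
    then have "\<exists>e. e \<in> carrier E \<and> p e = f (\<kappa> c x)" by auto
    then show ?thesis unfolding \<sigma>_def by (rule someI_ex)
  qed
  obtain k where k: "\<And>c g. c \<in> carrier F \<Longrightarrow> g \<in> carrier F \<Longrightarrow> k c g \<in> carrier E"
    "\<And>c g h. c \<in> carrier F \<Longrightarrow> g \<in> carrier F \<Longrightarrow> h \<in> carrier F \<Longrightarrow>
          k c (g \<otimes> h) = k c g \<otimes>\<^bsub>E\<^esub> k (c \<otimes> g) h"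
    "\<And>c x. c \<in> carrier F \<Longrightarrow> x \<in> B \<Longrightarrow> k c x = \<sigma> c x"
    by (rule free_basis_cocycle[OF F.is_group B \<open>group E\<close>, of \<sigma>]) (use \<sigma> BF in blast)+
  note unique = cocycle_unique[OF F.is_group _ free_basis_generates[OF F.is_group B] BF]
  have k_coset: "k c g = k (r \<otimes> c) g" if "r \<in> R" "c \<in> carrier F" "g \<in> carrier F" for r c g
  proof (rule unique[OF \<open>group E\<close>, of k "\<lambda>c g. k (r \<otimes> c) g"])
    show "k c x = k (r \<otimes> c) x" if "c \<in> carrier F" "x \<in> B" for c x
    proof -
      have "\<sigma> (r \<otimes> c) x = \<sigma> c x"
        using \<kappa>_coset[OF \<open>r \<in> R\<close> that(1), of x] that BF by (auto simp: \<sigma>_def)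
      then show ?thesis using k(3) that \<open>r \<in> R\<close> by simp
    qed
  qed (use that k in \<open>auto simp: F.m_assoc\<close>)
  have pk: "p (k c g) = f (\<kappa> c g)" if "c \<in> carrier F" "g \<in> carrier F" for c g
  proof (rule unique[OF \<open>group Q\<close>, of "\<lambda>c g. p (k c g)" "\<lambda>c g. f (\<kappa> c g)"])
    show "p (k c x) = f (\<kappa> c x)" if "c \<in> carrier F" "x \<in> B" for c x
      using k(3) \<sigma> that BF by auto
    show "f (\<kappa> c g) \<in> carrier Q" if "c \<in> carrier F" "g \<in> carrier F" for c g
      using f \<kappa>[OF that] by (auto simp: hom_def)
    show "f (\<kappa> c (g \<otimes> h)) = f (\<kappa> c g) \<otimes>\<^bsub>Q\<^esub> f (\<kappa> (c \<otimes> g) h)"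
      if "c \<in> carrier F" "g \<in> carrier F" "h \<in> carrier F" for c g h
      using f \<kappa>[of c g] \<kappa>[of "c \<otimes> g" h] that by (simp add: hom_def \<kappa>_cocycle)
  qed (use that k in auto)
  show ?thesis
  proof (rule that)
    show "k \<one> \<in> hom (F\<lparr>carrier := R\<rparr>) E"
    proof (rule homI)
      fix r s assume "r \<in> carrier (F\<lparr>carrier := R\<rparr>)" "s \<in> carrier (F\<lparr>carrier := R\<rparr>)"
      then show "k \<one> (r \<otimes>\<^bsub>F\<lparr>carrier := R\<rparr>\<^esub> s) = k \<one> r \<otimes>\<^bsub>E\<^esub> k \<one> s"
        using k(2)[of "\<one>" r s] k_coset[of r "\<one>" s] by simp
    qed (simp add: k(1))
    show "p (k \<one> r) = f r" if "r \<in> R" for r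
      using pk[of "\<one>" r] \<kappa>_R that by simp
  qed
qed

section \<open>Unitriangular representations\<close>

text \<open>
  Upper unitriangular integer matrices with rows and columns indexed by the natural numbers. The
  products are finite sums, since only the indices between \<open>i\<close> and \<open>j\<close> contribute to the entry at
  $(i,j)$.
\<close>

definition unitriangular :: "(nat \<Rightarrow> nat \<Rightarrow> int) monoid" where
  "unitriangular = \<lparr>carrier = {a. (\<forall>i. a i i = 1) \<and> (\<forall>i j. j < i \<longrightarrow> a i j = 0)},
     monoid.mult = (\<lambda>a b i j. \<Sum>k = i..j. a i k * b k j),
     one = (\<lambda>i j. if i = j then 1 else 0)\<rparr>"

abbreviation unitriangular_mult (infixl "\<cdot>" 70) where
  "a \<cdot> b \<equiv> a \<otimes>\<^bsub>unitriangular\<^esub> b"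

lemma unitriangular_simps [simp]:
  "a \<in> carrier unitriangular \<longleftrightarrow> (\<forall>i. a i i = 1) \<and> (\<forall>i j. j < i \<longrightarrow> a i j = 0)"
  "a \<cdot> b = (\<lambda>i j. \<Sum>k = i..j. a i k * b k j)"
  "\<one>\<^bsub>unitriangular\<^esub> = (\<lambda>i j. if i = j then 1 else 0)"
  by (simp_all add: unitriangular_def)

text \<open>Left inverses are found by solving for the entries of a row from left to right.\<close>

context
  notes [fundef_cong] = sum.cong
begin

fun unitriangular_inv :: "(nat \<Rightarrow> nat \<Rightarrow> int) \<Rightarrow> nat \<Rightarrow> nat \<Rightarrow> int" where
  "unitriangular_inv a i j = (if j < i then 0 else if i = j then 1
     else - (\<Sum>k = i..<j. unitriangular_inv a i k * a k j))"

end

declare unitriangular_inv.simps [simp del]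

lemma group_unitriangular: "group unitriangular"
proof (rule groupI)
  fix a b c :: "nat \<Rightarrow> nat \<Rightarrow> int"
  assume a: "a \<in> carrier unitriangular" and b: "b \<in> carrier unitriangular" and c: "c \<in> carrier unitriangular"
  have "(\<Sum>k = i..j. (\<Sum>l = i..k. a i l * b l k) * c k j) = (\<Sum>l = i..j. a i l * (\<Sum>k = l..j. b l k * c k j))" for i j
  proof -
    have "(\<Sum>k = i..j. (\<Sum>l = i..k. a i l * b l k) * c k j) = (\<Sum>k = i..j. \<Sum>l = i..j. a i l * b l k * c k j)"
      using b by (intro sum.cong refl, subst sum_distrib_right) (intro sum.mono_neutral_left, auto)
    also have "\<dots> = (\<Sum>l = i..j. \<Sum>k = i..j. a i l * b l k * c k j)"
      by (rule sum.swap)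
    also have "\<dots> = (\<Sum>l = i..j. a i l * (\<Sum>k = l..j. b l k * c k j))"
      using b by (intro sum.cong refl, subst sum_distrib_left) (intro sum.mono_neutral_cong_right, auto)
    finally show ?thesis .
  qed
  then show "a \<cdot> b \<cdot> c = a \<cdot> (b \<cdot> c)"
    by simp
next
  fix a assume a: "a \<in> carrier unitriangular"
  have "(\<Sum>k = i..j. (if i = k then 1 else 0) * a k j) = a i j" for i j
  proof (cases "i \<le> j")
    case True
    have "(\<Sum>k = i..j. (if i = k then 1 else 0) * a k j) = (\<Sum>k = i..j. if i = k then a k j else 0)"
      by (intro sum.cong) auto
    then show ?thesis using True by simp
  qed (use a in auto)
  then show "\<one>\<^bsub>unitriangular\<^esub> \<cdot> a = a" by simp
  let ?b = "unitriangular_inv a"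
  have "?b \<in> carrier unitriangular"
    by (simp add: unitriangular_inv.simps)
  moreover have "(\<Sum>k = i..j. ?b i k * a k j) = (if i = j then 1 else 0)" for i j
  proof (cases "i < j")
    case True
    then have "{i..j} = insert j {i..<j}" by auto
    then show ?thesis using True a unitriangular_inv.simps[of a i j] by simp
  next
    case False
    then show ?thesis using a by (cases "i = j") (auto simp: unitriangular_inv.simps)
  qed
  ultimately show "\<exists>b \<in> carrier unitriangular. b \<cdot> a = \<one>\<^bsub>unitriangular\<^esub>"
    by (intro bexI[of _ ?b]) auto
qed auto

lemma unitriangular_mult_entry:
  assumes "a \<in> carrier unitriangular" "b \<in> carrier unitriangular" "i < j"
  shows "(a \<cdot> b) i j = a i j + b i j + (\<Sum>k \<in> {i<..<j}. a i k * b k j)"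
proof -
  have "{i..j} = insert i (insert j {i<..<j})" using assms(3) by auto
  then show ?thesis using assms by simp
qed

text \<open>
  The filtration by superdiagonals: the first $n-1$ of them vanish. It is the analogue, in the matrix
  group, of the lower central series.
\<close>

definition vanishes_below :: "nat \<Rightarrow> (nat \<Rightarrow> nat \<Rightarrow> int) \<Rightarrow> bool" where
  "vanishes_below n a \<longleftrightarrow> (\<forall>i j. i < j \<longrightarrow> j < i + n \<longrightarrow> a i j = 0)"

lemma vanishes_belowD: "vanishes_below n a \<Longrightarrow> i < j \<Longrightarrow> j < i + n \<Longrightarrow> a i j = 0"
  by (simp add: vanishes_below_def)

lemma vanishes_below_mult:
  assumes "a \<in> carrier unitriangular" "b \<in> carrier unitriangular"
    and a: "vanishes_below n a" and b: "vanishes_below n b"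
  shows "vanishes_below n (a \<cdot> b)"
    and "n \<ge> 1 \<Longrightarrow> (a \<cdot> b) i (i + n) = a i (i + n) + b i (i + n)"
proof -
  have z: "(\<Sum>k \<in> {i<..<j}. a i k * b k j) = 0" if "j \<le> i + n" for i j
    using that by (intro sum.neutral ballI) (auto simp: vanishes_belowD[OF a])
  show "vanishes_below n (a \<cdot> b)"
    unfolding vanishes_below_def
    using unitriangular_mult_entry[OF assms(1,2)] z vanishes_belowD[OF a] vanishes_belowD[OF b]
    by (auto simp del: unitriangular_simps)
  show "(a \<cdot> b) i (i + n) = a i (i + n) + b i (i + n)" if "n \<ge> 1"
    using unitriangular_mult_entry[OF assms(1,2), of i "i + n"] z[of "i + n" i] that
    by (simp del: unitriangular_simps)
qed

text \<open>
  For $i < j$ the entry of $ab$ at $(i,j)$ is that of \<open>a\<close> plus that of \<open>b\<close> plus terms that contain earlier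
  entries of the same row of \<open>a\<close>, so the entries of \<open>a\<close> vanish one after the other.
\<close>

lemma vanishes_below_left_factor:
  assumes a: "a \<in> carrier unitriangular" and b: "b \<in> carrier unitriangular"
    and ab: "\<And>i j. i < j \<Longrightarrow> j < i + n \<Longrightarrow> (a \<cdot> b) i j = b i j"
  shows "vanishes_below n a"
proof -
  have "a i j = 0" if "i < j" "j < i + n" for i j
    using that
  proof (induction j rule: less_induct)
    case (less j)
    have "(\<Sum>k \<in> {i<..<j}. a i k * b k j) = 0"
      using less by (intro sum.neutral) auto
    then show ?case
      using unitriangular_mult_entry[OF a b less.prems(1)] ab[OF less.prems]
      by (simp del: unitriangular_simps)
  qed
  then show ?thesis by (simp add: vanishes_below_def)
qed

text \<open>
  Here \<open>c\<close> is the commutator of \<open>a\<close> and \<open>b\<close>. The products $ab$ and $ba$ have the same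
  entries below superdiagonal $p+q$, and on it they differ by the Lie bracket of the leading superdiagonals.
\<close>

lemma unitriangular_commutator_entry:
  assumes a: "a \<in> carrier unitriangular" "vanishes_below p a"
    and b: "b \<in> carrier unitriangular" "vanishes_below q b"
    and c: "c \<in> carrier unitriangular"
      "c \<cdot> (b \<cdot> a) = a \<cdot> b"
    and pq: "p \<ge> 1" "q \<ge> 1"
  shows "vanishes_below (p + q) c"
    and "c i (i + (p + q)) = a i (i + p) * b (i + p) (i + (p + q)) - b i (i + q) * a (i + q) (i + (p + q))"
proof -
  interpret group unitriangular by (rule group_unitriangular)
  have sum0: "(\<Sum>k \<in> {i<..<j}. a i k * b k j) = 0"
    if "vanishes_below p a" "vanishes_below q b" "j < i + (p + q)" for a b :: "nat \<Rightarrow> nat \<Rightarrow> int" and p q i j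
  proof (intro sum.neutral ballI)
    fix k assume k: "k \<in> {i<..<j}"
    then have "k < i + p \<or> j < k + q" using that(3) by auto
    then show "a i k * b k j = 0"
      using k vanishes_belowD[OF that(1), of i k] vanishes_belowD[OF that(2), of k j] by auto
  qed
  have sum1: "(\<Sum>k \<in> {i<..<i + (p + q)}. a i k * b k (i + (p + q))) = a i (i + p) * b (i + p) (i + (p + q))"
    if "vanishes_below p a" "vanishes_below q b" "p \<ge> 1" "q \<ge> 1"
    for a b :: "nat \<Rightarrow> nat \<Rightarrow> int" and p q i
  proof -
    have "(\<Sum>k \<in> {i<..<i + (p + q)}. a i k * b k (i + (p + q))) = (\<Sum>k \<in> {i + p}. a i k * b k (i + (p + q)))"
    proof (rule sum.mono_neutral_right)
      show "\<forall>k \<in> {i<..<i + (p + q)} - {i + p}. a i k * b k (i + (p + q)) = 0"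
      proof
        fix k assume k: "k \<in> {i<..<i + (p + q)} - {i + p}"
        then have "k < i + p \<or> i + (p + q) < k + q" by auto
        then show "a i k * b k (i + (p + q)) = 0"
          using k vanishes_belowD[OF that(1), of i k] vanishes_belowD[OF that(2), of k "i + (p + q)"]
          by auto
      qed
    qed (use that in auto)
    then show ?thesis by simp
  qed
  have ba: "b \<cdot> a \<in> carrier unitriangular"
    using a b by (intro m_closed)
  have ab_ba: "(a \<cdot> b) i j = (b \<cdot> a) i j"
    if "i < j" "j < i + (p + q)" for i j
    using that unitriangular_mult_entry[OF a(1) b(1) that(1)] unitriangular_mult_entry[OF b(1) a(1) that(1)]
      sum0[OF a(2) b(2), of j i] sum0[OF b(2) a(2), of j i]
    by (simp add: add.commute del: unitriangular_simps)
  show van: "vanishes_below (p + q) c"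
    using vanishes_below_left_factor[OF c(1) ba, of "p + q"] ab_ba unfolding c(2) by blast
  let ?j = "i + (p + q)"
  have lt: "i < ?j" using pq by simp
  have "(\<Sum>k \<in> {i<..<?j}. c i k * (b \<cdot> a) k ?j) = 0"
    by (intro sum.neutral ballI) (auto simp: vanishes_belowD[OF van] simp del: unitriangular_simps)
  then have "c i ?j + (b \<cdot> a) i ?j = (a \<cdot> b) i ?j"
    using unitriangular_mult_entry[OF c(1) ba lt] unfolding c(2) by simp
  moreover have "(b \<cdot> a) i ?j = b i ?j + a i ?j + b i (i + q) * a (i + q) ?j"
    using unitriangular_mult_entry[OF b(1) a(1) lt] sum1[OF b(2) a(2) pq(2,1), of i]
    by (simp add: add.commute[of q p] del: unitriangular_simps)
  moreover have "(a \<cdot> b) i ?j = a i ?j + b i ?j + a i (i + p) * b (i + p) ?j"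
    using unitriangular_mult_entry[OF a(1) b(1) lt] sum1[OF a(2) b(2) pq, of i]
    by (simp del: unitriangular_simps)
  ultimately show "c i ?j = a i (i + p) * b (i + p) ?j - b i (i + q) * a (i + q) ?j"
    by simp
qed

context group
begin

lemma unitriangular_hom_commutator:
  assumes \<rho>: "\<rho> \<in> hom G unitriangular" and u: "u \<in> carrier G" "vanishes_below p (\<rho> u)"
    and v: "v \<in> carrier G" "vanishes_below q (\<rho> v)" and pq: "p \<ge> 1" "q \<ge> 1"
  shows "vanishes_below (p + q) (\<rho> [u; v])"
    and "\<rho> [u; v] i (i + (p + q)) =
      \<rho> u i (i + p) * \<rho> v (i + p) (i + (p + q)) - \<rho> v i (i + q) * \<rho> u (i + q) (i + (p + q))"
proof -
  have carr: "\<rho> g \<in> carrier unitriangular" if "g \<in> carrier G" for g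
    using \<rho> that by (auto simp: hom_def simp del: unitriangular_simps)
  have mult: "\<rho> (g \<otimes> h) = \<rho> g \<cdot> \<rho> h" if "g \<in> carrier G" "h \<in> carrier G" for g h
    using \<rho> that by (auto simp: hom_def simp del: unitriangular_simps)
  have "[u; v] \<otimes> (v \<otimes> u) = u \<otimes> v"
    using u v by (simp add: commutator_def m_assoc)
  then have eq: "\<rho> [u; v] \<cdot> (\<rho> v \<cdot> \<rho> u) = \<rho> u \<cdot> \<rho> v"
    using u v mult[of "[u; v]" "v \<otimes> u"] mult[of v u] mult[of u v] by (simp del: unitriangular_simps)
  note * = unitriangular_commutator_entry[OF carr[OF u(1)] u(2) carr[OF v(1)] v(2) carr eq pq]
  show "vanishes_below (p + q) (\<rho> [u; v])"
    "\<rho> [u; v] i (i + (p + q)) =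
      \<rho> u i (i + p) * \<rho> v (i + p) (i + (p + q)) - \<rho> v i (i + q) * \<rho> u (i + q) (i + (p + q))"
    using * u v by auto
qed

lemma unitriangular_hom_lower_central:
  assumes \<rho>: "\<rho> \<in> hom G unitriangular"
  shows "w \<in> \<gamma> n \<Longrightarrow> vanishes_below n (\<rho> w)"
proof (induction n arbitrary: w)
  case (Suc n)
  interpret \<rho>: group_hom G unitriangular \<rho>
    using \<rho> group_unitriangular by (simp add: group_hom_def group_hom_axioms_def is_group)
  show ?case
  proof (cases "n = 0")
    case True
    then show ?thesis by (auto simp: vanishes_below_def)
  next
    case False
    have sub: "subgroup {w \<in> carrier G. vanishes_below (Suc n) (\<rho> w)} G"
    proof (rule subgroupI)
      have "\<one> \<in> {w \<in> carrier G. vanishes_below (Suc n) (\<rho> w)}"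
        using \<rho>.hom_one by (simp add: vanishes_below_def)
      then show "{w \<in> carrier G. vanishes_below (Suc n) (\<rho> w)} \<noteq> {}" by blast
    next
      fix u assume u: "u \<in> {w \<in> carrier G. vanishes_below (Suc n) (\<rho> w)}"
      then have carr: "\<rho> (inv u) \<in> carrier unitriangular" "\<rho> u \<in> carrier unitriangular"
        using \<rho>.hom_closed by blast+
      have "\<rho> (inv u) \<cdot> \<rho> u = \<one>\<^bsub>unitriangular\<^esub>"
        using u \<rho>.hom_mult[of "inv u" u] \<rho>.hom_one by (simp del: unitriangular_simps)
      then have "vanishes_below (Suc n) (\<rho> (inv u))"
        using u by (intro vanishes_below_left_factor[OF carr]) (auto simp: vanishes_belowD simp del: unitriangular_simps(1,2))
      then show "inv u \<in> {w \<in> carrier G. vanishes_below (Suc n) (\<rho> w)}"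
        using u by simp
    next
      fix u v assume "u \<in> {w \<in> carrier G. vanishes_below (Suc n) (\<rho> w)}"
        "v \<in> {w \<in> carrier G. vanishes_below (Suc n) (\<rho> w)}"
      then show "u \<otimes> v \<in> {w \<in> carrier G. vanishes_below (Suc n) (\<rho> w)}"
        using vanishes_below_mult(1)[of "\<rho> u" "\<rho> v" "Suc n"] \<rho>.hom_closed
        by (simp del: unitriangular_simps)
    qed auto
    have comm: "[u; g] \<in> {w \<in> carrier G. vanishes_below (Suc n) (\<rho> w)}"
      if "u \<in> \<gamma> n" "g \<in> carrier G" for u g
      using unitriangular_hom_commutator(1)[OF \<rho>, of u n g 1] Suc.IH that False
      by (auto simp: vanishes_below_def)
    have "commutator_subgroup G (\<gamma> n) (carrier G) \<subseteq> {w \<in> carrier G. vanishes_below (Suc n) (\<rho> w)}"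
      by (rule commutator_subgroup_least[OF sub comm])
    then have "\<gamma> (Suc n) \<subseteq> {w \<in> carrier G. vanishes_below (Suc n) (\<rho> w)}"
      using False by (simp add: lower_central_Suc)
    then show ?thesis using Suc.prems by blast
  qed
qed (simp add: vanishes_below_def)

end

text \<open>
  The superdiagonal is a surjective homomorphism from the unitriangular group to an abelian group,
  so projectivity of \<open>R\<close> provides representations with any prescribed superdiagonal. Their entries
  are the coefficients of a Magnus expansion.
\<close>

lemma unitriangular_representation:
  fixes F :: "('a, 'b) monoid_scheme" and \<phi> :: "nat \<Rightarrow> 'a \<Rightarrow> int"
  assumes "free_group F" "subgroup R F"
    and \<phi>: "\<And>i r s. r \<in> R \<Longrightarrow> s \<in> R \<Longrightarrow> \<phi> i (r \<otimes>\<^bsub>F\<^esub> s) = \<phi> i r + \<phi> i s"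
  obtains \<rho> where "\<rho> \<in> hom (F\<lparr>carrier := R\<rparr>) unitriangular"
    "\<And>r i. r \<in> R \<Longrightarrow> \<rho> r i (Suc i) = \<phi> i r"
proof -
  define Q :: "(nat \<Rightarrow> int) monoid" where "Q = \<lparr>carrier = UNIV :: (nat \<Rightarrow> int) set, monoid.mult = (\<lambda>f g i. f i + g i), one = (\<lambda>_. 0)\<rparr>"
  have Q: "group Q"
  proof (rule groupI)
    fix f assume "f \<in> carrier Q"
    show "\<exists>g \<in> carrier Q. g \<otimes>\<^bsub>Q\<^esub> f = \<one>\<^bsub>Q\<^esub>"
      by (rule bexI[of _ "\<lambda>i. - f i"]) (simp_all add: Q_def)
  qed (simp_all add: Q_def add.assoc)
  let ?p = "\<lambda>a i. a i (Suc i) :: int"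
  have p: "?p \<in> hom unitriangular Q"
    by (rule homI) (auto simp: Q_def)
  have surj: "?p ` carrier unitriangular = carrier Q"
  proof -
    have "f \<in> ?p ` carrier unitriangular" for f
      by (rule image_eqI[of _ _ "\<lambda>i j. if i = j then 1 else if j = Suc i then f i else 0"]) auto
    then show ?thesis by (auto simp: Q_def)
  qed
  have f: "(\<lambda>r i. \<phi> i r) \<in> hom (F\<lparr>carrier := R\<rparr>) Q"
    by (rule homI) (auto simp: Q_def \<phi>)
  obtain h where "h \<in> hom (F\<lparr>carrier := R\<rparr>) unitriangular" "\<And>r. r \<in> R \<Longrightarrow> ?p (h r) = (\<lambda>i. \<phi> i r)"
    by (rule subgroup_of_free_group_projective[OF assms(1,2) group_unitriangular Q p surj f]) blast
  then show ?thesis by (intro that[of h]) (auto dest: fun_cong)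
qed

section \<open>Bases of subgroups of free abelian groups\<close>

lemma lookup_frag_extend:
  "Poly_Mapping.lookup (frag_extend z c) k = (\<Sum>x \<in> Poly_Mapping.keys c. Poly_Mapping.lookup c x * Poly_Mapping.lookup (z x) k)"
  by (simp add: frag_extend_def lookup_sum)

text \<open>
  The set \<open>U\<close> is put in front of its complement, so that a leading key in \<open>U\<close> forces all keys into \<open>U\<close>.
\<close>

lemma well_order_with_initial_segment:
  fixes U :: "'k set"
  obtains lt :: "'k \<Rightarrow> 'k \<Rightarrow> bool"
  where "wfp lt" "\<And>x y. x \<noteq> y \<Longrightarrow> lt x y \<or> lt y x" "\<And>x y z. lt x y \<Longrightarrow> lt y z \<Longrightarrow> lt x z"
    "\<And>x y. lt x y \<Longrightarrow> y \<in> U \<Longrightarrow> x \<in> U"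
proof -
  obtain r :: "'k rel" where r: "well_order_on UNIV r"
    using well_order_on by blast
  define lt where "lt x y \<longleftrightarrow> (x \<in> U \<and> y \<notin> U) \<or> ((x \<in> U \<longleftrightarrow> y \<in> U) \<and> (x, y) \<in> r - Id)" for x y
  have wfr: "wf (r - Id)" and tot: "total r" and tr: "trans r" and anti: "antisym r"
    using r by (auto simp: well_order_on_def linear_order_on_def partial_order_on_def preorder_on_def)
  have "{(x, y). lt x y} \<subseteq> inv_image (less_than <*lex*> (r - Id)) (\<lambda>x. (if x \<in> U then 0 else 1, x))"
    by (auto simp: lt_def)
  moreover have "wf (inv_image (less_than <*lex*> (r - Id)) (\<lambda>x. (if x \<in> U then 0 else 1 :: nat, x)))"
    using wfr by (intro wf_inv_image wf_lex_prod) auto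
  ultimately have "wf {(x, y). lt x y}" by (rule wf_subset[rotated])
  then have "wfp lt" by (simp add: wfp_def)
  moreover have "lt x y \<or> lt y x" if "x \<noteq> y" for x y
    using tot that by (auto simp: lt_def total_on_def)
  moreover have "lt x z" if "lt x y" "lt y z" for x y z
    using that tr anti unfolding lt_def trans_def antisym_def by blast
  ultimately show ?thesis using that by (metis lt_def)
qed

lemma frag_cmul_mem:
  assumes "0 \<in> M" "\<And>a b. a \<in> M \<Longrightarrow> b \<in> M \<Longrightarrow> a - b \<in> M" "a \<in> (M :: ('k \<Rightarrow>\<^sub>0 int) set)"
  shows "frag_cmul n a \<in> M"
proof -
  have add: "x + y \<in> M" if "x \<in> M" "y \<in> M" for x y
    using assms(2)[OF that(1) assms(2)[OF assms(1) that(2)]] by simp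
  have nat: "frag_cmul (int k) a \<in> M" for k
    by (induction k) (use assms add in \<open>simp_all add: frag_cmul_distrib\<close>)
  show ?thesis
  proof (cases n)
    case (neg k)
    then have "frag_cmul n a = 0 - frag_cmul (int (Suc k)) a" by simp
    then show ?thesis using assms(2)[OF assms(1) nat[of "Suc k"]] by simp
  qed (use nat in simp)
qed

text \<open>
  For every key \<open>x\<close> that is the leading key of some element, with respect to a well-order, choose an
  element \<open>z x\<close> with that leading key and a leading coefficient of least absolute value. Division
  with remainder and well-founded induction show that these elements span; leading keys
  cannot cancel, so they are independent. The last two properties say that the
  basis is compatible with the subgroup of elements supported in \<open>U\<close>.
\<close>

lemma free_abelian_subgroup_basis:
  fixes M :: "('k \<Rightarrow>\<^sub>0 int) set" and U :: "'k set"
  assumes M: "0 \<in> M" "\<And>a b. a \<in> M \<Longrightarrow> b \<in> M \<Longrightarrow> a - b \<in> M"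
  obtains I z where "\<And>x. x \<in> I \<Longrightarrow> z x \<in> M"
    and "\<And>m. m \<in> M \<Longrightarrow> \<exists>!c. Poly_Mapping.keys c \<subseteq> I \<and> frag_extend z c = m"
    and "\<And>c. Poly_Mapping.keys c \<subseteq> I \<Longrightarrow> Poly_Mapping.keys (frag_extend z c) \<subseteq> U \<Longrightarrow> Poly_Mapping.keys c \<subseteq> U"
    and "\<And>x. x \<in> I \<Longrightarrow> x \<in> U \<Longrightarrow> Poly_Mapping.keys (z x) \<subseteq> U"
proof -
  obtain lt :: "'k \<Rightarrow> 'k \<Rightarrow> bool" where wf: "wfp lt"
    and total: "\<And>x y. x \<noteq> y \<Longrightarrow> lt x y \<or> lt y x"
    and trans: "\<And>x y z. lt x y \<Longrightarrow> lt y z \<Longrightarrow> lt x z"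
    and U: "\<And>x y. lt x y \<Longrightarrow> y \<in> U \<Longrightarrow> x \<in> U"
    by (rule well_order_with_initial_segment[of U]) blast
  have irrefl: "\<not> lt x x" for x using wfp_imp_asymp[OF wf] by (auto dest: asympD)
  let ?keys = "Poly_Mapping.keys :: ('k \<Rightarrow>\<^sub>0 int) \<Rightarrow> 'k set"
  let ?lk = "Poly_Mapping.lookup :: ('k \<Rightarrow>\<^sub>0 int) \<Rightarrow> 'k \<Rightarrow> int"
  have lead: "\<exists>k \<in> K. \<forall>k' \<in> K. k' = k \<or> lt k' k" if "finite K" "K \<noteq> {}" for K
    using that
  proof (induction K rule: finite_ne_induct)
    case (insert x K)
    then obtain k where k: "k \<in> K" "\<forall>k' \<in> K. k' = k \<or> lt k' k" by blast
    show ?case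
    proof (cases "x = k \<or> lt x k")
      case True
      then show ?thesis using k by (intro bexI[of _ k]) auto
    next
      case False
      then have "lt k x" using total by blast
      then have "\<forall>k' \<in> insert x K. k' = x \<or> lt k' x" using k(2) by (metis insert_iff trans)
      then show ?thesis by blast
    qed
  qed auto
  define L where "L x = {m \<in> M. \<forall>k \<in> ?keys m. k = x \<or> lt k x}" for x
  define I where "I = {x. \<exists>m \<in> L x. ?lk m x \<noteq> 0}"
  have "\<exists>m. (m \<in> L x \<and> ?lk m x \<noteq> 0) \<and> (\<forall>m'. m' \<in> L x \<and> ?lk m' x \<noteq> 0 \<longrightarrow> nat \<bar>?lk m x\<bar> \<le> nat \<bar>?lk m' x\<bar>)"
    if "x \<in> I" for x
    using that ex_has_least_nat[of "\<lambda>m. m \<in> L x \<and> ?lk m x \<noteq> 0" _ "\<lambda>m. nat \<bar>?lk m x\<bar>"]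
    by (auto simp: I_def)
  then obtain z where z: "\<And>x. x \<in> I \<Longrightarrow> z x \<in> L x" "\<And>x. x \<in> I \<Longrightarrow> ?lk (z x) x \<noteq> 0"
    and z_min: "\<And>x m'. x \<in> I \<Longrightarrow> m' \<in> L x \<Longrightarrow> ?lk m' x \<noteq> 0 \<Longrightarrow> nat \<bar>?lk (z x) x\<bar> \<le> nat \<bar>?lk m' x\<bar>"
    by metis
  have exists: "\<exists>c. ?keys c \<subseteq> I \<and> frag_extend z c = m" if "m \<in> L x" for x m
    using wf that
  proof (induction x arbitrary: m rule: wfp_induct_rule)
    case (less x)
    have zero_case: "\<exists>c. ?keys c \<subseteq> I \<and> frag_extend z c = m" if m: "m \<in> L x" "?lk m x = 0" for m
    proof (cases "m = 0")
      case True
      then show ?thesis by (intro exI[of _ 0]) simp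
    next
      case False
      then obtain k where k: "k \<in> ?keys m" "\<forall>k' \<in> ?keys m. k' = k \<or> lt k' k"
        using lead[of "?keys m"] by auto
      have "k \<noteq> x" using k m by (auto simp: in_keys_iff)
      then have "lt k x" using k m by (auto simp: L_def)
      moreover have "m \<in> L k" using k m by (auto simp: L_def)
      ultimately show ?thesis using less.IH by blast
    qed
    show ?case
    proof (cases "?lk m x = 0")
      case True
      then show ?thesis using zero_case less.prems by blast
    next
      case False
      then have x: "x \<in> I" using less.prems by (auto simp: I_def)
      define n where "n = ?lk m x div ?lk (z x) x"
      define m' where "m' = m - frag_cmul n (z x)"
      have "m' \<in> M"
        using less.prems z(1)[OF x] M frag_cmul_mem[of M "z x" n] by (auto simp: m'_def L_def)
      moreover have "?keys m' \<subseteq> ?keys m \<union> ?keys (z x)"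
        unfolding m'_def using keys_diff[of m "frag_cmul n (z x)"] keys_cmul[of n "z x"] by blast
      ultimately have m': "m' \<in> L x"
        using less.prems z(1)[OF x] by (auto simp: L_def)
      have lk: "?lk m' x = ?lk m x mod ?lk (z x) x"
        by (simp add: m'_def n_def lookup_minus minus_div_mult_eq_mod)
      have "?lk m' x = 0"
      proof (rule ccontr)
        assume "?lk m' x \<noteq> 0"
        then have "nat \<bar>?lk (z x) x\<bar> \<le> nat \<bar>?lk m' x\<bar>" using z_min[OF x m'] by blast
        moreover have "\<bar>?lk m' x\<bar> < \<bar>?lk (z x) x\<bar>"
          unfolding lk using z(2)[OF x] by (simp add: abs_mod_less)
        ultimately show False by linarith
      qed
      then obtain c where c: "?keys c \<subseteq> I" "frag_extend z c = m'" using zero_case[OF m'] by blast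
      have "?keys (c + frag_cmul n (frag_of x)) \<subseteq> I"
        using keys_add[of c "frag_cmul n (frag_of x)"] keys_cmul[of n "frag_of x"] c x
        by (auto dest!: subsetD)
      moreover have "frag_extend z (c + frag_cmul n (frag_of x)) = m"
        using c by (simp add: frag_extend_add frag_extend_cmul m'_def)
      ultimately show ?thesis by blast
    qed
  qed
  \<comment> \<open>no cancellation in the leading key\<close>
  have leading: "k \<in> ?keys (frag_extend z c)"
    if c: "?keys c \<subseteq> I" and k: "k \<in> ?keys c" "\<forall>k' \<in> ?keys c. k' = k \<or> lt k' k" for c k
  proof -
    have "?lk (frag_extend z c) k = (\<Sum>x \<in> ?keys c. ?lk c x * ?lk (z x) k)"
      by (rule lookup_frag_extend)
    also have "\<dots> = (\<Sum>x \<in> {k}. ?lk c x * ?lk (z x) k)"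
    proof (rule sum.mono_neutral_right)
      show "\<forall>x \<in> ?keys c - {k}. ?lk c x * ?lk (z x) k = 0"
      proof
        fix x assume "x \<in> ?keys c - {k}"
        then have x: "lt x k" "x \<in> I" "x \<noteq> k" using k c by auto
        have "k \<notin> ?keys (z x)"
          using z(1)[OF x(2)] x trans[of k x k] irrefl by (auto simp: L_def)
        then show "?lk c x * ?lk (z x) k = 0" by (simp add: in_keys_iff)
      qed
    qed (use k in auto)
    finally show ?thesis using k z(2)[of k] c by (auto simp: in_keys_iff)
  qed
  show ?thesis
  proof (rule that[of I z])
    show "z x \<in> M" if "x \<in> I" for x using z(1)[OF that] by (simp add: L_def)
    show "\<exists>!c. ?keys c \<subseteq> I \<and> frag_extend z c = m" if m: "m \<in> M" for m
    proof (rule ex_ex1I)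
      show "\<exists>c. ?keys c \<subseteq> I \<and> frag_extend z c = m"
      proof (cases "m = 0")
        case True
        then show ?thesis by (intro exI[of _ 0]) simp
      next
        case False
        then obtain k where "k \<in> ?keys m" "\<forall>k' \<in> ?keys m. k' = k \<or> lt k' k"
          using lead[of "?keys m"] by auto
        then have "m \<in> L k" using m by (auto simp: L_def)
        then show ?thesis by (rule exists)
      qed
    next
      fix c d
      assume c: "?keys c \<subseteq> I \<and> frag_extend z c = m" and d: "?keys d \<subseteq> I \<and> frag_extend z d = m"
      have keys: "?keys (c - d) \<subseteq> I" using keys_diff[of c d] c d by blast
      have zero: "frag_extend z (c - d) = 0" using c d by (simp add: frag_extend_diff)
      have "?keys (c - d) = {}"
      proof (rule ccontr)
        assume "?keys (c - d) \<noteq> {}"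
        then obtain k where "k \<in> ?keys (c - d)" "\<forall>k' \<in> ?keys (c - d). k' = k \<or> lt k' k"
          using lead[of "?keys (c - d)"] by auto
        then have "k \<in> ?keys (frag_extend z (c - d))" by (rule leading[OF keys])
        then show False using zero by simp
      qed
      then show "c = d" by simp
    qed
    show "?keys c \<subseteq> U" if c: "?keys c \<subseteq> I" and U': "?keys (frag_extend z c) \<subseteq> U" for c
    proof (cases "c = 0")
      case False
      then obtain k where k: "k \<in> ?keys c" "\<forall>k' \<in> ?keys c. k' = k \<or> lt k' k"
        using lead[of "?keys c"] by auto
      then have "k \<in> U" using leading[OF c] U' by blast
      then show ?thesis using k U by (metis subsetI)
    qed simp
    show "?keys (z x) \<subseteq> U" if "x \<in> I" "x \<in> U" for x
      using z(1)[OF that(1)] that U by (auto simp: L_def)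
  qed
qed

text \<open>
  Pulls a basis of the image of \<open>h\<close> back to \<open>G\<close>, together with the coordinates. The set \<open>U\<close> is for
  adapting the basis to a subgroup between the kernel of \<open>h\<close> and \<open>G\<close>, namely the elements whose image is
  supported in \<open>U\<close>.
\<close>

lemma (in group) basis_modulo_kernel:
  fixes h :: "'a \<Rightarrow> ('k \<Rightarrow>\<^sub>0 int)" and U :: "'k set"
  assumes h: "\<And>x y. x \<in> carrier G \<Longrightarrow> y \<in> carrier G \<Longrightarrow> h (x \<otimes> y) = h x + h y"
  obtains Y and f :: "'a \<Rightarrow> 'a \<Rightarrow> int" where "Y \<subseteq> carrier G"
    and "\<And>y g g'. y \<in> Y \<Longrightarrow> g \<in> carrier G \<Longrightarrow> g' \<in> carrier G \<Longrightarrow> f y (g \<otimes> g') = f y g + f y g'"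
    and "\<And>y y'. y \<in> Y \<Longrightarrow> y' \<in> Y \<Longrightarrow> f y y' = (if y = y' then 1 else 0)"
    and "generate G (Y \<union> {g \<in> carrier G. h g = 0}) = carrier G"
    and "\<And>y g. y \<in> Y \<Longrightarrow> \<not> Poly_Mapping.keys (h y) \<subseteq> U \<Longrightarrow> g \<in> carrier G \<Longrightarrow>
            Poly_Mapping.keys (h g) \<subseteq> U \<Longrightarrow> f y g = 0"
proof -
  have h_one: "h \<one> = 0" using h[of \<one> \<one>] by simp
  have h_inv: "h (inv x) = - h x" if "x \<in> carrier G" for x
    using h[of "inv x" x] that h_one by (simp add: eq_neg_iff_add_eq_0)
  let ?M = "h ` carrier G"
  have M: "a - b \<in> ?M" if "a \<in> ?M" "b \<in> ?M" for a b
  proof -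
    from that(1) obtain x where x: "a = h x" "x \<in> carrier G" by (rule imageE)
    from that(2) obtain y where y: "b = h y" "y \<in> carrier G" by (rule imageE)
    have "a - b = h (x \<otimes> inv y)" using x y by (simp add: h h_inv)
    moreover have "x \<otimes> inv y \<in> carrier G" using x y by simp
    ultimately show "a - b \<in> ?M" by (rule image_eqI)
  qed
  have M0: "0 \<in> ?M" using h_one by force
  obtain I z where z: "\<And>x. x \<in> I \<Longrightarrow> z x \<in> ?M"
    and ex1: "\<And>m. m \<in> ?M \<Longrightarrow> \<exists>!c. Poly_Mapping.keys c \<subseteq> I \<and> frag_extend z c = m"
    and U1: "\<And>c. Poly_Mapping.keys c \<subseteq> I \<Longrightarrow> Poly_Mapping.keys (frag_extend z c) \<subseteq> U \<Longrightarrow> Poly_Mapping.keys c \<subseteq> U"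
    and U2: "\<And>x. x \<in> I \<Longrightarrow> x \<in> U \<Longrightarrow> Poly_Mapping.keys (z x) \<subseteq> U"
    by (rule free_abelian_subgroup_basis[OF M0 M, of U], assumption, assumption, rule that)
  define C where "C m = (THE c. Poly_Mapping.keys c \<subseteq> I \<and> frag_extend z c = m)" for m
  have C: "Poly_Mapping.keys (C m) \<subseteq> I" "frag_extend z (C m) = m" if "m \<in> ?M" for m
    using theI'[OF ex1[OF that]] unfolding C_def by blast+
  have C_eq: "C m = c" if "m \<in> ?M" "Poly_Mapping.keys c \<subseteq> I" "frag_extend z c = m" for m c
    unfolding C_def using ex1[OF that(1)] that by (intro the1_equality) auto
  have "\<forall>x \<in> I. \<exists>y \<in> carrier G. h y = z x" using z by (metis imageE)
  then obtain y where y: "\<And>x. x \<in> I \<Longrightarrow> y x \<in> carrier G" "\<And>x. x \<in> I \<Longrightarrow> h (y x) = z x" by metis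
  have Cz: "C (z x) = frag_of x" if "x \<in> I" for x
    using that z by (intro C_eq) auto
  have inj: "inj_on y I"
    using y Cz by (intro inj_onI) (metis frag_of_eq)
  define f where "f y' g = Poly_Mapping.lookup (C (h g)) (inv_into I y y')" for y' g
  have f: "f (y x) g = Poly_Mapping.lookup (C (h g)) x" if "x \<in> I" for x g
    using inj that by (simp add: f_def)
  have gen: "\<exists>e \<in> generate G (y ` I). h e = frag_extend z c" if "Poly_Mapping.keys c \<subseteq> I" for c
    using that
  proof (induction c rule: frag_induction)
    case zero
    then show ?case using h_one by (auto intro: generate.one)
  next
    case (one x)
    then show ?case using y by (auto intro: generate.incl)
  next
    case (diff a b)
    then obtain u v where uv: "u \<in> generate G (y ` I)" "v \<in> generate G (y ` I)"
      "h u = frag_extend z a" "h v = frag_extend z b" by blast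
    have yI: "y ` I \<subseteq> carrier G" using y by auto
    then have carr: "u \<in> carrier G" "v \<in> carrier G" using uv generate_in_carrier by blast+
    have "h (u \<otimes> inv v) = frag_extend z (a - b)"
      using uv carr by (simp add: h h_inv frag_extend_diff)
    moreover have "u \<otimes> inv v \<in> generate G (y ` I)"
      using uv generate_m_inv_closed[OF yI] by (auto intro: generate.eng)
    ultimately show ?case by blast
  qed
  show ?thesis
  proof (rule that[of "y ` I" f])
    show "y ` I \<subseteq> carrier G" using y by auto
    show "f y' (g \<otimes> g') = f y' g + f y' g'" if "y' \<in> y ` I" "g \<in> carrier G" "g' \<in> carrier G" for y' g g'
    proof -
      have "C (h (g \<otimes> g')) = C (h g) + C (h g')"
      proof (rule C_eq)
        show "Poly_Mapping.keys (C (h g) + C (h g')) \<subseteq> I"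
          using keys_add[of "C (h g)" "C (h g')"] C(1)[of "h g"] C(1)[of "h g'"] that by blast
        show "h (g \<otimes> g') \<in> ?M" using that by (intro imageI m_closed)
      qed (use that in \<open>auto simp: frag_extend_add C(2) h\<close>)
      then show ?thesis by (simp add: f_def lookup_add)
    qed
    show "f y' y'' = (if y' = y'' then 1 else 0)" if "y' \<in> y ` I" "y'' \<in> y ` I" for y' y''
      using that f y Cz inj by (auto simp: inj_on_def lookup_frag_of)
    show "generate G (y ` I \<union> {g \<in> carrier G. h g = 0}) = carrier G" (is "generate G ?Z = _")
    proof
      have Z: "?Z \<subseteq> carrier G" using y by auto
      then show "generate G ?Z \<subseteq> carrier G" by (rule generate_incl)
      show "carrier G \<subseteq> generate G ?Z"
      proof
        fix g assume g: "g \<in> carrier G"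
        obtain e where e: "e \<in> generate G (y ` I)" "h e = h g"
          using gen[OF C(1)[of "h g"]] C(2)[of "h g"] g by auto
        have ec: "e \<in> carrier G" using e y generate_in_carrier[of "y ` I"] by blast
        have "inv e \<otimes> g \<in> generate G ?Z"
          using ec e g by (intro generate.incl) (auto simp: h h_inv)
        moreover have "e \<in> generate G ?Z" using e mono_generate[of "y ` I" ?Z] by blast
        ultimately have "e \<otimes> (inv e \<otimes> g) \<in> generate G ?Z" by (rule generate.eng[rotated])
        then show "g \<in> generate G ?Z" using ec g by (simp flip: m_assoc)
      qed
    qed
    show "f y' g = 0" if "y' \<in> y ` I" "\<not> Poly_Mapping.keys (h y') \<subseteq> U" "g \<in> carrier G"
      "Poly_Mapping.keys (h g) \<subseteq> U" for y' g
    proof -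
      from that(1) obtain x where x: "x \<in> I" "y' = y x" by blast
      have "x \<notin> U" using U2[OF x(1)] that x y by auto
      moreover have "Poly_Mapping.keys (C (h g)) \<subseteq> U"
        using U1[OF C(1)[of "h g"]] C(2)[of "h g"] that by auto
      ultimately show ?thesis using x f by (auto simp: in_keys_iff)
    qed
  qed
qed

section \<open>Coefficients of commutators\<close>

text \<open>
  The situation of the theorem, with $G = R$: the set $A \cup B$ represents a basis of $G/G'$ with
  dual basis \<open>f\<close>, where \<open>A\<close> lies in \<open>S\<close> and the coordinates belonging to \<open>B\<close> vanish on \<open>S\<close>. Freeness of \<open>G\<close>
  enters only through the existence of representations with given superdiagonals.
\<close>

locale split_basis = group G for G :: "('a, 'b) monoid_scheme" (structure) +
  fixes S A B :: "'a set" and f :: "'a \<Rightarrow> 'a \<Rightarrow> int"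
  assumes S: "S \<lhd> G" and A_S: "A \<subseteq> S" and B_G: "B \<subseteq> carrier G"
    and gen: "carrier G \<subseteq> generate G (A \<union> B \<union> \<gamma> 2)"
    and f_add: "\<And>y g h. y \<in> A \<union> B \<Longrightarrow> g \<in> carrier G \<Longrightarrow> h \<in> carrier G \<Longrightarrow> f y (g \<otimes> h) = f y g + f y h"
    and f_dual: "\<And>y y'. y \<in> A \<union> B \<Longrightarrow> y' \<in> A \<union> B \<Longrightarrow> f y y' = of_bool (y = y')"
    and f_S: "\<And>b s. b \<in> B \<Longrightarrow> s \<in> S \<Longrightarrow> f b s = 0"
    and representation: "\<And>\<phi> :: nat \<Rightarrow> 'a. range \<phi> \<subseteq> A \<union> B \<Longrightarrow>
      \<exists>\<rho> \<in> hom G unitriangular. \<forall>g \<in> carrier G. \<forall>i. \<rho> g i (Suc i) = f (\<phi> i) g"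
begin

definition Y :: "'a set" where "Y = A \<union> B"

lemma A_Y [simp, intro]: "a \<in> A \<Longrightarrow> a \<in> Y"
  and B_Y [simp, intro]: "b \<in> B \<Longrightarrow> b \<in> Y"
  by (simp_all add: Y_def)

lemmas Y_gen = gen[folded Y_def] and Y_add = f_add[folded Y_def]
  and Y_dual = f_dual[folded Y_def] and Y_representation = representation[folded Y_def]

definition rep :: "(nat \<Rightarrow> 'a) \<Rightarrow> 'a \<Rightarrow> nat \<Rightarrow> nat \<Rightarrow> int" where
  "rep \<phi> = (SOME \<rho>. \<rho> \<in> hom G unitriangular \<and> (\<forall>g \<in> carrier G. \<forall>i. \<rho> g i (Suc i) = f (\<phi> i) g))"

text \<open>
  Representations are indexed by infinite sequences of letters. A finite word is continued by
  repeating its last letter; the entries in the top left corner that are considered do not depend on this.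
\<close>

definition letters :: "'a list \<Rightarrow> nat \<Rightarrow> 'a" where
  "letters ys i = ys ! min i (length ys - 1)"

text \<open>
  On $\gamma_n$ and for a word of length $n$, this is the coefficient of that word in the Magnus expansion.
\<close>

definition coef :: "'a list \<Rightarrow> 'a \<Rightarrow> int" where
  "coef ys w = rep (letters ys) w 0 (length ys)"

lemma S_G: "S \<subseteq> carrier G"
  using S normal_imp_subgroup subgroup.subset by blast

lemma Y_G: "Y \<subseteq> carrier G"
  using A_S S_G B_G by (auto simp: Y_def)

lemma Y_closed [simp, intro]: "y \<in> Y \<Longrightarrow> y \<in> carrier G"
  using Y_G by auto

lemma A_B_neq: "a \<in> A \<Longrightarrow> b \<in> B \<Longrightarrow> a \<noteq> b"
proof
  assume "a \<in> A" "b \<in> B" "a = b"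
  then have "f b b = 0" "f b b = of_bool (b = b)" using A_S by (intro f_S f_dual; blast)+
  then show False by simp
qed

lemma rep:
  assumes "range \<phi> \<subseteq> Y"
  shows "rep \<phi> \<in> hom G unitriangular" "\<And>g i. g \<in> carrier G \<Longrightarrow> rep \<phi> g i (Suc i) = f (\<phi> i) g"
proof -
  have "\<exists>\<rho>. \<rho> \<in> hom G unitriangular \<and> (\<forall>g \<in> carrier G. \<forall>i. \<rho> g i (Suc i) = f (\<phi> i) g)"
    by (rule Y_representation[OF assms, unfolded Bex_def])
  from someI_ex[OF this] show "rep \<phi> \<in> hom G unitriangular"
    "\<And>g i. g \<in> carrier G \<Longrightarrow> rep \<phi> g i (Suc i) = f (\<phi> i) g"
    unfolding rep_def[symmetric] by simp_all
qed

lemma letters_Y: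
  assumes "set ys \<subseteq> Y" "ys \<noteq> []"
  shows "range (letters ys) \<subseteq> Y"
proof
  fix y assume "y \<in> range (letters ys)"
  then obtain i where "y = ys ! min i (length ys - 1)" by (auto simp: letters_def)
  moreover have "min i (length ys - 1) < length ys" using assms(2) by (cases ys) auto
  ultimately show "y \<in> Y" using assms(1) nth_mem by blast
qed

lemma rep_carrier:
  assumes "range \<phi> \<subseteq> Y" "g \<in> carrier G"
  shows "rep \<phi> g \<in> carrier unitriangular"
  using rep(1)[OF assms(1)] assms(2) by (auto simp: hom_def simp del: unitriangular_simps)

lemma rep_mult:
  assumes "range \<phi> \<subseteq> Y" "g \<in> carrier G" "h \<in> carrier G"
  shows "rep \<phi> (g \<otimes> h) = rep \<phi> g \<cdot> rep \<phi> h"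
  using rep(1)[OF assms(1)] assms(2,3) by (auto simp: hom_def simp del: unitriangular_simps)

lemma rep_add:
  assumes "range \<phi> \<subseteq> Y" "n \<ge> 1" "g \<in> \<gamma> n" "h \<in> \<gamma> n"
  shows "rep \<phi> (g \<otimes> h) i (i + n) = rep \<phi> g i (i + n) + rep \<phi> h i (i + n)"
  using vanishes_below_mult(2)[of "rep \<phi> g" "rep \<phi> h" n i] rep_carrier[OF assms(1)] rep_mult[OF assms(1)]
    unitriangular_hom_lower_central[OF rep(1)[OF assms(1)]] assms(2-4)
  by (simp del: unitriangular_simps)

lemma rep_commutator:
  assumes \<phi>: "range \<phi> \<subseteq> Y" and u: "u \<in> \<gamma> p" and v: "v \<in> \<gamma> q"
    and pq: "p \<ge> 1" "q \<ge> 1" and j: "j = i + (p + q)"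
  shows "rep \<phi> [u; v] i j =
    rep \<phi> u i (i + p) * rep \<phi> v (i + p) j - rep \<phi> v i (i + q) * rep \<phi> u (i + q) j"
  unfolding j
  by (rule unitriangular_hom_commutator(2)[OF rep(1)[OF \<phi>] _ _ _ _ pq])
     (use u v unitriangular_hom_lower_central[OF rep(1)[OF \<phi>]] in auto)

lemma coef_add:
  assumes "set ys \<subseteq> Y" "ys \<noteq> []" "g \<in> \<gamma> (length ys)" "h \<in> \<gamma> (length ys)"
  shows "coef ys (g \<otimes> h) = coef ys g + coef ys h"
  using rep_add[OF letters_Y[OF assms(1,2)] _ assms(3,4), of 0] assms(2)
  by (cases ys) (simp_all add: coef_def)

text \<open>
  The leading entries of commutators of basis elements follow the expansion of Lie brackets in
  non-commuting letters.
\<close>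

lemma rep_weight_1:
  assumes \<phi>: "range \<phi> \<subseteq> Y" and "x \<in> Y" and "j = Suc i"
  shows "rep \<phi> x i j = of_bool (\<phi> i = x)"
proof -
  have "x \<in> carrier G" using assms(2) Y_G by blast
  then have "rep \<phi> x i j = f (\<phi> i) x" unfolding assms(3) by (rule rep(2)[OF \<phi>])
  also have "\<dots> = of_bool (\<phi> i = x)" using \<phi> assms(2) by (intro Y_dual) blast+
  finally show ?thesis .
qed

lemma rep_weight_2:
  assumes \<phi>: "range \<phi> \<subseteq> Y" and xy: "x \<in> Y" "y \<in> Y" and j: "j = i + 2"
  shows "rep \<phi> [x; y] i j = of_bool (\<phi> i = x \<and> \<phi> (Suc i) = y) - of_bool (\<phi> i = y \<and> \<phi> (Suc i) = x)"
proof -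
  have "x \<in> \<gamma> 1" "y \<in> \<gamma> 1" using xy Y_G by auto
  then have "rep \<phi> [x; y] i j =
      rep \<phi> x i (i + 1) * rep \<phi> y (i + 1) j - rep \<phi> y i (i + 1) * rep \<phi> x (i + 1) j"
    by (rule rep_commutator[OF \<phi>]) (simp_all add: j)
  moreover have "rep \<phi> z i (i + 1) = of_bool (\<phi> i = z)" "rep \<phi> z (i + 1) j = of_bool (\<phi> (Suc i) = z)"
    if "z \<in> Y" for z
    using that by (simp_all add: rep_weight_1[OF \<phi>] j)
  ultimately show ?thesis using xy by (simp flip: of_bool_conj)
qed

lemma rep_weight_3:
  assumes \<phi>: "range \<phi> \<subseteq> Y" and xyz: "x \<in> Y" "y \<in> Y" "z \<in> Y" and j: "j = i + 3" "k = i + 2" "l = i + 1"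
  shows "rep \<phi> [[x; y]; z] i j =
    rep \<phi> [x; y] i k * of_bool (\<phi> k = z) - of_bool (\<phi> i = z) * rep \<phi> [x; y] l j"
proof -
  have "[x; y] \<in> \<gamma> 2" "z \<in> \<gamma> 1"
    using xyz Y_G by (auto intro!: commutator_in_lower_central_2)
  then have "rep \<phi> [[x; y]; z] i j =
      rep \<phi> [x; y] i (i + 2) * rep \<phi> z (i + 2) j - rep \<phi> z i (i + 1) * rep \<phi> [x; y] (i + 1) j"
    by (rule rep_commutator[OF \<phi>]) (simp_all add: j)
  moreover have "rep \<phi> z (i + 2) j = of_bool (\<phi> (i + 2) = z)" "rep \<phi> z i (i + 1) = of_bool (\<phi> i = z)"
    by (simp_all add: rep_weight_1[OF \<phi> xyz(3)] j)
  ultimately show ?thesis by (simp only: j(2,3))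
qed

lemma rep_weight_4:
  assumes \<phi>: "range \<phi> \<subseteq> Y" and xyzt: "x \<in> Y" "y \<in> Y" "z \<in> Y" "t \<in> Y"
  shows "rep \<phi> [[[x; y]; z]; t] 0 4 =
    rep \<phi> [[x; y]; z] 0 3 * of_bool (\<phi> 3 = t) - of_bool (\<phi> 0 = t) * rep \<phi> [[x; y]; z] 1 4"
proof -
  have "[[x; y]; z] \<in> \<gamma> 3" "t \<in> \<gamma> 1"
    using xyzt Y_G by (auto intro!: commutator_in_lower_central_3)
  then have "rep \<phi> [[[x; y]; z]; t] 0 4 =
      rep \<phi> [[x; y]; z] 0 (0 + 3) * rep \<phi> t (0 + 3) 4 - rep \<phi> t 0 (0 + 1) * rep \<phi> [[x; y]; z] (0 + 1) 4"
    by (rule rep_commutator[OF \<phi>]) simp_all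
  then show ?thesis
    using rep_weight_1[OF \<phi> xyzt(4), of 4 3] rep_weight_1[OF \<phi> xyzt(4), of 1 0] by simp
qed

lemma coef_weight_2:
  assumes "{y1, y2, x1, x2} \<subseteq> Y"
  shows "coef [y1, y2] [x1; x2] = of_bool (y1 = x1 \<and> y2 = x2) - of_bool (y1 = x2 \<and> y2 = x1)"
proof -
  let ?\<phi> = "letters [y1, y2]"
  have \<phi>: "range ?\<phi> \<subseteq> Y" using assms by (intro letters_Y) auto
  have l: "?\<phi> 0 = y1" "?\<phi> (Suc 0) = y2" by (simp_all add: letters_def)
  show ?thesis
    using rep_weight_2[OF \<phi>, of x1 x2 2 0] assms by (simp add: coef_def l eval_nat_numeral)
qed

lemma coef_weight_3:
  assumes "{y1, y2, y3, x1, x2, x3} \<subseteq> Y"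
  shows "coef [y1, y2, y3] [[x1; x2]; x3] =
      of_bool (y1 = x1 \<and> y2 = x2 \<and> y3 = x3) - of_bool (y1 = x2 \<and> y2 = x1 \<and> y3 = x3)
      - of_bool (y1 = x3 \<and> y2 = x1 \<and> y3 = x2) + of_bool (y1 = x3 \<and> y2 = x2 \<and> y3 = x1)"
proof -
  let ?\<phi> = "letters [y1, y2, y3]"
  have \<phi>: "range ?\<phi> \<subseteq> Y" using assms by (intro letters_Y) auto
  have l: "?\<phi> 0 = y1" "?\<phi> (Suc 0) = y2" "?\<phi> 1 = y2" "?\<phi> (Suc 1) = y3" "?\<phi> 2 = y3"
    by (simp_all add: letters_def)
  have x: "x1 \<in> Y" "x2 \<in> Y" "x3 \<in> Y" using assms by auto
  note w2 = rep_weight_2[OF \<phi> x(1,2)]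
  have 2: "rep ?\<phi> [x1; x2] 0 2 = of_bool (y1 = x1 \<and> y2 = x2) - of_bool (y1 = x2 \<and> y2 = x1)"
    "rep ?\<phi> [x1; x2] 1 3 = of_bool (y2 = x1 \<and> y3 = x2) - of_bool (y2 = x2 \<and> y3 = x1)"
    by (subst w2, simp, simp only: l)+
  have 3: "rep ?\<phi> [[x1; x2]; x3] 0 3 = rep ?\<phi> [x1; x2] 0 2 * of_bool (y3 = x3) - of_bool (y1 = x3) * rep ?\<phi> [x1; x2] 1 3"
    by (subst rep_weight_3[OF \<phi> x, where k = 2 and l = 1], simp, simp, simp, simp only: l)
  have "coef [y1, y2, y3] [[x1; x2]; x3] = rep ?\<phi> [[x1; x2]; x3] 0 3"
    by (simp add: coef_def eval_nat_numeral)
  then show ?thesis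
    unfolding 3 2 of_bool_conj by (simp only: algebra_simps)
qed

lemma coef_weight_4:
  assumes "{y1, y2, y3, y4, x1, x2, x3, x4} \<subseteq> Y"
  shows "coef [y1, y2, y3, y4] [[[x1; x2]; x3]; x4] =
      of_bool (y1 = x1 \<and> y2 = x2 \<and> y3 = x3 \<and> y4 = x4) - of_bool (y1 = x2 \<and> y2 = x1 \<and> y3 = x3 \<and> y4 = x4)
      - of_bool (y1 = x3 \<and> y2 = x1 \<and> y3 = x2 \<and> y4 = x4) + of_bool (y1 = x3 \<and> y2 = x2 \<and> y3 = x1 \<and> y4 = x4)
      - of_bool (y1 = x4 \<and> y2 = x1 \<and> y3 = x2 \<and> y4 = x3) + of_bool (y1 = x4 \<and> y2 = x2 \<and> y3 = x1 \<and> y4 = x3)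
      + of_bool (y1 = x4 \<and> y2 = x3 \<and> y3 = x1 \<and> y4 = x2) - of_bool (y1 = x4 \<and> y2 = x3 \<and> y3 = x2 \<and> y4 = x1)"
proof -
  let ?\<phi> = "letters [y1, y2, y3, y4]"
  have \<phi>: "range ?\<phi> \<subseteq> Y" using assms by (intro letters_Y) auto
  have l: "?\<phi> 0 = y1" "?\<phi> 1 = y2" "?\<phi> (Suc 0) = y2" "?\<phi> (Suc 1) = y3" "?\<phi> 2 = y3" "?\<phi> (Suc 2) = y4" "?\<phi> 3 = y4"
    by (simp_all add: letters_def)
  have x: "x1 \<in> Y" "x2 \<in> Y" "x3 \<in> Y" "x4 \<in> Y" using assms by auto
  note w2 = rep_weight_2[OF \<phi> x(1,2)] and w3 = rep_weight_3[OF \<phi> x(1-3)]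
  have 2: "rep ?\<phi> [x1; x2] 0 2 = of_bool (y1 = x1 \<and> y2 = x2) - of_bool (y1 = x2 \<and> y2 = x1)"
    "rep ?\<phi> [x1; x2] 1 3 = of_bool (y2 = x1 \<and> y3 = x2) - of_bool (y2 = x2 \<and> y3 = x1)"
    "rep ?\<phi> [x1; x2] 2 4 = of_bool (y3 = x1 \<and> y4 = x2) - of_bool (y3 = x2 \<and> y4 = x1)"
    by (subst w2, simp, simp only: l)+
  have 3: "rep ?\<phi> [[x1; x2]; x3] 0 3 = rep ?\<phi> [x1; x2] 0 2 * of_bool (y3 = x3) - of_bool (y1 = x3) * rep ?\<phi> [x1; x2] 1 3"
    "rep ?\<phi> [[x1; x2]; x3] 1 4 = rep ?\<phi> [x1; x2] 1 3 * of_bool (y4 = x3) - of_bool (y2 = x3) * rep ?\<phi> [x1; x2] 2 4"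
    by (subst w3[where k = 2 and l = 1], simp, simp, simp, simp only: l)
       (subst w3[where k = 3 and l = 2], simp, simp, simp, simp only: l)
  have "coef [y1, y2, y3, y4] [[[x1; x2]; x3]; x4] = rep ?\<phi> [[[x1; x2]; x3]; x4] 0 4"
    by (simp add: coef_def eval_nat_numeral)
  then show ?thesis
    unfolding rep_weight_4[OF \<phi> x] l 3 2 of_bool_conj by (simp only: algebra_simps)
qed

lemma coef_weight_22:
  assumes "{y1, y2, y3, y4, x1, x2, x3, x4} \<subseteq> Y"
  shows "coef [y1, y2, y3, y4] [[x1; x2]; [x3; x4]] =
      of_bool (y1 = x1 \<and> y2 = x2 \<and> y3 = x3 \<and> y4 = x4) - of_bool (y1 = x2 \<and> y2 = x1 \<and> y3 = x3 \<and> y4 = x4)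
      - of_bool (y1 = x1 \<and> y2 = x2 \<and> y3 = x4 \<and> y4 = x3) + of_bool (y1 = x2 \<and> y2 = x1 \<and> y3 = x4 \<and> y4 = x3)
      - of_bool (y1 = x3 \<and> y2 = x4 \<and> y3 = x1 \<and> y4 = x2) + of_bool (y1 = x3 \<and> y2 = x4 \<and> y3 = x2 \<and> y4 = x1)
      + of_bool (y1 = x4 \<and> y2 = x3 \<and> y3 = x1 \<and> y4 = x2) - of_bool (y1 = x4 \<and> y2 = x3 \<and> y3 = x2 \<and> y4 = x1)"
proof -
  let ?\<phi> = "letters [y1, y2, y3, y4]"
  have \<phi>: "range ?\<phi> \<subseteq> Y" using assms by (intro letters_Y) auto
  have l: "?\<phi> 0 = y1" "?\<phi> 1 = y2" "?\<phi> (Suc 0) = y2" "?\<phi> (Suc 1) = y3" "?\<phi> 2 = y3" "?\<phi> (Suc 2) = y4" "?\<phi> 3 = y4"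
    by (simp_all add: letters_def)
  have "[x1; x2] \<in> \<gamma> 2" "[x3; x4] \<in> \<gamma> 2"
    using assms Y_G by (intro commutator_in_lower_central_2; blast)+
  then have "rep ?\<phi> [[x1; x2]; [x3; x4]] 0 4 =
      rep ?\<phi> [x1; x2] 0 2 * rep ?\<phi> [x3; x4] 2 4 - rep ?\<phi> [x3; x4] 0 2 * rep ?\<phi> [x1; x2] 2 4"
    by (rule rep_commutator[OF \<phi>, of _ 2 _ 2 4 0, unfolded add_0]) simp_all
  moreover have "coef [y1, y2, y3, y4] [[x1; x2]; [x3; x4]] = rep ?\<phi> [[x1; x2]; [x3; x4]] 0 4"
    by (simp add: coef_def eval_nat_numeral)
  moreover have "rep ?\<phi> [x; y] 0 2 = of_bool (y1 = x \<and> y2 = y) - of_bool (y1 = y \<and> y2 = x)"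
    "rep ?\<phi> [x; y] 2 4 = of_bool (y3 = x \<and> y4 = y) - of_bool (y3 = y \<and> y4 = x)"
    if "x \<in> Y" "y \<in> Y" for x y
    by (subst rep_weight_2[OF \<phi> that], simp, simp only: l)+
  ultimately have "coef [y1, y2, y3, y4] [[x1; x2]; [x3; x4]] =
      (of_bool (y1 = x1 \<and> y2 = x2) - of_bool (y1 = x2 \<and> y2 = x1)) * (of_bool (y3 = x3 \<and> y4 = x4) - of_bool (y3 = x4 \<and> y4 = x3))
    - (of_bool (y1 = x3 \<and> y2 = x4) - of_bool (y1 = x4 \<and> y2 = x3)) * (of_bool (y3 = x1 \<and> y4 = x2) - of_bool (y3 = x2 \<and> y4 = x1))"
    using assms by (simp only: insert_subset)
  then show ?thesis unfolding of_bool_conj by (simp only: algebra_simps)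
qed

text \<open>
  Only the words in the expansion of a commutator have a nonzero coefficient.
\<close>

lemma coef_weight_2_eq_0:
  assumes "{y1, y2, x1, x2} \<subseteq> Y"
    and "\<not> (y1 = x1 \<and> y2 = x2)"
      "\<not> (y1 = x2 \<and> y2 = x1)"
  shows "coef [y1, y2] [x1; x2] = 0"
  unfolding coef_weight_2[OF assms(1)] using assms(2-) by (simp only: of_bool_eq)

lemma coef_weight_3_eq_0:
  assumes "{y1, y2, y3, x1, x2, x3} \<subseteq> Y"
    and "\<not> (y1 = x1 \<and> y2 = x2 \<and> y3 = x3)"
      "\<not> (y1 = x2 \<and> y2 = x1 \<and> y3 = x3)"
      "\<not> (y1 = x3 \<and> y2 = x1 \<and> y3 = x2)"
      "\<not> (y1 = x3 \<and> y2 = x2 \<and> y3 = x1)"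
  shows "coef [y1, y2, y3] [[x1; x2]; x3] = 0"
  unfolding coef_weight_3[OF assms(1)] using assms(2-) by (simp only: of_bool_eq)

lemma coef_weight_4_eq_0:
  assumes "{y1, y2, y3, y4, x1, x2, x3, x4} \<subseteq> Y"
    and "\<not> (y1 = x1 \<and> y2 = x2 \<and> y3 = x3 \<and> y4 = x4)"
      "\<not> (y1 = x2 \<and> y2 = x1 \<and> y3 = x3 \<and> y4 = x4)"
      "\<not> (y1 = x3 \<and> y2 = x1 \<and> y3 = x2 \<and> y4 = x4)"
      "\<not> (y1 = x3 \<and> y2 = x2 \<and> y3 = x1 \<and> y4 = x4)"
      "\<not> (y1 = x4 \<and> y2 = x1 \<and> y3 = x2 \<and> y4 = x3)"
      "\<not> (y1 = x4 \<and> y2 = x2 \<and> y3 = x1 \<and> y4 = x3)"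
      "\<not> (y1 = x4 \<and> y2 = x3 \<and> y3 = x1 \<and> y4 = x2)"
      "\<not> (y1 = x4 \<and> y2 = x3 \<and> y3 = x2 \<and> y4 = x1)"
  shows "coef [y1, y2, y3, y4] [[[x1; x2]; x3]; x4] = 0"
  unfolding coef_weight_4[OF assms(1)] using assms(2-) by (simp only: of_bool_eq)

lemma coef_weight_22_eq_0:
  assumes "{y1, y2, y3, y4, x1, x2, x3, x4} \<subseteq> Y"
    and "\<not> (y1 = x1 \<and> y2 = x2 \<and> y3 = x3 \<and> y4 = x4)"
      "\<not> (y1 = x2 \<and> y2 = x1 \<and> y3 = x3 \<and> y4 = x4)"
      "\<not> (y1 = x1 \<and> y2 = x2 \<and> y3 = x4 \<and> y4 = x3)"
      "\<not> (y1 = x2 \<and> y2 = x1 \<and> y3 = x4 \<and> y4 = x3)"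
      "\<not> (y1 = x3 \<and> y2 = x4 \<and> y3 = x1 \<and> y4 = x2)"
      "\<not> (y1 = x3 \<and> y2 = x4 \<and> y3 = x2 \<and> y4 = x1)"
      "\<not> (y1 = x4 \<and> y2 = x3 \<and> y3 = x1 \<and> y4 = x2)"
      "\<not> (y1 = x4 \<and> y2 = x3 \<and> y3 = x2 \<and> y4 = x1)"
  shows "coef [y1, y2, y3, y4] [[x1; x2]; [x3; x4]] = 0"
  unfolding coef_weight_22[OF assms(1)] using assms(2-) by (simp only: of_bool_eq)

lemma lower_central_2_subsetI:
  assumes "subgroup P G" "\<gamma> 3 \<subseteq> P" "\<And>x y. x \<in> Y \<Longrightarrow> y \<in> Y \<Longrightarrow> [x; y] \<in> P"
  shows "\<gamma> 2 \<subseteq> P"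
  using lower_central_Suc_subsetI[of 1 P Y Y] assms Y_gen Y_G by (simp add: eval_nat_numeral)

lemma lower_central_3_subsetI:
  assumes "subgroup P G" "\<gamma> 4 \<subseteq> P"
    "\<And>x y z. x \<in> Y \<Longrightarrow> y \<in> Y \<Longrightarrow> z \<in> Y \<Longrightarrow> [[x; y]; z] \<in> P"
  shows "\<gamma> 3 \<subseteq> P"
proof -
  let ?U = "{[x; y] | x y. x \<in> Y \<and> y \<in> Y}"
  have U: "?U \<subseteq> \<gamma> 2"
    using Y_G by (auto intro!: commutator_in_lower_central_2)
  have "\<gamma> 2 \<subseteq> generate G (?U \<union> \<gamma> 3)"
    by (rule lower_central_2_subsetI) (use Y_G in \<open>auto intro!: generate_is_subgroup intro: generate.incl\<close>)
  then have "\<gamma> (Suc 2) \<subseteq> P"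
    by (intro lower_central_Suc_subsetI[of 2 P ?U Y] assms(1) Y_gen Y_G)
       (use assms U in \<open>auto simp: eval_nat_numeral\<close>)
  then show ?thesis by simp
qed

lemma lower_central_4_subsetI:
  assumes "subgroup P G" "\<gamma> 5 \<subseteq> P"
    "\<And>x y z t. x \<in> Y \<Longrightarrow> y \<in> Y \<Longrightarrow> z \<in> Y \<Longrightarrow> t \<in> Y \<Longrightarrow> [[[x; y]; z]; t] \<in> P"
  shows "\<gamma> 4 \<subseteq> P"
proof -
  let ?U = "{[[x; y]; z] | x y z. x \<in> Y \<and> y \<in> Y \<and> z \<in> Y}"
  have U: "?U \<subseteq> \<gamma> 3"
    using Y_G by (auto intro!: commutator_in_lower_central_3)
  have "\<gamma> 3 \<subseteq> generate G (?U \<union> \<gamma> 4)"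
    by (rule lower_central_3_subsetI) (use Y_G in \<open>auto intro!: generate_is_subgroup intro: generate.incl\<close>)
  then have "\<gamma> (Suc 3) \<subseteq> P"
    by (intro lower_central_Suc_subsetI[of 3 P ?U Y] assms(1) Y_gen Y_G)
       (use assms U in \<open>auto simp: eval_nat_numeral\<close>)
  then show ?thesis by simp
qed


section \<open>Elements with vanishing coefficients\<close>

abbreviation C :: "'a set" where "C \<equiv> commutator_subgroup G (carrier G) S"

text \<open>
  The three factors on the right hand side of the theorem. They are normal subgroups, so the
  subgroup that they generate is their product.
\<close>

definition target_factors :: "'a set" where
  "target_factors = \<gamma> 5 \<union> commutator_subgroup G (commutator_subgroup G C S) S
     \<union> commutator_subgroup G C C"

lemma S_subgroup: "subgroup S G"
  using S by (rule normal_imp_subgroup)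

lemma C_normal: "C \<lhd> G"
  by (intro commutator_subgroup_normal carrier_normal S)

lemma C_lower_central: "C \<subseteq> \<gamma> 2"
  using S_G by (intro commutator_subgroup_least lower_central_subgroup commutator_in_lower_central_2) auto

lemma CS_lower_central: "commutator_subgroup G C S \<subseteq> \<gamma> 3"
proof (intro commutator_subgroup_least lower_central_subgroup)
  fix c s assume "c \<in> C" "s \<in> S"
  then show "[c; s] \<in> \<gamma> 3"
    using commutator_lower_central[of 2 c s] C_lower_central S_G by (auto simp: eval_nat_numeral)
qed

lemma CSS_lower_central: "commutator_subgroup G (commutator_subgroup G C S) S \<subseteq> \<gamma> 4"
proof (intro commutator_subgroup_least lower_central_subgroup)
  fix c s assume "c \<in> commutator_subgroup G C S" "s \<in> S"
  then show "[c; s] \<in> \<gamma> 4"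
    using commutator_lower_central[of 3 c s] CS_lower_central S_G by (auto simp: eval_nat_numeral)
qed

lemma CC_lower_central: "commutator_subgroup G C C \<subseteq> \<gamma> 4"
proof (intro commutator_subgroup_least lower_central_subgroup)
  fix c d assume "c \<in> C" "d \<in> C"
  then show "[c; d] \<in> \<gamma> 4"
    using commutator_lower_central_2[of 2 d c] C_lower_central by (auto simp: eval_nat_numeral)
qed

lemma target_factors_lower_central: "target_factors \<subseteq> \<gamma> 4"
  unfolding target_factors_def
  using lower_central_antimono[of 4 5] CSS_lower_central CC_lower_central by auto

text \<open>
  If the last two letters of a word lie in \<open>B\<close>, then the last two superdiagonal entries of its
  representation vanish on \<open>S\<close>. Hence the entry at $(2,4)$ vanishes on \<open>C\<close>, because it is the bracket of these
  two. Each term of the bracket formula for an element of $[C,S,S]$ or $[C,C]$ contains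
  one of these entries, so the coefficient of the word is zero there.
\<close>

lemma rep_S_eq_0:
  assumes "range \<phi> \<subseteq> Y" "\<phi> i \<in> B" "s \<in> S"
  shows "rep \<phi> s i (Suc i) = 0"
proof -
  have "s \<in> carrier G" using assms(3) S_G by blast
  then show ?thesis using rep(2)[OF assms(1), of s i] f_S[OF assms(2,3)] by simp
qed

lemma rep_generate_eq_0:
  assumes "range \<phi> \<subseteq> Y" "n \<ge> 1" "T \<subseteq> \<gamma> n" "\<And>t. t \<in> T \<Longrightarrow> rep \<phi> t i (i + n) = 0"
    "w \<in> generate G T"
  shows "rep \<phi> w i (i + n) = 0"
  by (rule additive_generate_zero[where e = "\<lambda>w. rep \<phi> w i (i + n)", OF lower_central_subgroup[of n] _ assms(3,4,5)])
     (rule rep_add[OF assms(1,2)])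

lemma rep_C_eq_0:
  assumes \<phi>: "range \<phi> \<subseteq> Y" "\<phi> 2 \<in> B" "\<phi> 3 \<in> B" and c: "c \<in> C"
  shows "rep \<phi> c 2 4 = 0"
proof -
  have "rep \<phi> c 2 (2 + 2) = 0"
  proof (rule rep_generate_eq_0[OF \<phi>(1)])
    show "c \<in> generate G {[g; s] | g s. g \<in> carrier G \<and> s \<in> S}"
      using c unfolding commutator_subgroup_eq .
    show "{[g; s] | g s. g \<in> carrier G \<and> s \<in> S} \<subseteq> \<gamma> 2"
      using S_G by (auto intro!: commutator_in_lower_central_2)
    fix t assume "t \<in> {[g; s] | g s. g \<in> carrier G \<and> s \<in> S}"
    then obtain g s where t: "t = [g; s]" "g \<in> carrier G" "s \<in> S" by blast
    have "g \<in> \<gamma> 1" "s \<in> \<gamma> 1" using t S_G by auto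
    then have "rep \<phi> [g; s] 2 (2 + 2) =
        rep \<phi> g 2 (2 + 1) * rep \<phi> s (2 + 1) (2 + 2) - rep \<phi> s 2 (2 + 1) * rep \<phi> g (2 + 1) (2 + 2)"
      by (rule rep_commutator[OF \<phi>(1)]) simp_all
    then show "rep \<phi> t 2 (2 + 2) = 0"
      using rep_S_eq_0[OF \<phi>(1,2) t(3)] rep_S_eq_0[OF \<phi>(1,3) t(3)] t by simp
  qed simp
  then show ?thesis by simp
qed

lemma coef_target_factors:
  assumes y: "{y1, y2} \<subseteq> Y" "{y3, y4} \<subseteq> B" and w: "w \<in> target_factors"
  shows "coef [y1, y2, y3, y4] w = 0"
proof -
  let ?\<phi> = "letters [y1, y2, y3, y4]"
  let ?r = "rep ?\<phi>"
  have \<phi>: "range ?\<phi> \<subseteq> Y" using y by (intro letters_Y) auto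
  have l: "?\<phi> 2 = y3" "?\<phi> 3 = y4" by (simp_all add: letters_def)
  have coef: "coef [y1, y2, y3, y4] w = ?r w 0 4" for w
    by (simp add: coef_def eval_nat_numeral)
  have rS: "?r s 3 4 = 0" if "s \<in> S" for s
    using rep_S_eq_0[OF \<phi> _ that, of 3] y l by simp
  have rC: "?r c 2 4 = 0" if "c \<in> C" for c
    using rep_C_eq_0[OF \<phi> _ _ that] y l by simp
  note zero = rep_generate_eq_0[OF \<phi>]
  have rCS: "?r u 1 4 = 0" if u: "u \<in> commutator_subgroup G C S" for u
  proof -
    have "?r u 1 (1 + 3) = 0"
    proof (rule zero)
      show "u \<in> generate G {[c; s] | c s. c \<in> C \<and> s \<in> S}"
        using u unfolding commutator_subgroup_eq[of C S] .
      show "{[c; s] | c s. c \<in> C \<and> s \<in> S} \<subseteq> \<gamma> 3"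
        using CS_lower_central commutator_in_commutator_subgroup[of _ C _ S] by blast
      fix t assume "t \<in> {[c; s] | c s. c \<in> C \<and> s \<in> S}"
      then obtain c s where t: "t = [c; s]" "c \<in> C" "s \<in> S" by blast
      have "c \<in> \<gamma> 2" "s \<in> \<gamma> 1" using t S_G C_lower_central by auto
      then have "?r [c; s] 1 (1 + 3) = ?r c 1 (1 + 2) * ?r s (1 + 2) (1 + 3) - ?r s 1 (1 + 1) * ?r c (1 + 1) (1 + 3)"
        by (rule rep_commutator[OF \<phi>]) simp_all
      then show "?r t 1 (1 + 3) = 0" using rS[OF t(3)] rC[OF t(2)] t
        by (simp add: numeral_2_eq_2[symmetric])
    qed simp
    then show ?thesis by simp
  qed
  consider "w \<in> \<gamma> 5" | "w \<in> commutator_subgroup G (commutator_subgroup G C S) S"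
    | "w \<in> commutator_subgroup G C C" using w by (auto simp: target_factors_def)
  then show ?thesis
  proof cases
    case 1
    then show ?thesis
      unfolding coef using vanishes_belowD[OF unitriangular_hom_lower_central[OF rep(1)[OF \<phi>]], of w 5 0 4] by simp
  next
    case 2
    have "?r w 0 (0 + 4) = 0"
    proof (rule zero)
      show "w \<in> generate G {[u; s] | u s. u \<in> commutator_subgroup G C S \<and> s \<in> S}"
        using 2 unfolding commutator_subgroup_eq[of "commutator_subgroup G C S" S] .
      show "{[u; s] | u s. u \<in> commutator_subgroup G C S \<and> s \<in> S} \<subseteq> \<gamma> 4"
        using CSS_lower_central commutator_in_commutator_subgroup[of _ "commutator_subgroup G C S" _ S] by blast
      fix t assume "t \<in> {[u; s] | u s. u \<in> commutator_subgroup G C S \<and> s \<in> S}"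
      then obtain u s where t: "t = [u; s]" "u \<in> commutator_subgroup G C S" "s \<in> S" by blast
      have "u \<in> \<gamma> 3" "s \<in> \<gamma> 1" using t S_G CS_lower_central by auto
      then have "?r [u; s] 0 (0 + 4) = ?r u 0 (0 + 3) * ?r s (0 + 3) (0 + 4) - ?r s 0 (0 + 1) * ?r u (0 + 1) (0 + 4)"
        by (rule rep_commutator[OF \<phi>]) simp_all
      then show "?r t 0 (0 + 4) = 0" using rS[OF t(3)] rCS[OF t(2)] t by simp
    qed simp
    then show ?thesis unfolding coef by simp
  next
    case 3
    have "?r w 0 (0 + 4) = 0"
    proof (rule zero)
      show "w \<in> generate G {[c; d] | c d. c \<in> C \<and> d \<in> C}"
        using 3 unfolding commutator_subgroup_eq[of C C] .
      show "{[c; d] | c d. c \<in> C \<and> d \<in> C} \<subseteq> \<gamma> 4"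
        using CC_lower_central commutator_in_commutator_subgroup[of _ C _ C] by blast
      fix t assume "t \<in> {[c; d] | c d. c \<in> C \<and> d \<in> C}"
      then obtain c d where t: "t = [c; d]" "c \<in> C" "d \<in> C" by blast
      have "c \<in> \<gamma> 2" "d \<in> \<gamma> 2" using t C_lower_central by auto
      then have "?r [c; d] 0 (0 + 4) = ?r c 0 (0 + 2) * ?r d (0 + 2) (0 + 4) - ?r d 0 (0 + 2) * ?r c (0 + 2) (0 + 4)"
        by (rule rep_commutator[OF \<phi>]) simp_all
      then show "?r t 0 (0 + 4) = 0" using rC[OF t(2)] rC[OF t(3)] t
        by (simp add: numeral_2_eq_2[symmetric])
    qed simp
    then show ?thesis unfolding coef by simp
  qed
qed

text \<open>In weight one the coefficients are the coordinates of an element of $G/G'$.\<close>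

lemma lower_central_2_if_coef_zero:
  assumes "w \<in> carrier G" "\<And>y. y \<in> Y \<Longrightarrow> f y w = 0"
  shows "w \<in> lower_central G 2"
proof -
  have L: "generate G (lower_central G 2) = lower_central G 2" by (rule generate_lower_central)
  have "w \<in> generate G (lower_central G 2)"
  proof (rule mem_generate_if_dual_functionals_vanish[where s = id and I = Y and e = f, OF subgroup_self])
    show "f i x = 0" if "i \<in> Y" "x \<in> lower_central G 2" for i x
    proof -
      have \<phi>: "range (\<lambda>_. i) \<subseteq> Y" using that by auto
      have "rep (\<lambda>_. i) x 0 (Suc 0) = 0"
        by (rule vanishes_belowD[OF unitriangular_hom_lower_central[OF rep(1)[OF \<phi>] that(2)]]) auto
      then show ?thesis using rep(2)[OF \<phi>, of x 0] that(2) by auto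
    qed
    show "[x; y] \<in> generate G (lower_central G 2)" if "x \<in> carrier G" "y \<in> carrier G" for x y
      using that commutator_in_lower_central_2 L by simp
    show "w \<in> generate G (id ` Y \<union> lower_central G 2)" using Y_gen assms by auto
  qed (use assms Y_add Y_dual Y_G in auto)
  then show ?thesis using L by simp
qed


text \<open>
  A coefficient of a word of length $n$ is an entry on superdiagonal $n$, and these vanish on $\gamma_{n+1}$.
\<close>

lemma coef_lower_central_Suc:
  assumes "set ys \<subseteq> Y" "ys \<noteq> []" "w \<in> \<gamma> n" "n = Suc (length ys)"
  shows "coef ys w = 0"
  unfolding coef_def
  by (rule vanishes_belowD[OF unitriangular_hom_lower_central[OF rep(1)[OF letters_Y[OF assms(1,2)]] assms(3)]])
     (use assms in auto)

text \<open>
  One step of elimination: the commutators \<open>s i\<close> are removed by means of the words \<open>ys i\<close>, each of which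
  occurs in the expansion of one of them.
\<close>

lemma mem_generate_if_coef_zero:
  assumes n: "n \<ge> 1"
    and w: "w \<in> generate G (s ` I \<union> T)"
    and I: "\<And>i. i \<in> I \<Longrightarrow> set (ys i) \<subseteq> Y \<and> length (ys i) = n \<and> s i \<in> \<gamma> n \<and>
      coef (ys i) (s i) \<noteq> 0 \<and> coef (ys i) w = 0"
    and off: "\<And>i j. i \<in> I \<Longrightarrow> j \<in> I \<Longrightarrow> i \<noteq> j \<Longrightarrow> coef (ys i) (s j) = 0"
    and T: "T \<subseteq> \<gamma> n" "\<gamma> (Suc n) \<subseteq> T"
      "\<And>i t. i \<in> I \<Longrightarrow> t \<in> T \<Longrightarrow> coef (ys i) t = 0"
  shows "w \<in> generate G T"
proof (rule mem_generate_if_dual_functionals_vanish[where s = s and I = I and e = "\<lambda>i. coef (ys i)"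
      and \<Gamma> = "\<gamma> n"])
  show "coef (ys i) (x \<otimes> y) = coef (ys i) x + coef (ys i) y"
    if "i \<in> I" "x \<in> \<gamma> n" "y \<in> \<gamma> n" for i x y
    using I[OF that(1)] that n by (intro coef_add) auto
  show "[x; y] \<in> generate G T" if "x \<in> \<gamma> n" "y \<in> \<gamma> n" for x y
    using commutator_lower_central[OF n that(1), of y] that T(2) by (auto intro: generate.incl)
qed (use assms lower_central_subgroup in auto)

text \<open>
  For a strict linear order of the letters, the commutator $[m,p]$ with $m < p$ is singled out by the
  word $mp$.
\<close>

lemma lower_central_3_if_coef_zero:
  assumes w: "w \<in> \<gamma> 2" "\<And>x y. x \<in> Y \<Longrightarrow> y \<in> Y \<Longrightarrow> coef [x, y] w = 0"
  shows "w \<in> \<gamma> 3"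
proof -
  obtain lt :: "'a \<Rightarrow> 'a \<Rightarrow> bool" where wf: "wfp lt"
    and total: "\<And>x y. x \<noteq> y \<Longrightarrow> lt x y \<or> lt y x"
    by (rule well_order_with_initial_segment[of UNIV]) blast
  have asym: "\<not> lt y x" if "lt x y" for x y using asympD[OF wfp_imp_asymp[OF wf] that] .
  let ?I = "{(m, p). m \<in> Y \<and> p \<in> Y \<and> lt m p \<and> \<not> lt p m \<and> m \<noteq> p}"
  let ?s = "\<lambda>(m, p). [m; p]"
  let ?P = "generate G (?s ` ?I \<union> \<gamma> 3)"
  have sub: "?s ` ?I \<union> \<gamma> 3 \<subseteq> carrier G" using Y_G by auto
  have P: "subgroup ?P G" by (rule generate_is_subgroup[OF sub])
  have "\<gamma> 2 \<subseteq> ?P"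
  proof (rule lower_central_2_subsetI[OF P])
    show "\<gamma> 3 \<subseteq> ?P" by (auto intro: generate.incl)
    fix x y assume xy: "x \<in> Y" "y \<in> Y"
    have lt: "[x; y] \<in> ?P" if "x \<in> Y" "y \<in> Y" "lt x y" for x y
      using that asym[of x y] by (intro generate.incl UnI1 image_eqI[of _ _ "(x, y)"]) auto
    consider "x = y" | "lt x y" | "lt y x" using total by blast
    then show "[x; y] \<in> ?P"
    proof cases
      case 1
      then show ?thesis using xy Y_G commutator_self[of x] subgroup.one_closed[OF P] by auto
    qed (use lt[of x y] lt[of y x] xy commutator_swap_iff[OF P] Y_G in auto)
  qed
  then have "w \<in> ?P" using w by blast
  then have "w \<in> generate G (\<gamma> 3)"
  proof (rule mem_generate_if_coef_zero[where n = 2 and ys = "\<lambda>(m, p). [m, p]", rotated])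
    show "\<gamma> 3 \<subseteq> \<gamma> 2" by (rule lower_central_antimono) simp
    show "set ((\<lambda>(m, p). [m, p]) i) \<subseteq> Y \<and> length ((\<lambda>(m, p). [m, p]) i) = 2 \<and> ?s i \<in> \<gamma> 2 \<and>
        coef ((\<lambda>(m, p). [m, p]) i) (?s i) \<noteq> 0 \<and> coef ((\<lambda>(m, p). [m, p]) i) w = 0" if "i \<in> ?I" for i
      using that by (cases i) (auto simp: coef_weight_2 w(2) commutator_in_lower_central_2)
    show "coef ((\<lambda>(m, p). [m, p]) i) (?s j) = 0" if "i \<in> ?I" "j \<in> ?I" "i \<noteq> j" for i j
      using that by (cases i; cases j) (auto intro!: coef_weight_2_eq_0)
    show "coef ((\<lambda>(m, p). [m, p]) i) t = 0" if "i \<in> ?I" "t \<in> \<gamma> 3" for i t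
      using that by (auto intro!: coef_lower_central_Suc[where n = 3])
  qed simp_all
  then show ?thesis by (simp add: generate_lower_central)
qed

text \<open>
  The commutators $[m,p,q]$ with $m < p, q$ are singled out by the words $mpq$, and then the
  $[p,m,m]$ by the words $pmm$.
\<close>

lemma lower_central_4_if_coef_zero:
  assumes w: "w \<in> \<gamma> 3"
    "\<And>x y z. x \<in> Y \<Longrightarrow> y \<in> Y \<Longrightarrow> z \<in> Y \<Longrightarrow> coef [x, y, z] w = 0"
  shows "w \<in> \<gamma> 4"
proof -
  obtain lt :: "'a \<Rightarrow> 'a \<Rightarrow> bool" where wf: "wfp lt"
    and total: "\<And>x y. x \<noteq> y \<Longrightarrow> lt x y \<or> lt y x" and trans: "\<And>x y z. lt x y \<Longrightarrow> lt y z \<Longrightarrow> lt x z"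
    by (rule well_order_with_initial_segment[of UNIV]) blast
  have asym: "\<not> lt y x" if "lt x y" for x y using asympD[OF wfp_imp_asymp[OF wf] that] .
  let ?I1 = "{(m, p, q). m \<in> Y \<and> p \<in> Y \<and> q \<in> Y \<and> lt m p \<and> \<not> lt p m \<and> m \<noteq> p \<and> lt m q \<and> \<not> lt q m \<and> m \<noteq> q}"
  let ?s1 = "\<lambda>(m, p, q). [[m; p]; q]" and ?ys1 = "\<lambda>(m, p, q). [m, p, q]"
  let ?I2 = "{(p, m). m \<in> Y \<and> p \<in> Y \<and> lt m p \<and> \<not> lt p m \<and> m \<noteq> p}"
  let ?s2 = "\<lambda>(p, m). [[p; m]; m]" and ?ys2 = "\<lambda>(p, m). [p, m, m]"
  let ?P = "generate G (?s1 ` ?I1 \<union> (?s2 ` ?I2 \<union> \<gamma> 4))"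
  have sub: "?s1 ` ?I1 \<union> (?s2 ` ?I2 \<union> \<gamma> 4) \<subseteq> carrier G" using Y_G by auto
  have P: "subgroup ?P G" by (rule generate_is_subgroup[OF sub])
  have L: "\<gamma> 4 \<subseteq> ?P" by (auto intro: generate.incl)
  have "\<gamma> 3 \<subseteq> ?P"
  proof (rule lower_central_3_subsetI[OF P L], rule spanning_weight_3[OF P L Y_G, of lt])
    show "[[m; p]; q] \<in> ?P" if "m \<in> Y" "p \<in> Y" "q \<in> Y" "lt m p" "lt m q" for m p q
      using that asym[of m p] asym[of m q] by (intro generate.incl UnI1 image_eqI[of _ _ "(m, p, q)"]) auto
    show "[[p; m]; m] \<in> ?P" if "m \<in> Y" "p \<in> Y" "lt m p" for m p
      using that asym[of m p] by (intro generate.incl UnI2 UnI1 image_eqI[of _ _ "(p, m)"]) auto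
  qed (use total trans in auto)
  then have "w \<in> ?P" using w by blast
  then have "w \<in> generate G (?s2 ` ?I2 \<union> \<gamma> 4)"
  proof (rule mem_generate_if_coef_zero[where n = 3 and ys = ?ys1, rotated])
    show "?s2 ` ?I2 \<union> \<gamma> 4 \<subseteq> \<gamma> 3"
      using lower_central_antimono[of 3 4] by (auto intro: commutator_in_lower_central_3)
    show "set (?ys1 i) \<subseteq> Y \<and> length (?ys1 i) = 3 \<and> ?s1 i \<in> \<gamma> 3 \<and>
        coef (?ys1 i) (?s1 i) \<noteq> 0 \<and> coef (?ys1 i) w = 0" if "i \<in> ?I1" for i
      using that by (cases i) (auto simp: coef_weight_3 w(2) commutator_in_lower_central_3)
    show "coef (?ys1 i) (?s1 j) = 0" if "i \<in> ?I1" "j \<in> ?I1" "i \<noteq> j" for i j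
      using that by (cases i; cases j) (auto intro!: coef_weight_3_eq_0)
    show "coef (?ys1 i) t = 0" if i: "i \<in> ?I1" and t: "t \<in> ?s2 ` ?I2 \<union> \<gamma> 4" for i t
      using t
    proof
      assume "t \<in> \<gamma> 4"
      then show ?thesis using i by (auto intro!: coef_lower_central_Suc[where n = 4])
    qed (use i in \<open>auto intro!: coef_weight_3_eq_0\<close>)
  qed auto
  then have "w \<in> generate G (\<gamma> 4)"
  proof (rule mem_generate_if_coef_zero[where n = 3 and ys = ?ys2, rotated])
    show "\<gamma> 4 \<subseteq> \<gamma> 3" by (rule lower_central_antimono) simp
    show "set (?ys2 i) \<subseteq> Y \<and> length (?ys2 i) = 3 \<and> ?s2 i \<in> \<gamma> 3 \<and>
        coef (?ys2 i) (?s2 i) \<noteq> 0 \<and> coef (?ys2 i) w = 0" if "i \<in> ?I2" for i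
      using that by (cases i) (auto simp: coef_weight_3 w(2) commutator_in_lower_central_3)
    show "coef (?ys2 i) (?s2 j) = 0" if "i \<in> ?I2" "j \<in> ?I2" "i \<noteq> j" for i j
      using that by (cases i; cases j) (auto intro!: coef_weight_3_eq_0)
    show "coef (?ys2 i) t = 0" if "i \<in> ?I2" "t \<in> \<gamma> 4" for i t
      using that by (auto intro!: coef_lower_central_Suc[where n = 4])
  qed simp_all
  then show ?thesis by (simp add: generate_lower_central)
qed

lemma A_not_B: "a \<in> A \<Longrightarrow> a \<notin> B"
  using A_B_neq by blast

text \<open>
  Elimination in weight four, for words that end in two letters from \<open>B\<close>. Coefficients of such words vanish on
  the factors of the right hand side, which therefore remain untouched until the end.
\<close>

lemma mem_generate_target_factors_step:
  fixes ys :: "'i \<Rightarrow> 'a list"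
  assumes w: "w \<in> generate G (s ` I \<union> T)"
    and coef_w: "\<And>x y z t. x \<in> Y \<Longrightarrow> y \<in> Y \<Longrightarrow> z \<in> B \<Longrightarrow> t \<in> B \<Longrightarrow> coef [x, y, z, t] w = 0"
    and I: "\<And>i. i \<in> I \<Longrightarrow> \<exists>x y z t. ys i = [x, y, z, t] \<and> x \<in> Y \<and> y \<in> Y \<and> z \<in> B \<and> t \<in> B \<and>
      s i \<in> \<gamma> 4 \<and> coef (ys i) (s i) \<noteq> 0"
    and off: "\<And>i j. i \<in> I \<Longrightarrow> j \<in> I \<Longrightarrow> i \<noteq> j \<Longrightarrow> coef (ys i) (s j) = 0"
    and T: "T \<subseteq> \<gamma> 4" "target_factors \<subseteq> T"
      "\<And>i t. i \<in> I \<Longrightarrow> t \<in> T - target_factors \<Longrightarrow> coef (ys i) t = 0"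
  shows "w \<in> generate G T"
proof (rule mem_generate_if_coef_zero[OF _ w, of 4])
  show "set (ys i) \<subseteq> Y \<and> length (ys i) = 4 \<and> s i \<in> \<gamma> 4 \<and>
      coef (ys i) (s i) \<noteq> 0 \<and> coef (ys i) w = 0" if "i \<in> I" for i
    using I[OF that] coef_w by fastforce
  show "coef (ys i) t = 0" if "i \<in> I" "t \<in> T" for i t
  proof (cases "t \<in> target_factors")
    case True
    obtain x y z t where "ys i = [x, y, z, t]" "{x, y} \<subseteq> Y" "{z, t} \<subseteq> B" using I[OF \<open>i \<in> I\<close>] by auto
    then show ?thesis using coef_target_factors True by auto
  next
    case False
    then show ?thesis using T(3) that by blast
  qed
  show "\<gamma> (Suc 4) \<subseteq> T" using T(2) by (simp add: target_factors_def)
qed (use off T in auto)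

text \<open>
  The generators of weight four are eliminated in this order, with the words that single them out:
  $[a,b,b',a']$ by $a'abb'$; $[a,b,b',b'']$ by $abb'b''$; and, for letters from \<open>B\<close> with $m < p, q, r$,
  $[m,p,q,r]$ by $mpqr$; $[p,m,m,m]$ by $pmmm$; $[p,m,m,q]$ by $mmpq$; $[[p,m],[q,m]]$ with
  $q < p$ by $mpmq$. The order matters: the word $mpmq$ also occurs in the expansion of $[p,m,m,q]$.
\<close>

lemma mem_target_factors_if_coef_zero:
  assumes w: "w \<in> \<gamma> 4"
    "\<And>x y z t. x \<in> Y \<Longrightarrow> y \<in> Y \<Longrightarrow> z \<in> B \<Longrightarrow> t \<in> B \<Longrightarrow> coef [x, y, z, t] w = 0"
  shows "w \<in> generate G target_factors"
proof -
  obtain lt :: "'a \<Rightarrow> 'a \<Rightarrow> bool" where wf: "wfp lt"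
    and total: "\<And>x y. x \<noteq> y \<Longrightarrow> lt x y \<or> lt y x" and trans: "\<And>x y z. lt x y \<Longrightarrow> lt y z \<Longrightarrow> lt x z"
    by (rule well_order_with_initial_segment[of UNIV]) blast
  have asym: "\<not> lt y x" if "lt x y" for x y using asympD[OF wfp_imp_asymp[OF wf] that] .
  \<comment> \<open>the order relations are spelled out because each of them excludes coincidences of words\<close>
  let ?I1 = "{(a, b, b', a'). a \<in> A \<and> b \<in> B \<and> b' \<in> B \<and> a' \<in> A}"
  let ?s1 = "\<lambda>(a, b, b', a'). [[[a; b]; b']; a']"
  let ?ys1 = "\<lambda>(a, b, b', a'). [a', a, b, b']"
  let ?I2 = "{(a, b, b', b''). a \<in> A \<and> b \<in> B \<and> b' \<in> B \<and> b'' \<in> B}"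
  let ?s2 = "\<lambda>(a, b, b', b''). [[[a; b]; b']; b'']"
  let ?ys2 = "\<lambda>(a, b, b', b''). [a, b, b', b'']"
  let ?I3 = "{(m, p, q, r). m \<in> B \<and> p \<in> B \<and> q \<in> B \<and> r \<in> B \<and> lt m p \<and> \<not> lt p m \<and> m \<noteq> p \<and> lt m q \<and> \<not> lt q m \<and> m \<noteq> q \<and> lt m r \<and> \<not> lt r m \<and> m \<noteq> r}"
  let ?s3 = "\<lambda>(m, p, q, r). [[[m; p]; q]; r]"
  let ?ys3 = "\<lambda>(m, p, q, r). [m, p, q, r]"
  let ?I4 = "{(p, m). m \<in> B \<and> p \<in> B \<and> lt m p \<and> \<not> lt p m \<and> m \<noteq> p}"
  let ?s4 = "\<lambda>(p, m). [[[p; m]; m]; m]"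
  let ?ys4 = "\<lambda>(p, m). [p, m, m, m]"
  let ?I5 = "{(p, m, q). m \<in> B \<and> p \<in> B \<and> q \<in> B \<and> lt m p \<and> \<not> lt p m \<and> m \<noteq> p \<and> lt m q \<and> \<not> lt q m \<and> m \<noteq> q}"
  let ?s5 = "\<lambda>(p, m, q). [[[p; m]; m]; q]"
  let ?ys5 = "\<lambda>(p, m, q). [m, m, p, q]"
  let ?I6 = "{(p, m, q). m \<in> B \<and> p \<in> B \<and> q \<in> B \<and> lt m p \<and> \<not> lt p m \<and> m \<noteq> p \<and> lt m q \<and> \<not> lt q m \<and> m \<noteq> q \<and> lt q p \<and> \<not> lt p q \<and> q \<noteq> p}"
  let ?s6 = "\<lambda>(p, m, q). [[p; m]; [q; m]]"
  let ?ys6 = "\<lambda>(p, m, q). [m, p, m, q]"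
  let ?T6 = "?s6 ` ?I6 \<union> target_factors"
  let ?T5 = "?s5 ` ?I5 \<union> ?T6"
  let ?T4 = "?s4 ` ?I4 \<union> ?T5"
  let ?T3 = "?s3 ` ?I3 \<union> ?T4"
  let ?T2 = "?s2 ` ?I2 \<union> ?T3"
  let ?T1 = "?s1 ` ?I1 \<union> ?T2"
  note L4 = commutator_in_lower_central_4 commutator_commutator_in_lower_central_4
  have T6: "?T6 \<subseteq> \<gamma> 4" using target_factors_lower_central by (auto intro: L4)
  have T5: "?T5 \<subseteq> \<gamma> 4" using T6 by (intro Un_least) (auto intro: L4)
  have T4: "?T4 \<subseteq> \<gamma> 4" using T5 by (intro Un_least) (auto intro: L4)
  have T3: "?T3 \<subseteq> \<gamma> 4" using T4 by (intro Un_least) (auto intro: L4)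
  have T2: "?T2 \<subseteq> \<gamma> 4" using T3 by (intro Un_least) (auto intro: L4)
  have T1: "?T1 \<subseteq> \<gamma> 4" using T2 by (intro Un_least) (auto intro: L4)
  let ?P = "generate G ?T1"
  have sub: "?T1 \<subseteq> carrier G" by (rule subset_trans[OF T1 subgroup.subset[OF lower_central_subgroup]])
  have P: "subgroup ?P G" by (rule generate_is_subgroup[OF sub])
  have inclP: "x \<in> ?P" if "x \<in> ?s1 ` ?I1 \<or> x \<in> ?s2 ` ?I2 \<or> x \<in> ?s3 ` ?I3 \<or> x \<in> ?s4 ` ?I4 \<or>
      x \<in> ?s5 ` ?I5 \<or> x \<in> ?s6 ` ?I6 \<or> x \<in> target_factors" for x
    by (rule generate.incl) (use that in simp)
  have rel: "target_factors \<subseteq> ?P" using inclP by blast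
  have L5: "\<gamma> 5 \<subseteq> ?P" using rel by (simp add: target_factors_def)
  have T0: "[[[b1; b2]; b3]; b4] \<in> ?P" if "b1 \<in> B" "b2 \<in> B" "b3 \<in> B" "b4 \<in> B" for b1 b2 b3 b4
  proof (rule spanning_weight_4[OF P L5 B_G, of lt])
    show "[[[m; p]; q]; r] \<in> ?P"
      if "m \<in> B" "p \<in> B" "q \<in> B" "r \<in> B" "lt m p" "lt m q" "lt m r" for m p q r
      by (rule inclP, rule disjI2, rule disjI2, rule disjI1, rule image_eqI[of _ _ "(m, p, q, r)"]) (use that asym[of m p] asym[of m q] asym[of m r] in auto)
    show "[[[p; m]; m]; q] \<in> ?P" if "m \<in> B" "p \<in> B" "q \<in> B" "lt m p" "lt m q" for m p q
      by (rule inclP, rule disjI2, rule disjI2, rule disjI2, rule disjI2, rule disjI1, rule image_eqI[of _ _ "(p, m, q)"]) (use that asym[of m p] asym[of m q] asym[of q p] in auto)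
    show "[[p; m]; [q; m]] \<in> ?P" if "m \<in> B" "p \<in> B" "q \<in> B" "lt m p" "lt m q" "lt q p" for m p q
      by (rule inclP, rule disjI2, rule disjI2, rule disjI2, rule disjI2, rule disjI2, rule disjI1, rule image_eqI[of _ _ "(p, m, q)"]) (use that asym[of m p] asym[of m q] asym[of q p] in auto)
    show "[[[p; m]; m]; m] \<in> ?P" if "m \<in> B" "p \<in> B" "lt m p" for m p
      by (rule inclP, rule disjI2, rule disjI2, rule disjI2, rule disjI1, rule image_eqI[of _ _ "(p, m)"]) (use that asym[of m p] in auto)
  qed (use total trans that in blast)+
  have "\<gamma> 4 \<subseteq> ?P"
  proof (rule lower_central_4_subsetI[OF P L5])
    fix x y z t assume xyzt: "x \<in> Y" "y \<in> Y" "z \<in> Y" "t \<in> Y"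
    show "[[[x; y]; z]; t] \<in> ?P"
    proof (rule spanning_weight_4_relative[OF P L5])
      show "A \<subseteq> carrier G" "B \<subseteq> carrier G" using Y_G by auto
      have C: "[x; a] \<in> C" if "x \<in> A \<union> B" "a \<in> A" for x a
        using that A_S by (intro commutator_in_commutator_subgroup) auto
      show "[[[x; a]; a']; a''] \<in> ?P" if "x \<in> A \<union> B" "a \<in> A" "a' \<in> A" "a'' \<in> A" for x a a' a''
      proof -
        have "[[[x; a]; a']; a''] \<in> commutator_subgroup G (commutator_subgroup G C S) S"
          using that A_S by (intro commutator_in_commutator_subgroup[of _ "commutator_subgroup G C S"]
              commutator_in_commutator_subgroup[of _ C] C) auto
        then show ?thesis using rel by (auto simp: target_factors_def)
      qed
      show "[[x; a]; [x'; a']] \<in> ?P" if "x \<in> A \<union> B" "x' \<in> A \<union> B" "a \<in> A" "a' \<in> A" for x x' a a'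
      proof -
        have "[[x; a]; [x'; a']] \<in> commutator_subgroup G C C"
          using that by (intro commutator_in_commutator_subgroup[of _ C] C)
        then show ?thesis using rel by (auto simp: target_factors_def)
      qed
      show "[[[a; b]; b']; a'] \<in> ?P" if "a \<in> A" "b \<in> B" "b' \<in> B" "a' \<in> A" for a b b' a'
        by (rule inclP, rule disjI1, rule image_eqI[of _ _ "(a, b, b', a')"]) (use that  in auto)
      show "[[[a; b]; b']; b''] \<in> ?P" if "a \<in> A" "b \<in> B" "b' \<in> B" "b'' \<in> B" for a b b' b''
        by (rule inclP, rule disjI2, rule disjI1, rule image_eqI[of _ _ "(a, b, b', b'')"]) (use that  in auto)
    qed (use xyzt in \<open>simp_all only: T0 Y_def\<close>)
  qed
  then have "w \<in> ?P" using w by blast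
  then have "w \<in> generate G ?T2"
  proof (rule mem_generate_target_factors_step[where ys = ?ys1])
    show "\<exists>x y z t. ?ys1 i = [x, y, z, t] \<and> x \<in> Y \<and> y \<in> Y \<and> z \<in> B \<and> t \<in> B \<and>
        ?s1 i \<in> \<gamma> 4 \<and> coef (?ys1 i) (?s1 i) \<noteq> 0" if "i \<in> ?I1" for i
      using that by (cases i) (auto simp: coef_weight_4 L4 A_not_B A_B_neq A_B_neq[symmetric])
    show "coef (?ys1 i) (?s1 j) = 0" if "i \<in> ?I1" "j \<in> ?I1" "i \<noteq> j" for i j
      using that by (cases i; cases j) (auto intro!: coef_weight_4_eq_0 simp: A_not_B A_B_neq A_B_neq[symmetric])
    show "coef (?ys1 i) t = 0" if "i \<in> ?I1" "t \<in> ?T2 - target_factors" for i t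
      using that by (cases i) (auto intro!: coef_weight_4_eq_0 coef_weight_22_eq_0 simp: A_not_B A_B_neq A_B_neq[symmetric])
  qed (rule w(2), assumption+, use T2 in auto)
  then have "w \<in> generate G ?T3"
  proof (rule mem_generate_target_factors_step[where ys = ?ys2])
    show "\<exists>x y z t. ?ys2 i = [x, y, z, t] \<and> x \<in> Y \<and> y \<in> Y \<and> z \<in> B \<and> t \<in> B \<and>
        ?s2 i \<in> \<gamma> 4 \<and> coef (?ys2 i) (?s2 i) \<noteq> 0" if "i \<in> ?I2" for i
      using that by (cases i) (auto simp: coef_weight_4 L4 A_not_B A_B_neq A_B_neq[symmetric])
    show "coef (?ys2 i) (?s2 j) = 0" if "i \<in> ?I2" "j \<in> ?I2" "i \<noteq> j" for i j
      using that by (cases i; cases j) (auto intro!: coef_weight_4_eq_0 simp: A_not_B A_B_neq A_B_neq[symmetric])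
    show "coef (?ys2 i) t = 0" if "i \<in> ?I2" "t \<in> ?T3 - target_factors" for i t
      using that by (cases i) (auto intro!: coef_weight_4_eq_0 coef_weight_22_eq_0 simp: A_not_B A_B_neq A_B_neq[symmetric])
  qed (rule w(2), assumption+, use T3 in auto)
  then have "w \<in> generate G ?T4"
  proof (rule mem_generate_target_factors_step[where ys = ?ys3])
    show "\<exists>x y z t. ?ys3 i = [x, y, z, t] \<and> x \<in> Y \<and> y \<in> Y \<and> z \<in> B \<and> t \<in> B \<and>
        ?s3 i \<in> \<gamma> 4 \<and> coef (?ys3 i) (?s3 i) \<noteq> 0" if "i \<in> ?I3" for i
      using that by (cases i) (auto simp: coef_weight_4 L4)
    show "coef (?ys3 i) (?s3 j) = 0" if "i \<in> ?I3" "j \<in> ?I3" "i \<noteq> j" for i j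
      using that by (cases i; cases j) (auto intro!: coef_weight_4_eq_0)
    show "coef (?ys3 i) t = 0" if "i \<in> ?I3" "t \<in> ?T4 - target_factors" for i t
      using that by (cases i) (auto intro!: coef_weight_4_eq_0 coef_weight_22_eq_0)
  qed (rule w(2), assumption+, use T4 in auto)
  then have "w \<in> generate G ?T5"
  proof (rule mem_generate_target_factors_step[where ys = ?ys4])
    show "\<exists>x y z t. ?ys4 i = [x, y, z, t] \<and> x \<in> Y \<and> y \<in> Y \<and> z \<in> B \<and> t \<in> B \<and>
        ?s4 i \<in> \<gamma> 4 \<and> coef (?ys4 i) (?s4 i) \<noteq> 0" if "i \<in> ?I4" for i
      using that by (cases i) (auto simp: coef_weight_4 L4)
    show "coef (?ys4 i) (?s4 j) = 0" if "i \<in> ?I4" "j \<in> ?I4" "i \<noteq> j" for i j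
      using that by (cases i; cases j) (auto intro!: coef_weight_4_eq_0)
    show "coef (?ys4 i) t = 0" if "i \<in> ?I4" "t \<in> ?T5 - target_factors" for i t
      using that by (cases i) (auto intro!: coef_weight_4_eq_0 coef_weight_22_eq_0)
  qed (rule w(2), assumption+, use T5 in auto)
  then have "w \<in> generate G ?T6"
  proof (rule mem_generate_target_factors_step[where ys = ?ys5])
    show "\<exists>x y z t. ?ys5 i = [x, y, z, t] \<and> x \<in> Y \<and> y \<in> Y \<and> z \<in> B \<and> t \<in> B \<and>
        ?s5 i \<in> \<gamma> 4 \<and> coef (?ys5 i) (?s5 i) \<noteq> 0" if "i \<in> ?I5" for i
      using that by (cases i) (auto simp: coef_weight_4 L4)
    show "coef (?ys5 i) (?s5 j) = 0" if "i \<in> ?I5" "j \<in> ?I5" "i \<noteq> j" for i j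
      using that by (cases i; cases j) (auto intro!: coef_weight_4_eq_0)
    show "coef (?ys5 i) t = 0" if "i \<in> ?I5" "t \<in> ?T6 - target_factors" for i t
      using that by (cases i) (auto intro!: coef_weight_4_eq_0 coef_weight_22_eq_0)
  qed (rule w(2), assumption+, use T6 in auto)
  then show "w \<in> generate G target_factors"
  proof (rule mem_generate_target_factors_step[where ys = ?ys6])
    show "\<exists>x y z t. ?ys6 i = [x, y, z, t] \<and> x \<in> Y \<and> y \<in> Y \<and> z \<in> B \<and> t \<in> B \<and>
        ?s6 i \<in> \<gamma> 4 \<and> coef (?ys6 i) (?s6 i) \<noteq> 0" if "i \<in> ?I6" for i
      using that by (cases i) (auto simp: coef_weight_22 L4)
    show "coef (?ys6 i) (?s6 j) = 0" if "i \<in> ?I6" "j \<in> ?I6" "i \<noteq> j" for i j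
      using that by (cases i; cases j) (auto intro!: coef_weight_22_eq_0)
  qed (rule w(2), assumption+, use target_factors_lower_central in auto)
qed

end

section \<open>Powers of the augmentation ideal\<close>

text \<open>Products are expanded on group elements only, by bilinearity.\<close>

declare group_ring_simps(2) [simp del]

definition linear_extension :: "('a \<Rightarrow> int) \<Rightarrow> ('a \<Rightarrow>\<^sub>0 int) \<Rightarrow> int" where
  "linear_extension \<phi> x = (\<Sum>g \<in> Poly_Mapping.keys x. Poly_Mapping.lookup x g * \<phi> g)"

lemma linear_extension_alt:
  "linear_extension \<phi> x = Poly_Mapping.lookup (frag_extend (\<lambda>g. frag_cmul (\<phi> g) (frag_of ())) x) ()"
  by (simp add: linear_extension_def lookup_frag_extend)

lemma linear_extension_simps [simp]:
  "linear_extension \<phi> 0 = 0"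
  "linear_extension \<phi> (frag_of g) = \<phi> g"
  "linear_extension \<phi> (x + y) = linear_extension \<phi> x + linear_extension \<phi> y"
  "linear_extension \<phi> (- x) = - linear_extension \<phi> x"
  "linear_extension \<phi> (x - y) = linear_extension \<phi> x - linear_extension \<phi> y"
  by (simp_all add: linear_extension_alt frag_extend_add frag_extend_minus frag_extend_diff lookup_add lookup_minus)

lemma linear_extension_eq_0:
  "(\<And>g. g \<in> Poly_Mapping.keys x \<Longrightarrow> \<phi> g = 0) \<Longrightarrow> linear_extension \<phi> x = 0"
  by (simp add: linear_extension_def)

lemma augmentation_linear: "augmentation = linear_extension (\<lambda>_. 1)"
  by (simp add: fun_eq_iff augmentation_def linear_extension_def)

context group
begin

abbreviation Z :: "('a \<Rightarrow>\<^sub>0 int) ring" where "Z \<equiv> group_ring G"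

abbreviation ring_times :: "('a \<Rightarrow>\<^sub>0 int) \<Rightarrow> ('a \<Rightarrow>\<^sub>0 int) \<Rightarrow> ('a \<Rightarrow>\<^sub>0 int)" (infixl "\<star>" 70) where
  "x \<star> y \<equiv> x \<otimes>\<^bsub>group_ring G\<^esub> y"

lemma times_frag_of [simp]: "frag_of g \<star> frag_of h = frag_of (g \<otimes> h)"
  by (simp add: group_ring_simps(2))

lemma times_distrib [simp]:
  "0 \<star> z = 0" "z \<star> 0 = 0"
  "(x + y) \<star> z = x \<star> z + y \<star> z" "z \<star> (x + y) = z \<star> x + z \<star> y"
  "(x - y) \<star> z = x \<star> z - y \<star> z" "z \<star> (x - y) = z \<star> x - z \<star> y"
  "(- x) \<star> z = - (x \<star> z)" "z \<star> (- x) = - (z \<star> x)"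
proof -
  show d: "(x - y) \<star> z = x \<star> z - y \<star> z" "z \<star> (x - y) = z \<star> x - z \<star> y" for x y z
    by (simp_all add: group_ring_simps(2) frag_extend_diff frag_extend_fun_diff)
  show 0: "0 \<star> z = 0" "z \<star> 0 = 0" using d(1)[of 0 0 z] d(2)[of z 0 0] by simp_all
  show m: "(- x) \<star> z = - (x \<star> z)" "z \<star> (- x) = - (z \<star> x)" for x z
    using d(1)[of 0 x z] d(2)[of z 0 x] 0 by (simp_all add: group_ring_simps(2) frag_extend_eq_0)
  show "(x + y) \<star> z = x \<star> z + y \<star> z" "z \<star> (x + y) = z \<star> x + z \<star> y"
    using d(1)[of x "- y" z] d(2)[of z x "- y"] m by simp_all
qed

lemma ring_Z: "ring Z"
  by (rule ring_group_ring) (rule is_group)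

lemma times_closed: "x \<in> carrier Z \<Longrightarrow> y \<in> carrier Z \<Longrightarrow> x \<star> y \<in> carrier Z"
  by (rule monoid.m_closed[OF ring.is_monoid[OF ring_Z]])

lemma times_assoc:
  "x \<in> carrier Z \<Longrightarrow> y \<in> carrier Z \<Longrightarrow> z \<in> carrier Z \<Longrightarrow> x \<star> y \<star> z = x \<star> (y \<star> z)"
  by (rule monoid.m_assoc[OF ring.is_monoid[OF ring_Z]])

lemma frag_of_carrier: "g \<in> carrier G \<Longrightarrow> frag_of g \<in> carrier Z"
  by simp

text \<open>
  Subgroups of the additive group of the group ring, in terms of the addition of the underlying type.
\<close>

definition additive_subgroup :: "('a \<Rightarrow>\<^sub>0 int) set \<Rightarrow> bool" where
  "additive_subgroup V \<longleftrightarrow> V \<subseteq> carrier Z \<and> 0 \<in> V \<and> (\<forall>x \<in> V. \<forall>y \<in> V. x + y \<in> V) \<and> (\<forall>x \<in> V. - x \<in> V)"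

lemma additive_subgroupD:
  assumes "additive_subgroup V"
  shows "x \<in> V \<Longrightarrow> x \<in> carrier Z" "0 \<in> V" "x \<in> V \<Longrightarrow> y \<in> V \<Longrightarrow> x + y \<in> V"
    "x \<in> V \<Longrightarrow> - x \<in> V" "x \<in> V \<Longrightarrow> y \<in> V \<Longrightarrow> x - y \<in> V"
proof -
  show 1: "x \<in> V \<Longrightarrow> x \<in> carrier Z" "0 \<in> V" "x \<in> V \<Longrightarrow> y \<in> V \<Longrightarrow> x + y \<in> V" "x \<in> V \<Longrightarrow> - x \<in> V" for x y
    using assms unfolding additive_subgroup_def by blast+
  show "x \<in> V \<Longrightarrow> y \<in> V \<Longrightarrow> x - y \<in> V" using 1(3)[of x "- y"] 1(4)[of y] by simp
qed

lemma additive_subgroup_carrier: "additive_subgroup (carrier Z)"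
proof -
  have "x + y \<in> carrier Z" if "x \<in> carrier Z" "y \<in> carrier Z" for x y
    using that Poly_Mapping.keys_add[of x y] by auto
  then show ?thesis unfolding additive_subgroup_def by simp
qed

lemma a_inv_eq: "x \<in> carrier Z \<Longrightarrow> \<ominus>\<^bsub>Z\<^esub> x = - x"
  using abelian_group.minus_equality[OF ring.is_abelian_group[OF ring_Z], of "- x" x] by simp

lemma a_minus_eq: "x \<in> carrier Z \<Longrightarrow> y \<in> carrier Z \<Longrightarrow> x \<ominus>\<^bsub>Z\<^esub> y = x - y"
  by (simp add: a_minus_def a_inv_eq)

lemma additive_prod_subset:
  assumes V: "additive_subgroup V" and IJ: "\<And>x y. x \<in> I \<Longrightarrow> y \<in> J \<Longrightarrow> x \<star> y \<in> V"
  shows "additive_prod Z I J \<subseteq> V"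
proof
  fix x assume "x \<in> additive_prod Z I J"
  then show "x \<in> V"
    unfolding additive_prod_def
  proof (induction rule: generate.induct)
    case one
    then show ?case using additive_subgroupD(2)[OF V] by simp
  next
    case (incl h)
    then show ?case using IJ by blast
  next
    case (inv h)
    then have "h \<in> V" using IJ by blast
    then show ?case using additive_subgroupD[OF V] a_inv_eq[of h] by (simp add: a_inv_def)
  next
    case (eng h1 h2)
    then show ?case using additive_subgroupD(3)[OF V] by simp
  qed
qed

lemma additive_prod_times: "x \<in> I \<Longrightarrow> y \<in> J \<Longrightarrow> x \<star> y \<in> additive_prod Z I J"
  unfolding additive_prod_def by (blast intro: generate.incl)

lemma additive_subgroup_additive_prod:
  assumes "I \<subseteq> carrier Z" "J \<subseteq> carrier Z"
  shows "additive_subgroup (additive_prod Z I J)"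
proof -
  let ?T = "{x \<star> y | x y. x \<in> I \<and> y \<in> J}"
  have gr: "group (add_monoid Z)"
    using abelian_group.a_group[OF ring.is_abelian_group[OF ring_Z]] .
  have T: "?T \<subseteq> carrier (add_monoid Z)"
  proof
    fix z assume "z \<in> ?T"
    then obtain x y where z: "z = x \<star> y" "x \<in> I" "y \<in> J" by blast
    then have "x \<star> y \<in> carrier Z" using assms by (intro times_closed) (rule subsetD, assumption+)+
    then show "z \<in> carrier (add_monoid Z)" using z by (simp del: group_ring_simps(1))
  qed
  have sub: "subgroup (generate (add_monoid Z) ?T) (add_monoid Z)"
    by (rule group.generate_is_subgroup[OF gr T])
  have carr: "x \<in> carrier Z" if "x \<in> generate (add_monoid Z) ?T" for x
    using subgroup.mem_carrier[OF sub that] by simp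
  show ?thesis
    unfolding additive_subgroup_def additive_prod_def
  proof (intro conjI ballI)
    show "generate (add_monoid Z) ?T \<subseteq> carrier Z" using carr by blast
    show "0 \<in> generate (add_monoid Z) ?T" using subgroup.one_closed[OF sub] by simp
    fix x assume x: "x \<in> generate (add_monoid Z) ?T"
    show "x + y \<in> generate (add_monoid Z) ?T" if "y \<in> generate (add_monoid Z) ?T" for y
      using subgroup.m_closed[OF sub x that] by simp
    show "- x \<in> generate (add_monoid Z) ?T"
      using subgroup.m_inv_closed[OF sub x] a_inv_eq[OF carr[OF x]] by (simp add: a_inv_def)
  qed
qed

lemma additive_subgroup_sum:
  assumes V: "additive_subgroup V" and W: "additive_subgroup W"
  shows "additive_subgroup (V <+>\<^bsub>Z\<^esub> W)" and "V \<subseteq> V <+>\<^bsub>Z\<^esub> W" and "W \<subseteq> V <+>\<^bsub>Z\<^esub> W"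
    and "\<And>U. additive_subgroup U \<Longrightarrow> V \<subseteq> U \<Longrightarrow> W \<subseteq> U \<Longrightarrow> V <+>\<^bsub>Z\<^esub> W \<subseteq> U"
proof -
  have eq: "V <+>\<^bsub>Z\<^esub> W = {v + w | v w. v \<in> V \<and> w \<in> W}"
    by (auto simp: set_add_def set_mult_def)
  note v = additive_subgroupD[OF V] and w = additive_subgroupD[OF W]
  show "V \<subseteq> V <+>\<^bsub>Z\<^esub> W" unfolding eq using w(2) by force
  show "W \<subseteq> V <+>\<^bsub>Z\<^esub> W" unfolding eq using v(2) by force
  show "V <+>\<^bsub>Z\<^esub> W \<subseteq> U" if "additive_subgroup U" "V \<subseteq> U" "W \<subseteq> U" for U
    unfolding eq using that(2,3) additive_subgroupD(3)[OF that(1)] by blast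
  show "additive_subgroup (V <+>\<^bsub>Z\<^esub> W)"
    unfolding additive_subgroup_def
  proof (intro conjI ballI)
    show "V <+>\<^bsub>Z\<^esub> W \<subseteq> carrier Z"
      unfolding eq using v(1) w(1) additive_subgroupD(3)[OF additive_subgroup_carrier] by blast
    show "0 \<in> V <+>\<^bsub>Z\<^esub> W" unfolding eq using v(2) w(2) by force
    fix x assume "x \<in> V <+>\<^bsub>Z\<^esub> W"
    then obtain a b where x: "x = a + b" "a \<in> V" "b \<in> W" unfolding eq by blast
    have "- x = - a + - b" using x by simp
    then show "- x \<in> V <+>\<^bsub>Z\<^esub> W" unfolding eq using v(4)[OF x(2)] w(4)[OF x(3)] by blast
    fix y assume "y \<in> V <+>\<^bsub>Z\<^esub> W"
    then obtain c d where y: "y = c + d" "c \<in> V" "d \<in> W" unfolding eq by blast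
    have "x + y = (a + c) + (b + d)" using x y by simp
    then show "x + y \<in> V <+>\<^bsub>Z\<^esub> W" unfolding eq using v(3)[OF x(2) y(2)] w(3)[OF x(3) y(3)] by blast
  qed
qed

lemma augmentation_times:
  assumes "x \<in> carrier Z" "y \<in> carrier Z"
  shows "augmentation (x \<star> y) = augmentation x * augmentation y"
proof -
  have "Poly_Mapping.keys x \<subseteq> carrier G" using assms by simp
  then show ?thesis
  proof (induction x rule: frag_induction)
    case (one g)
    have "Poly_Mapping.keys y \<subseteq> carrier G" using assms by simp
    then show ?case
      by (induction y rule: frag_induction) (auto simp: augmentation_linear)
  qed (auto simp: augmentation_linear algebra_simps)
qed

lemma aug_ideal_carrier: "aug_ideal G \<subseteq> carrier Z"
  by (auto simp: aug_ideal_def)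

lemma additive_subgroup_aug_power: "additive_subgroup (aug_power G n)"
proof (induction n)
  case (Suc n)
  then show ?case
    using additive_subgroup_additive_prod[OF _ aug_ideal_carrier, of "aug_power G n"]
    by (simp add: additive_subgroup_def)
qed (simp only: aug_power.simps additive_subgroup_carrier)

lemma aug_power_carrier: "x \<in> aug_power G n \<Longrightarrow> x \<in> carrier Z"
  by (rule additive_subgroupD(1)[OF additive_subgroup_aug_power])

lemma aug_power_Suc_times: "x \<in> aug_power G n \<Longrightarrow> y \<in> aug_ideal G \<Longrightarrow> x \<star> y \<in> aug_power G (Suc n)"
  by (simp add: additive_prod_times)

lemma additive_subgroup_left_times:
  assumes "additive_subgroup V" "a \<in> carrier Z"
  shows "additive_subgroup {x \<in> carrier Z. a \<star> x \<in> V}"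
  using additive_subgroupD[OF additive_subgroup_carrier] additive_subgroupD[OF assms(1)]
  unfolding additive_subgroup_def by (auto simp del: group_ring_simps(1))

lemma additive_subgroup_right_times:
  assumes "additive_subgroup V" "a \<in> carrier Z"
  shows "additive_subgroup {x \<in> carrier Z. x \<star> a \<in> V}"
  using additive_subgroupD[OF additive_subgroup_carrier] additive_subgroupD[OF assms(1)]
  unfolding additive_subgroup_def by (auto simp del: group_ring_simps(1))

lemma aug_power_times_carrier:
  assumes a: "a \<in> aug_power G m" and b: "b \<in> carrier Z"
  shows "a \<star> b \<in> aug_power G m"
proof (cases m)
  case 0
  then show ?thesis using assms times_closed[OF _ b] by (simp del: group_ring_simps(1))
next
  case (Suc k)
  have "aug_power G (Suc k) \<subseteq> {x \<in> carrier Z. x \<star> b \<in> aug_power G (Suc k)}"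
    unfolding aug_power.simps(2)[of G k]
  proof (rule additive_prod_subset)
    show "additive_subgroup {x \<in> carrier Z. x \<star> b \<in> additive_prod Z (aug_power G k) (aug_ideal G)}"
      using additive_subgroup_right_times[OF additive_subgroup_aug_power[of "Suc k"] b] by simp
    fix c d assume c: "c \<in> aug_power G k" and d: "d \<in> aug_ideal G"
    have cc: "c \<in> carrier Z" and dc: "d \<in> carrier Z"
      using c d aug_power_carrier aug_ideal_carrier by blast+
    have "augmentation (d \<star> b) = 0"
      using augmentation_times[OF dc b] d by (simp add: aug_ideal_def)
    then have "d \<star> b \<in> aug_ideal G"
      using times_closed[OF dc b] by (simp add: aug_ideal_def del: group_ring_simps(1))
    then show "c \<star> d \<in> {x \<in> carrier Z. x \<star> b \<in> additive_prod Z (aug_power G k) (aug_ideal G)}"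
      using times_closed[OF cc dc] times_assoc[OF cc dc b] c by (auto intro: additive_prod_times simp del: group_ring_simps(1))
  qed
  then show ?thesis using a Suc by blast
qed

lemma aug_power_times:
  assumes "a \<in> aug_power G m"
  shows "b \<in> aug_power G n \<Longrightarrow> a \<star> b \<in> aug_power G (m + n)"
proof (induction n arbitrary: b)
  case 0
  then show ?case using aug_power_times_carrier[OF assms] by simp
next
  case (Suc n)
  have ac: "a \<in> carrier Z" using assms by (rule aug_power_carrier)
  have "aug_power G (Suc n) \<subseteq> {x \<in> carrier Z. a \<star> x \<in> aug_power G (m + Suc n)}"
    unfolding aug_power.simps(2)[of G n]
  proof (rule additive_prod_subset)
    show "additive_subgroup {x \<in> carrier Z. a \<star> x \<in> aug_power G (m + Suc n)}"
      by (rule additive_subgroup_left_times[OF additive_subgroup_aug_power ac])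
    fix c d assume c: "c \<in> aug_power G n" and d: "d \<in> aug_ideal G"
    have cc: "c \<in> carrier Z" and dc: "d \<in> carrier Z"
      using c d aug_power_carrier aug_ideal_carrier by blast+
    have "(a \<star> c) \<star> d \<in> aug_power G (Suc (m + n))"
      using Suc.IH[OF c] d by (rule aug_power_Suc_times)
    then show "c \<star> d \<in> {x \<in> carrier Z. a \<star> x \<in> aug_power G (m + Suc n)}"
      using times_closed[OF cc dc] times_assoc[OF ac cc dc] by (simp del: group_ring_simps(1) aug_power.simps)
  qed
  then show ?case using Suc.prems by blast
qed

lemma aug_power_antimono: "m \<le> n \<Longrightarrow> aug_power G n \<subseteq> aug_power G m"
proof (induction rule: inc_induct)
  case (step k)
  have "aug_power G (Suc k) \<subseteq> aug_power G k"
    unfolding aug_power.simps(2)[of G k]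
    by (rule additive_prod_subset[OF additive_subgroup_aug_power])
       (use aug_ideal_carrier aug_power_times_carrier in blast)
  then show ?case using step by blast
qed simp

lemma aug_ideal_subset_aug_power_1: "aug_ideal G \<subseteq> aug_power G 1"
proof
  fix x assume x: "x \<in> aug_ideal G"
  then have xc: "x \<in> carrier Z" using aug_ideal_carrier by blast
  have "frag_of \<one> \<star> x \<in> aug_power G (Suc 0)"
    using aug_power_Suc_times[of "frag_of \<one>" 0 x] x by simp
  moreover have "frag_of \<one> \<star> x = x"
    using monoid.l_one[OF ring.is_monoid[OF ring_Z] xc] by simp
  ultimately show "x \<in> aug_power G 1" by simp
qed

lemma frag_of_minus_one_mem:
  assumes "h \<in> H" "\<one> \<in> H"
  shows "frag_of h - frag_of \<one> \<in> aug_ideal (G\<lparr>carrier := H\<rparr>)"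
proof -
  have "Poly_Mapping.keys (frag_of h - frag_of \<one>) \<subseteq> H"
    using keys_diff[of "frag_of h" "frag_of \<one>"] assms by auto
  then show ?thesis by (simp add: aug_ideal_def augmentation_linear)
qed

text \<open>
  Modulo the differences $h - 1$, an element of the group ring is the multiple of $1$ given by its
  augmentation.
\<close>

lemma aug_ideal_subset:
  assumes V: "additive_subgroup V" and H: "\<And>h. h \<in> H \<Longrightarrow> frag_of h - frag_of \<one> \<in> V"
  shows "aug_ideal (G\<lparr>carrier := H\<rparr>) \<subseteq> V"
proof
  fix x assume x: "x \<in> aug_ideal (G\<lparr>carrier := H\<rparr>)"
  then have "Poly_Mapping.keys x \<subseteq> H" by (simp add: aug_ideal_def)
  then have "x - frag_cmul (augmentation x) (frag_of \<one>) \<in> V"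
  proof (induction x rule: frag_induction)
    case zero
    then show ?case using additive_subgroupD(2)[OF V] by (simp add: augmentation_linear)
  next
    case (one h)
    then show ?case using H by (simp add: augmentation_linear)
  next
    case (diff a b)
    have "frag_cmul (augmentation a - augmentation b) (frag_of \<one>) =
        frag_cmul (augmentation a) (frag_of \<one>) - frag_cmul (augmentation b) (frag_of \<one>)"
      by (rule poly_mapping_eqI) (simp add: lookup_minus algebra_simps)
    then have "(a - b) - frag_cmul (augmentation (a - b)) (frag_of \<one>) =
        (a - frag_cmul (augmentation a) (frag_of \<one>)) - (b - frag_cmul (augmentation b) (frag_of \<one>))"
      by (simp add: augmentation_linear)
    then show ?case using additive_subgroupD(5)[OF V diff] by (simp only:)
  qed
  then show "x \<in> V" using x by (simp add: aug_ideal_def)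
qed

text \<open>By $uv - 1 = (u-1)v + (v-1)$ and $u^{-1} - 1 = -(u-1)u^{-1}$.\<close>

lemma one_plus_subgroup:
  assumes V: "additive_subgroup V" and stable: "\<And>x g. x \<in> V \<Longrightarrow> g \<in> carrier G \<Longrightarrow> x \<star> frag_of g \<in> V"
  shows "subgroup {w \<in> carrier G. frag_of w - frag_of \<one> \<in> V} G"
proof (rule subgroupI)
  show "{w \<in> carrier G. frag_of w - frag_of \<one> \<in> V} \<subseteq> carrier G" by blast
  have "\<one> \<in> {w \<in> carrier G. frag_of w - frag_of \<one> \<in> V}" using additive_subgroupD(2)[OF V] by simp
  then show "{w \<in> carrier G. frag_of w - frag_of \<one> \<in> V} \<noteq> {}" by blast
next
  fix u assume "u \<in> {w \<in> carrier G. frag_of w - frag_of \<one> \<in> V}"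
  then have u: "u \<in> carrier G" "frag_of u - frag_of \<one> \<in> V" by auto
  have "- ((frag_of u - frag_of \<one>) \<star> frag_of (inv u)) \<in> V"
    using u by (intro additive_subgroupD(4)[OF V] stable) auto
  moreover have "- ((frag_of u - frag_of \<one>) \<star> frag_of (inv u)) = frag_of (inv u) - frag_of \<one>"
    using u by simp
  ultimately show "inv u \<in> {w \<in> carrier G. frag_of w - frag_of \<one> \<in> V}" using u by simp
next
  fix u v assume "u \<in> {w \<in> carrier G. frag_of w - frag_of \<one> \<in> V}" "v \<in> {w \<in> carrier G. frag_of w - frag_of \<one> \<in> V}"
  then have u: "u \<in> carrier G" "frag_of u - frag_of \<one> \<in> V" and v: "v \<in> carrier G" "frag_of v - frag_of \<one> \<in> V"
    by auto
  have "(frag_of u - frag_of \<one>) \<star> frag_of v + (frag_of v - frag_of \<one>) \<in> V"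
    using u v by (intro additive_subgroupD(3)[OF V] stable) auto
  moreover have "(frag_of u - frag_of \<one>) \<star> frag_of v + (frag_of v - frag_of \<one>) = frag_of (u \<otimes> v) - frag_of \<one>"
    using u v by simp
  ultimately show "u \<otimes> v \<in> {w \<in> carrier G. frag_of w - frag_of \<one> \<in> V}" using u v by simp
qed

lemma commutator_minus_one:
  assumes "u \<in> carrier G" "v \<in> carrier G"
  shows "frag_of [u; v] - frag_of \<one> =
    ((frag_of u - frag_of \<one>) \<star> (frag_of v - frag_of \<one>) - (frag_of v - frag_of \<one>) \<star> (frag_of u - frag_of \<one>))
      \<star> frag_of (inv u \<otimes> inv v)"
  using assms by (simp add: commutator_def m_assoc)

lemma commutator_minus_one_mem:
  assumes V: "additive_subgroup V" and stable: "\<And>x g. x \<in> V \<Longrightarrow> g \<in> carrier G \<Longrightarrow> x \<star> frag_of g \<in> V"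
    and "u \<in> carrier G" "v \<in> carrier G"
    and "(frag_of u - frag_of \<one>) \<star> (frag_of v - frag_of \<one>) \<in> V"
    and "(frag_of v - frag_of \<one>) \<star> (frag_of u - frag_of \<one>) \<in> V"
  shows "frag_of [u; v] - frag_of \<one> \<in> V"
  unfolding commutator_minus_one[OF assms(3,4)]
  using assms by (intro stable additive_subgroupD(5)[OF V]) auto

lemma aug_power_stable: "x \<in> aug_power G n \<Longrightarrow> g \<in> carrier G \<Longrightarrow> x \<star> frag_of g \<in> aug_power G n"
  by (rule aug_power_times_carrier) simp_all

lemma frag_of_minus_one_aug_power_1: "g \<in> carrier G \<Longrightarrow> frag_of g - frag_of \<one> \<in> aug_power G 1"
  using frag_of_minus_one_mem[of g "carrier G"] aug_ideal_subset_aug_power_1 by auto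

text \<open>
  By the formula for $[u,v] - 1$, each further commutator contributes a further factor in the augmentation
  ideal. This is the easy half of the theory of dimension subgroups.
\<close>

lemma lower_central_minus_one:
  "w \<in> \<gamma> n \<Longrightarrow> frag_of w - frag_of \<one> \<in> aug_power G n"
proof (induction n arbitrary: w)
  case 0
  have "frag_of w - frag_of \<one> \<in> carrier Z"
    using 0 by (intro additive_subgroupD(5)[OF additive_subgroup_carrier]) auto
  then show ?case by simp
next
  case (Suc n)
  show ?case
  proof (cases "n = 0")
    case True
    then show ?thesis using Suc.prems frag_of_minus_one_aug_power_1[of w] by simp
  next
    case False
    have "commutator_subgroup G (\<gamma> n) (carrier G) \<subseteq>
        {w \<in> carrier G. frag_of w - frag_of \<one> \<in> aug_power G (Suc n)}"
    proof (rule commutator_subgroup_least)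
      show "subgroup {w \<in> carrier G. frag_of w - frag_of \<one> \<in> aug_power G (Suc n)} G"
        by (rule one_plus_subgroup[OF additive_subgroup_aug_power aug_power_stable])
      fix u g assume u: "u \<in> \<gamma> n" and g: "g \<in> carrier G"
      have uc: "u \<in> carrier G" using u by (rule lower_central_closed)
      note u' = Suc.IH[OF u] and g' = frag_of_minus_one_aug_power_1[OF g]
      have "frag_of [u; g] - frag_of \<one> \<in> aug_power G (Suc n)"
        using aug_power_times[OF u' g'] aug_power_times[OF g' u'] uc g
        by (intro commutator_minus_one_mem[OF additive_subgroup_aug_power aug_power_stable])
           (simp_all del: aug_power.simps times_distrib)
      then show "[u; g] \<in> {w \<in> carrier G. frag_of w - frag_of \<one> \<in> aug_power G (Suc n)}"
        using uc g by (simp del: aug_power.simps)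
    qed
    then show ?thesis using Suc.prems False by (auto simp: lower_central_Suc)
  qed
qed

end

section \<open>The two inclusions\<close>

context split_basis
begin

definition augmentation_sum :: "('a \<Rightarrow>\<^sub>0 int) set" where
  "augmentation_sum = aug_power G 5
     <+>\<^bsub>Z\<^esub> additive_prod Z (aug_power G 3) (aug_ideal (G\<lparr>carrier := S\<rparr>))
     <+>\<^bsub>Z\<^esub> additive_prod Z (aug_power G 2) (aug_ideal (G\<lparr>carrier := C\<rparr>))"

lemma aug_ideal_sub_carrier:
  "H \<subseteq> carrier G \<Longrightarrow> aug_ideal (G\<lparr>carrier := H\<rparr>) \<subseteq> carrier Z"
  by (auto simp: aug_ideal_def)

lemma C_G: "C \<subseteq> carrier G"
  by (rule subset_trans[OF C_lower_central subgroup.subset[OF lower_central_subgroup]])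

lemma aug_power_subset_carrier: "aug_power G n \<subseteq> carrier Z"
  using aug_power_carrier by blast

lemma additive_subgroup_prods:
  "additive_subgroup (additive_prod Z (aug_power G m) (aug_ideal (G\<lparr>carrier := S\<rparr>)))"
  "additive_subgroup (additive_prod Z (aug_power G m) (aug_ideal (G\<lparr>carrier := C\<rparr>)))"
  by (intro additive_subgroup_additive_prod aug_power_subset_carrier aug_ideal_sub_carrier S_G C_G)+

lemmas additive_subgroup_partial_sum =
  additive_subgroup_sum[OF additive_subgroup_aug_power[of 5] additive_subgroup_prods(1)[of 3]]

lemma additive_subgroup_augmentation_sum: "additive_subgroup augmentation_sum"
  unfolding augmentation_sum_def
  by (intro additive_subgroup_sum(1) additive_subgroup_aug_power additive_subgroup_prods)

lemma augmentation_sum_upper: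
  "aug_power G 5 \<subseteq> augmentation_sum"
  "additive_prod Z (aug_power G 3) (aug_ideal (G\<lparr>carrier := S\<rparr>)) \<subseteq> augmentation_sum"
  "additive_prod Z (aug_power G 2) (aug_ideal (G\<lparr>carrier := C\<rparr>)) \<subseteq> augmentation_sum"
  using additive_subgroup_sum(2,3)[OF additive_subgroup_partial_sum(1) additive_subgroup_prods(2)[of 2]]
    additive_subgroup_partial_sum(2,3)
  unfolding augmentation_sum_def by blast+

lemma augmentation_sum_least:
  assumes "additive_subgroup V" "aug_power G 5 \<subseteq> V"
    "additive_prod Z (aug_power G 3) (aug_ideal (G\<lparr>carrier := S\<rparr>)) \<subseteq> V"
    "additive_prod Z (aug_power G 2) (aug_ideal (G\<lparr>carrier := C\<rparr>)) \<subseteq> V"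
  shows "augmentation_sum \<subseteq> V"
  unfolding augmentation_sum_def
  using additive_subgroup_sum(4)[OF additive_subgroup_partial_sum(1) additive_subgroup_prods(2)[of 2] assms(1)]
    additive_subgroup_partial_sum(4)[OF assms(1)] assms by blast

definition entry :: "(nat \<Rightarrow> 'a) \<Rightarrow> nat \<Rightarrow> nat \<Rightarrow> ('a \<Rightarrow>\<^sub>0 int) \<Rightarrow> int" where
  "entry \<phi> i j = linear_extension (\<lambda>g. rep \<phi> g i j)"

lemma entry_times:
  assumes \<phi>: "range \<phi> \<subseteq> Y" and x: "x \<in> carrier Z" and y: "y \<in> carrier Z"
  shows "entry \<phi> i j (x \<star> y) = (\<Sum>k = i..j. entry \<phi> i k x * entry \<phi> k j y)"
proof -
  have "Poly_Mapping.keys x \<subseteq> carrier G" using x by simp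
  then show ?thesis
  proof (induction x rule: frag_induction)
    case zero
    then show ?case by (simp add: entry_def)
  next
    case (one g)
    have "Poly_Mapping.keys y \<subseteq> carrier G" using y by simp
    then show ?case
    proof (induction y rule: frag_induction)
      case zero
      then show ?case by (simp add: entry_def)
    next
      case (one h)
      then show ?case using \<open>g \<in> carrier G\<close> rep_mult[OF \<phi>, of g h] by (simp add: entry_def)
    next
      case (diff a b)
      then show ?case by (simp add: entry_def right_diff_distrib sum_subtractf)
    qed
  next
    case (diff a b)
    then show ?case by (simp add: entry_def left_diff_distrib sum_subtractf)
  qed
qed

lemma additive_subgroup_entry: "additive_subgroup {x \<in> carrier Z. entry \<phi> i j x = 0}"
  using additive_subgroupD[OF additive_subgroup_carrier]
  unfolding additive_subgroup_def by (simp add: entry_def del: group_ring_simps(1))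

lemma entry_diagonal:
  assumes "range \<phi> \<subseteq> Y" "x \<in> carrier Z"
  shows "entry \<phi> i i x = augmentation x"
proof -
  have "rep \<phi> g i i = 1" if "g \<in> Poly_Mapping.keys x" for g
    using rep_carrier[OF assms(1), of g] that assms(2) by auto
  then show ?thesis by (simp add: entry_def augmentation_linear linear_extension_def)
qed

lemma entry_below_diagonal:
  assumes "range \<phi> \<subseteq> Y" "x \<in> carrier Z" "j < i"
  shows "entry \<phi> i j x = 0"
  unfolding entry_def
proof (rule linear_extension_eq_0)
  show "rep \<phi> g i j = 0" if "g \<in> Poly_Mapping.keys x" for g
    using rep_carrier[OF assms(1), of g] that assms(2,3) by auto
qed

text \<open>
  On the augmentation ideal the matrices are strictly upper triangular, so on its $n$-th power the first
  $n - 1$ superdiagonals vanish too.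
\<close>

lemma entry_aug_power:
  assumes \<phi>: "range \<phi> \<subseteq> Y"
  shows "x \<in> aug_power G n \<Longrightarrow> j < i + n \<Longrightarrow> entry \<phi> i j x = 0"
proof (induction n arbitrary: x i j)
  case 0
  then show ?case by (intro entry_below_diagonal[OF \<phi>]) auto
next
  case (Suc n)
  have "aug_power G (Suc n) \<subseteq> {x \<in> carrier Z. entry \<phi> i j x = 0}"
    unfolding aug_power.simps(2)[of G n]
  proof (rule additive_prod_subset[OF additive_subgroup_entry])
    fix a b assume a: "a \<in> aug_power G n" and b: "b \<in> aug_ideal G"
    have ac: "a \<in> carrier Z" and bc: "b \<in> carrier Z"
      using a b aug_power_carrier aug_ideal_carrier by blast+
    have "entry \<phi> i k a * entry \<phi> k j b = 0" if "k \<in> {i..j}" for k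
    proof (cases "k < i + n")
      case False
      then have "k = j" using that Suc.prems by auto
      then have "entry \<phi> k j b = 0" using entry_diagonal[OF \<phi> bc] b by (simp add: aug_ideal_def)
      then show ?thesis by simp
    qed (use Suc.IH[OF a] in simp)
    then have "entry \<phi> i j (a \<star> b) = 0"
      unfolding entry_times[OF \<phi> ac bc] by (intro sum.neutral) blast
    then show "a \<star> b \<in> {x \<in> carrier Z. entry \<phi> i j x = 0}"
      using times_closed[OF ac bc] by simp
  qed
  then show ?case using Suc.prems by blast
qed

text \<open>
  In the product of matrices, the left factor from $\Delta^3$ or $\Delta^2$ has its first row supported from
  index three or two on. The entries of the right factor in column \<open>j\<close> vanish from there on: it comes from \<open>S\<close> or \<open>C\<close>, where
  the relevant entries are zero as soon as the letters at positions two and three lie in \<open>B\<close>, and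
  for shorter words in any case.
\<close>

lemma entry_augmentation_sum:
  assumes \<phi>: "range \<phi> \<subseteq> Y" and x: "x \<in> augmentation_sum"
    and j: "j < 4 \<or> j = 4 \<and> \<phi> 2 \<in> B \<and> \<phi> 3 \<in> B"
  shows "entry \<phi> 0 j x = 0"
proof -
  have C2: "rep \<phi> c 2 3 = 0" "rep \<phi> c 3 4 = 0" if "c \<in> C" for c
  proof -
    have "c \<in> \<gamma> 2" using that C_lower_central by blast
    then have "vanishes_below 2 (rep \<phi> c)" by (rule unitriangular_hom_lower_central[OF rep(1)[OF \<phi>]])
    then show "rep \<phi> c 2 3 = 0" "rep \<phi> c 3 4 = 0" by (simp_all add: vanishes_below_def)
  qed
  have S34: "entry \<phi> 3 j b = 0" if b: "b \<in> aug_ideal (G\<lparr>carrier := S\<rparr>)" and j3: "j \<ge> 3" for b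
  proof -
    have bc: "b \<in> carrier Z" using b aug_ideal_sub_carrier[OF S_G] by blast
    have keys: "Poly_Mapping.keys b \<subseteq> S" using b by (simp add: aug_ideal_def)
    consider "j = 3" | "j = 4" "\<phi> 3 \<in> B" using j j3 by force
    then show ?thesis
    proof cases
      case 1
      then show ?thesis using entry_diagonal[OF \<phi> bc] b by (simp add: aug_ideal_def)
    next
      case 2
      have "rep \<phi> s 3 4 = 0" if "s \<in> S" for s using rep_S_eq_0[OF \<phi> 2(2) that] by simp
      then show ?thesis using keys 2 unfolding entry_def by (intro linear_extension_eq_0) auto
    qed
  qed
  have C234: "entry \<phi> k j b = 0" if b: "b \<in> aug_ideal (G\<lparr>carrier := C\<rparr>)" and k: "k \<ge> 2" "k \<le> j" for b k
  proof -
    have bc: "b \<in> carrier Z" using b aug_ideal_sub_carrier[OF C_G] by blast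
    have keys: "Poly_Mapping.keys b \<subseteq> C" using b by (simp add: aug_ideal_def)
    have "k = j \<or> (k = 2 \<and> j = 3) \<or> (k = 3 \<and> j = 4) \<or> (k = 2 \<and> j = 4 \<and> \<phi> 2 \<in> B \<and> \<phi> 3 \<in> B)"
      using j k by force
    then consider "k = j" | "\<And>c. c \<in> C \<Longrightarrow> rep \<phi> c k j = 0"
      using C2 rep_C_eq_0[OF \<phi>] by blast
    then show ?thesis
    proof cases
      case 1
      then show ?thesis using entry_diagonal[OF \<phi> bc] b by (simp add: aug_ideal_def)
    next
      case 2
      then show ?thesis using keys unfolding entry_def by (intro linear_extension_eq_0) auto
    qed
  qed
  have "augmentation_sum \<subseteq> {x \<in> carrier Z. entry \<phi> 0 j x = 0}"
  proof (rule augmentation_sum_least[OF additive_subgroup_entry])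
    show "aug_power G 5 \<subseteq> {x \<in> carrier Z. entry \<phi> 0 j x = 0}"
      using entry_aug_power[OF \<phi>, of _ 5 j 0] aug_power_carrier j by auto
    show "additive_prod Z (aug_power G 3) (aug_ideal (G\<lparr>carrier := S\<rparr>)) \<subseteq> {x \<in> carrier Z. entry \<phi> 0 j x = 0}"
    proof (rule additive_prod_subset[OF additive_subgroup_entry])
      fix a b assume a: "a \<in> aug_power G 3" and b: "b \<in> aug_ideal (G\<lparr>carrier := S\<rparr>)"
      have ac: "a \<in> carrier Z" and bc: "b \<in> carrier Z"
        using a b aug_power_carrier aug_ideal_sub_carrier[OF S_G] by blast+
      have "entry \<phi> 0 k a * entry \<phi> k j b = 0" if k: "k \<in> {0..j}" for k
      proof -
        consider "k < 3" | "k = 3" | "k = 4" "j = 4" using k j by fastforce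
        then show ?thesis
        proof cases
          case 1
          then show ?thesis using entry_aug_power[OF \<phi> a, of k 0] by simp
        next
          case 2
          then show ?thesis using S34[OF b] k by simp
        next
          case 3
          then show ?thesis using entry_diagonal[OF \<phi> bc] b by (simp add: aug_ideal_def)
        qed
      qed
      then have "entry \<phi> 0 j (a \<star> b) = 0"
        unfolding entry_times[OF \<phi> ac bc] by (intro sum.neutral) blast
      then show "a \<star> b \<in> {x \<in> carrier Z. entry \<phi> 0 j x = 0}"
        using times_closed[OF ac bc] by simp
    qed
    show "additive_prod Z (aug_power G 2) (aug_ideal (G\<lparr>carrier := C\<rparr>)) \<subseteq> {x \<in> carrier Z. entry \<phi> 0 j x = 0}"
    proof (rule additive_prod_subset[OF additive_subgroup_entry])
      fix a b assume a: "a \<in> aug_power G 2" and b: "b \<in> aug_ideal (G\<lparr>carrier := C\<rparr>)"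
      have ac: "a \<in> carrier Z" and bc: "b \<in> carrier Z"
        using a b aug_power_carrier aug_ideal_sub_carrier[OF C_G] by blast+
      have "entry \<phi> 0 k a * entry \<phi> k j b = 0" if k: "k \<in> {0..j}" for k
        using entry_aug_power[OF \<phi> a, of k 0] C234[OF b, of k] k by (cases "k < 2") auto
      then have "entry \<phi> 0 j (a \<star> b) = 0"
        unfolding entry_times[OF \<phi> ac bc] by (intro sum.neutral) blast
      then show "a \<star> b \<in> {x \<in> carrier Z. entry \<phi> 0 j x = 0}"
        using times_closed[OF ac bc] by simp
    qed
  qed
  then show ?thesis using x by blast
qed

theorem augmentation_sum_imp_target_factors:
  assumes w: "w \<in> carrier G" "frag_of w - frag_of \<one> \<in> augmentation_sum"
  shows "w \<in> generate G target_factors"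
proof -
  have rep_w: "rep \<phi> w 0 j = 0"
    if "range \<phi> \<subseteq> Y" "0 < j" "j < 4 \<or> j = 4 \<and> \<phi> 2 \<in> B \<and> \<phi> 3 \<in> B" for \<phi> j
  proof -
    have "rep \<phi> \<one> = \<one>\<^bsub>unitriangular\<^esub>"
      using hom_one[OF rep(1)[OF that(1)] is_group group_unitriangular] .
    then have "rep \<phi> \<one> 0 j = 0" using that(2) by simp
    moreover have "entry \<phi> 0 j (frag_of w - frag_of \<one>) = 0"
      by (rule entry_augmentation_sum[OF that(1) w(2) that(3)])
    ultimately show ?thesis by (simp add: entry_def)
  qed
  have coef_w: "coef ys w = 0" if "set ys \<subseteq> Y" "ys \<noteq> []"
    "length ys < 4 \<or> length ys = 4 \<and> letters ys 2 \<in> B \<and> letters ys 3 \<in> B" for ys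
    unfolding coef_def using letters_Y[OF that(1,2)] that by (intro rep_w) auto
  have 2: "w \<in> \<gamma> 2"
  proof (rule lower_central_2_if_coef_zero[OF w(1)])
    fix y assume "y \<in> Y"
    then have \<phi>: "range (\<lambda>_. y) \<subseteq> Y" by auto
    show "f y w = 0" using rep_w[OF \<phi>, of "Suc 0"] rep(2)[OF \<phi> w(1), of 0] by simp
  qed
  have 3: "w \<in> \<gamma> 3"
    by (rule lower_central_3_if_coef_zero[OF 2]) (rule coef_w; simp)
  have 4: "w \<in> \<gamma> 4"
    by (rule lower_central_4_if_coef_zero[OF 3]) (rule coef_w; simp)
  show ?thesis
    by (rule mem_target_factors_if_coef_zero[OF 4]) (rule coef_w; simp add: letters_def)
qed

lemma C_minus_one: "aug_ideal (G\<lparr>carrier := C\<rparr>) \<subseteq> aug_power G 2"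
  using C_lower_central
  by (intro aug_ideal_subset additive_subgroup_aug_power lower_central_minus_one) blast

lemma augmentation_sum_aug_power_4: "augmentation_sum \<subseteq> aug_power G 4"
proof (rule augmentation_sum_least[OF additive_subgroup_aug_power])
  show "aug_power G 5 \<subseteq> aug_power G 4" by (rule aug_power_antimono) simp
  show "additive_prod Z (aug_power G 3) (aug_ideal (G\<lparr>carrier := S\<rparr>)) \<subseteq> aug_power G 4"
  proof (rule additive_prod_subset[OF additive_subgroup_aug_power])
    fix x y assume "x \<in> aug_power G 3" "y \<in> aug_ideal (G\<lparr>carrier := S\<rparr>)"
    moreover have "aug_ideal (G\<lparr>carrier := S\<rparr>) \<subseteq> aug_ideal G"
      using S_G by (auto simp: aug_ideal_def)
    ultimately have "x \<star> y \<in> aug_power G (Suc 3)"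
      by (intro aug_power_Suc_times) auto
    then show "x \<star> y \<in> aug_power G 4" by (simp del: aug_power.simps)
  qed
  show "additive_prod Z (aug_power G 2) (aug_ideal (G\<lparr>carrier := C\<rparr>)) \<subseteq> aug_power G 4"
  proof (rule additive_prod_subset[OF additive_subgroup_aug_power])
    fix x y assume "x \<in> aug_power G 2" "y \<in> aug_ideal (G\<lparr>carrier := C\<rparr>)"
    then have "x \<star> y \<in> aug_power G (2 + 2)"
      using C_minus_one by (intro aug_power_times) auto
    then show "x \<star> y \<in> aug_power G 4" by simp
  qed
qed

text \<open>
  Since the sum lies in $\Delta^4$, multiplying it by $g - 1$ from the right leads to $\Delta^5$, which is part of the
  sum.
\<close>

lemma augmentation_sum_stable:
  assumes x: "x \<in> augmentation_sum" and g: "g \<in> carrier G"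
  shows "x \<star> frag_of g \<in> augmentation_sum"
proof -
  have xc: "x \<in> carrier Z" by (rule additive_subgroupD(1)[OF additive_subgroup_augmentation_sum x])
  have "x \<star> (frag_of g - frag_of \<one>) \<in> aug_power G (4 + 1)"
    using x augmentation_sum_aug_power_4 frag_of_minus_one_aug_power_1[OF g]
    by (intro aug_power_times) auto
  then have "x \<star> (frag_of g - frag_of \<one>) \<in> augmentation_sum"
    using augmentation_sum_upper(1) by auto
  from additive_subgroupD(3)[OF additive_subgroup_augmentation_sum this x]
  show ?thesis
    using monoid.r_one[OF ring.is_monoid[OF ring_Z] xc] by simp
qed

text \<open>
  Up to a unit on the right, $[u,v] - 1$ is $(u-1)(v-1) - (v-1)(u-1)$. For $c, d \in C$ both products lie in
  $\Delta^2 \Delta(C)$. For $u \in [C,S]$ and $s \in S$ the product $(u-1)(s-1)$ lies in $\Delta^3 \Delta(S)$;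
  in the other order, $u - 1$ is expanded once more, which leads to
  $\Delta^3 \Delta(S) + \Delta^2 \Delta(C)$.
\<close>

theorem target_factors_imp_augmentation_sum:
  "generate G target_factors \<subseteq> {w \<in> carrier G. frag_of w - frag_of \<one> \<in> augmentation_sum}"
proof (rule generate_subgroup_incl)
  let ?V = "{w \<in> carrier G. frag_of w - frag_of \<one> \<in> augmentation_sum}"
  note J = additive_subgroup_augmentation_sum
  note mem = commutator_minus_one_mem[OF J augmentation_sum_stable]
  show V: "subgroup ?V G" by (rule one_plus_subgroup[OF J augmentation_sum_stable])
  have oneS: "\<one> \<in> S" and oneC: "\<one> \<in> C"
    using subgroup.one_closed[OF S_subgroup] subgroup.one_closed[OF normal_imp_subgroup[OF C_normal]] by auto
  have s1: "frag_of s - frag_of \<one> \<in> aug_ideal (G\<lparr>carrier := S\<rparr>)" "frag_of s - frag_of \<one> \<in> aug_power G 1"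
    "frag_of s - frag_of \<one> \<in> carrier Z" "s \<in> carrier G" if "s \<in> S" for s
  proof -
    show "s \<in> carrier G" using that S_G by blast
    then show "frag_of s - frag_of \<one> \<in> aug_power G 1" by (rule frag_of_minus_one_aug_power_1)
    then show "frag_of s - frag_of \<one> \<in> carrier Z" by (rule aug_power_carrier)
    show "frag_of s - frag_of \<one> \<in> aug_ideal (G\<lparr>carrier := S\<rparr>)" using that oneS by (rule frag_of_minus_one_mem)
  qed
  have c1: "frag_of c - frag_of \<one> \<in> aug_ideal (G\<lparr>carrier := C\<rparr>)" "frag_of c - frag_of \<one> \<in> aug_power G 2"
    "frag_of c - frag_of \<one> \<in> carrier Z" "c \<in> carrier G" if "c \<in> C" for c
  proof -
    show "c \<in> carrier G" using that C_G by blast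
    show 1: "frag_of c - frag_of \<one> \<in> aug_ideal (G\<lparr>carrier := C\<rparr>)" using that oneC by (rule frag_of_minus_one_mem)
    then show "frag_of c - frag_of \<one> \<in> aug_power G 2" using C_minus_one by blast
    then show "frag_of c - frag_of \<one> \<in> carrier Z" by (rule aug_power_carrier)
  qed
  have prodS: "x \<star> y \<in> augmentation_sum" if "x \<in> aug_power G 3" "y \<in> aug_ideal (G\<lparr>carrier := S\<rparr>)" for x y
    using augmentation_sum_upper(2) additive_prod_times[OF that] by blast
  have prodC: "x \<star> y \<in> augmentation_sum" if "x \<in> aug_power G 2" "y \<in> aug_ideal (G\<lparr>carrier := C\<rparr>)" for x y
    using augmentation_sum_upper(3) additive_prod_times[OF that] by blast
  \<comment> \<open>the part of $\Delta^3$ that left multiplication by $\Delta$ takes into the sum\<close>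
  define V3 where "V3 = {x \<in> aug_power G 3. \<forall>a \<in> aug_power G 1. a \<star> x \<in> augmentation_sum}"
  have V3: "additive_subgroup V3"
    unfolding additive_subgroup_def
  proof (intro conjI ballI)
    note L = additive_subgroupD[OF additive_subgroup_aug_power[of 3]] and M = additive_subgroupD[OF J]
    show "V3 \<subseteq> carrier Z" unfolding V3_def using L(1) by blast
    show "0 \<in> V3" unfolding V3_def using L(2) M(2) by (simp del: aug_power.simps)
    show "x + y \<in> V3" if "x \<in> V3" "y \<in> V3" for x y
      using that L(3)[of x y] M(3) unfolding V3_def by simp
    show "- x \<in> V3" if "x \<in> V3" for x
      using that L(4)[of x] M(4) unfolding V3_def by simp
  qed
  have V3_stable: "x \<star> frag_of g \<in> V3" if "x \<in> V3" "g \<in> carrier G" for x g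
  proof -
    have xc: "x \<in> carrier Z" using that(1) additive_subgroupD(1)[OF V3] by blast
    have "a \<star> (x \<star> frag_of g) \<in> augmentation_sum" if a: "a \<in> aug_power G 1" for a
    proof -
      have "(a \<star> x) \<star> frag_of g \<in> augmentation_sum"
        using \<open>x \<in> V3\<close> a \<open>g \<in> carrier G\<close> by (intro augmentation_sum_stable) (auto simp: V3_def)
      then show ?thesis
        using times_assoc[OF aug_power_carrier[OF a] xc frag_of_carrier[OF \<open>g \<in> carrier G\<close>]] by simp
    qed
    then show ?thesis using that aug_power_stable by (simp add: V3_def)
  qed
  have cs: "(frag_of c - frag_of \<one>) \<star> (frag_of s - frag_of \<one>) \<in> V3"
    "(frag_of s - frag_of \<one>) \<star> (frag_of c - frag_of \<one>) \<in> V3" if c: "c \<in> C" and s: "s \<in> S" for c s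
  proof -
    note C1 = c1[OF c] and S1 = s1[OF s]
    have "a \<star> ((frag_of c - frag_of \<one>) \<star> (frag_of s - frag_of \<one>)) \<in> augmentation_sum" if "a \<in> aug_power G 1" for a
      unfolding times_assoc[OF aug_power_carrier[OF that] C1(3) S1(3), symmetric]
      by (rule prodS[OF _ S1(1)]) (use aug_power_times[OF that C1(2)] in \<open>simp add: eval_nat_numeral del: aug_power.simps times_distrib\<close>)
    moreover have "a \<star> ((frag_of s - frag_of \<one>) \<star> (frag_of c - frag_of \<one>)) \<in> augmentation_sum" if "a \<in> aug_power G 1" for a
      unfolding times_assoc[OF aug_power_carrier[OF that] S1(3) C1(3), symmetric]
      by (rule prodC[OF _ C1(1)]) (use aug_power_times[OF that S1(2)] in \<open>simp add: eval_nat_numeral del: aug_power.simps times_distrib\<close>)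
    ultimately show "(frag_of c - frag_of \<one>) \<star> (frag_of s - frag_of \<one>) \<in> V3"
      "(frag_of s - frag_of \<one>) \<star> (frag_of c - frag_of \<one>) \<in> V3"
      using aug_power_times[OF C1(2) S1(2)] aug_power_times[OF S1(2) C1(2)]
      by (simp_all add: V3_def eval_nat_numeral del: aug_power.simps times_distrib)
  qed
  have "commutator_subgroup G C S \<subseteq> {w \<in> carrier G. frag_of w - frag_of \<one> \<in> V3}"
  proof (rule commutator_subgroup_least[OF one_plus_subgroup[OF V3 V3_stable]])
    fix c s assume c: "c \<in> C" and s: "s \<in> S"
    have "frag_of [c; s] - frag_of \<one> \<in> V3"
      by (rule commutator_minus_one_mem[OF V3 V3_stable c1(4)[OF c] s1(4)[OF s] cs[OF c s]])
    then show "[c; s] \<in> {w \<in> carrier G. frag_of w - frag_of \<one> \<in> V3}"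
      using c1(4)[OF c] s1(4)[OF s] by simp
  qed
  then have u1: "u \<in> carrier G" "frag_of u - frag_of \<one> \<in> V3" if "u \<in> commutator_subgroup G C S" for u
    using that by blast+
  have "commutator_subgroup G (commutator_subgroup G C S) S \<subseteq> ?V"
  proof (rule commutator_subgroup_least[OF V])
    fix u s assume u: "u \<in> commutator_subgroup G C S" and s: "s \<in> S"
    have "frag_of [u; s] - frag_of \<one> \<in> augmentation_sum"
      by (rule mem) (use u1[OF u] s1[OF s] prodS in \<open>simp_all add: V3_def del: times_distrib\<close>)
    then show "[u; s] \<in> ?V" using u1[OF u] s1[OF s] by simp
  qed
  moreover have "commutator_subgroup G C C \<subseteq> ?V"
  proof (rule commutator_subgroup_least[OF V])
    fix c d assume c: "c \<in> C" and d: "d \<in> C"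
    have "frag_of [c; d] - frag_of \<one> \<in> augmentation_sum"
      by (rule mem) (use c1[OF c] c1[OF d] prodC in \<open>simp_all del: times_distrib\<close>)
    then show "[c; d] \<in> ?V" using c1[OF c] c1[OF d] by simp
  qed
  moreover have "\<gamma> 5 \<subseteq> ?V"
    using lower_central_minus_one[of _ 5] augmentation_sum_upper(1) by auto
  ultimately show "target_factors \<subseteq> ?V" unfolding target_factors_def by blast
qed

theorem one_plus_augmentation_sum:
  "{w \<in> carrier G. frag_of w - frag_of \<one> \<in> augmentation_sum} =
    \<gamma> 5 <#> commutator_subgroup G (commutator_subgroup G C S) S <#> commutator_subgroup G C C"
    (is "?V = ?N <#> ?K <#> ?L")
proof
  have K: "?K \<lhd> G" and L: "?L \<lhd> G"
    by (intro commutator_subgroup_normal C_normal S)+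
  note N = lower_central_normal[of 5]
  have NK: "subgroup (?N <#> ?K) G"
    by (rule mult_norm_subgroup[OF N normal_imp_subgroup[OF K]])
  have NKL: "subgroup (?N <#> ?K <#> ?L) G"
    unfolding commut_normal[OF NK L] by (rule mult_norm_subgroup[OF L NK])
  have one: "\<one> \<in> ?N" "\<one> \<in> ?K" "\<one> \<in> ?L"
    using N K L normal_imp_subgroup subgroup.one_closed by blast+
  have sub: "H \<subseteq> H <#> H'" "H' \<subseteq> H <#> H'" if "\<one> \<in> H" "\<one> \<in> H'" "H \<subseteq> carrier G" "H' \<subseteq> carrier G" for H H'
    using that unfolding set_mult_def by force+
  have G: "?N \<subseteq> carrier G" "?K \<subseteq> carrier G" "?L \<subseteq> carrier G" "?N <#> ?K \<subseteq> carrier G"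
    using N K L NK normal_imp_subgroup subgroup.subset by blast+
  have "target_factors \<subseteq> ?N <#> ?K <#> ?L"
    using sub[OF one(1,2) G(1,2)] sub[OF subgroup.one_closed[OF NK] one(3) G(4,3)]
    unfolding target_factors_def by blast
  then have "generate G target_factors \<subseteq> ?N <#> ?K <#> ?L" using NKL by (rule generate_subgroup_incl)
  then show "?V \<subseteq> ?N <#> ?K <#> ?L" using augmentation_sum_imp_target_factors by blast
  have V: "subgroup ?V G"
    by (rule one_plus_subgroup[OF additive_subgroup_augmentation_sum augmentation_sum_stable])
  have "target_factors \<subseteq> ?V" using target_factors_imp_augmentation_sum generate.incl[of _ target_factors G] by blast
  then have "?N \<subseteq> ?V" "?K \<subseteq> ?V" "?L \<subseteq> ?V" by (simp_all only: target_factors_def Un_subset_iff)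
  then show "?N <#> ?K <#> ?L \<subseteq> ?V"
    using subgroup.m_closed[OF V] unfolding set_mult_def by blast
qed

end

section \<open>Normal subgroups of free groups\<close>

lemma commutator_subgroup_consistent:
  assumes "group F" "subgroup R F" "H \<subseteq> R" "H' \<subseteq> R"
  shows "commutator_subgroup (F\<lparr>carrier := R\<rparr>) H H' = commutator_subgroup F H H'"
proof -
  interpret F: group F by fact
  interpret R: subgroup R F by fact
  let ?T = "\<Union>a\<in>H. \<Union>b\<in>H'. {a \<otimes>\<^bsub>F\<^esub> b \<otimes>\<^bsub>F\<^esub> inv\<^bsub>F\<^esub> a \<otimes>\<^bsub>F\<^esub> inv\<^bsub>F\<^esub> b}"
  have "(\<Union>a\<in>H. \<Union>b\<in>H'. {a \<otimes>\<^bsub>F\<lparr>carrier := R\<rparr>\<^esub> b \<otimes>\<^bsub>F\<lparr>carrier := R\<rparr>\<^esub> inv\<^bsub>F\<lparr>carrier := R\<rparr>\<^esub> a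
      \<otimes>\<^bsub>F\<lparr>carrier := R\<rparr>\<^esub> inv\<^bsub>F\<lparr>carrier := R\<rparr>\<^esub> b}) = ?T"
  proof (intro SUP_cong refl)
    fix a b assume "a \<in> H" "b \<in> H'"
    then have "a \<in> R" "b \<in> R" using assms by auto
    then show "{a \<otimes>\<^bsub>F\<lparr>carrier := R\<rparr>\<^esub> b \<otimes>\<^bsub>F\<lparr>carrier := R\<rparr>\<^esub> inv\<^bsub>F\<lparr>carrier := R\<rparr>\<^esub> a
      \<otimes>\<^bsub>F\<lparr>carrier := R\<rparr>\<^esub> inv\<^bsub>F\<lparr>carrier := R\<rparr>\<^esub> b} = {a \<otimes>\<^bsub>F\<^esub> b \<otimes>\<^bsub>F\<^esub> inv\<^bsub>F\<^esub> a \<otimes>\<^bsub>F\<^esub> inv\<^bsub>F\<^esub> b}"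
      using F.m_inv_consistent[OF assms(2)] by simp
  qed
  moreover have "?T \<subseteq> R"
  proof (intro UN_least)
    fix a b assume "a \<in> H" "b \<in> H'"
    then have "a \<in> R" "b \<in> R" using assms by auto
    then have "a \<otimes>\<^bsub>F\<^esub> b \<otimes>\<^bsub>F\<^esub> inv\<^bsub>F\<^esub> a \<otimes>\<^bsub>F\<^esub> inv\<^bsub>F\<^esub> b \<in> R"
      by (intro R.m_closed R.m_inv_closed)
    then show "{a \<otimes>\<^bsub>F\<^esub> b \<otimes>\<^bsub>F\<^esub> inv\<^bsub>F\<^esub> a \<otimes>\<^bsub>F\<^esub> inv\<^bsub>F\<^esub> b} \<subseteq> R" by blast
  qed
  ultimately show ?thesis
    unfolding commutator_subgroup_def using F.generate_consistent[OF _ assms(2)] by simp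
qed

lemma lookup_frag_extend_inj:
  assumes "inj \<phi>"
  shows "Poly_Mapping.lookup (frag_extend (frag_of \<circ> \<phi>) c) (\<phi> x) = Poly_Mapping.lookup c x"
    and "y \<notin> range \<phi> \<Longrightarrow> Poly_Mapping.lookup (frag_extend (frag_of \<circ> \<phi>) c) y = 0"
proof -
  have "Poly_Mapping.keys c \<subseteq> UNIV" by simp
  then show "Poly_Mapping.lookup (frag_extend (frag_of \<circ> \<phi>) c) (\<phi> x) = Poly_Mapping.lookup c x"
    by (induction c rule: frag_induction)
       (use assms in \<open>auto simp: frag_extend_diff lookup_minus inj_eq\<close>)
  show "Poly_Mapping.lookup (frag_extend (frag_of \<circ> \<phi>) c) y = 0" if "y \<notin> range \<phi>"
    unfolding lookup_frag_extend using that by (intro sum.neutral) auto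
qed

text \<open>The homomorphism \<open>h\<close> records the exponent sums of the basis elements.\<close>

lemma free_group_abelianization:
  fixes F :: "('a, 'b) monoid_scheme" (structure)
  assumes "free_group F"
  obtains h :: "'a \<Rightarrow> ('a \<Rightarrow>\<^sub>0 int)"
  where "\<And>x y. x \<in> carrier F \<Longrightarrow> y \<in> carrier F \<Longrightarrow> h (x \<otimes> y) = h x + h y"
    and "\<And>x. x \<in> carrier F \<Longrightarrow> h x = 0 \<longleftrightarrow> x \<in> derived F (carrier F)"
proof -
  interpret F: group F using assms by (simp add: free_group_def)
  obtain X' where B: "free_basis F X'" using assms by (auto simp: free_group_def)
  have BF: "X' \<subseteq> carrier F" using B by (auto simp: free_basis_def)
  obtain h where h: "h \<in> hom F (free_Abelian_group X')" "\<And>x. x \<in> X' \<Longrightarrow> h x = frag_of x"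
    by (rule free_basis_extend_hom[OF F.is_group B group_free_Abelian_group, of frag_of]) auto
  have h_mult: "h (x \<otimes> y) = h x + h y" if "x \<in> carrier F" "y \<in> carrier F" for x y
    using h(1) that by (simp add: hom_def)
  have h_one: "h \<one> = 0" using h_mult[of "\<one>" "\<one>"] by simp
  have h_inv: "h (inv x) = - h x" if "x \<in> carrier F" for x
    using h_mult[of "inv x" x] that h_one by (simp add: eq_neg_iff_add_eq_0)
  have h_comm: "h (F.commutator x y) = 0" if "x \<in> carrier F" "y \<in> carrier F" for x y
    using that by (simp add: F.commutator_def h_mult h_inv)
  have derived: "h x = 0" if x: "x \<in> derived F (carrier F)" for x
  proof -
    have sub: "subgroup {x \<in> carrier F. h x = 0} F"
      by (rule F.subgroupI) (use h_mult h_inv h_one in auto)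
    have "commutator_subgroup F (carrier F) (carrier F) \<subseteq> {x \<in> carrier F. h x = 0}"
      by (rule F.commutator_subgroup_least[OF sub]) (use h_comm in auto)
    then show ?thesis using x by (auto simp: commutator_subgroup_self)
  qed
  have "x \<in> derived F (carrier F)" if x: "x \<in> carrier F" "h x = 0" for x
  proof -
    have gen: "generate F (derived F (carrier F)) = derived F (carrier F)"
      using F.generate_lower_central[of 2] by (simp add: lower_central_2)
    have "x \<in> generate F (derived F (carrier F))"
    proof (rule F.mem_generate_if_dual_functionals_vanish[where s = id and I = X' and \<Gamma> = "carrier F"
          and e = "\<lambda>y x. Poly_Mapping.lookup (h x) y"])
      show "F.commutator y z \<in> generate F (derived F (carrier F))" if "y \<in> carrier F" "z \<in> carrier F" for y z
        using F.commutator_in_commutator_subgroup[OF that] by (simp add: gen commutator_subgroup_self)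
      have "carrier F \<subseteq> generate F (X' \<union> derived F (carrier F))"
        using free_basis_generates[OF F.is_group B] F.mono_generate[of X' "X' \<union> derived F (carrier F)"] by blast
      then show "x \<in> generate F (id ` X' \<union> derived F (carrier F))" using x by auto
      show "derived F (carrier F) \<subseteq> carrier F" by (rule F.derived_in_carrier) simp
    qed (use x h BF derived h_mult F.subgroup_self in \<open>auto simp: lookup_add\<close>)
    then show ?thesis by (simp only: gen)
  qed
  then show ?thesis using that[of h] h_mult derived by blast
qed

text \<open>
  The abelianization of a subgroup \<open>R\<close> of a free group is projective, hence embeds in the free
  abelian group on the set \<open>R\<close>.
\<close>

lemma subgroup_abelianization_embedding:
  fixes F :: "('a, 'b) monoid_scheme"
  assumes F: "free_group F" and R: "subgroup R F"
  obtains h :: "'a \<Rightarrow> ('a \<Rightarrow>\<^sub>0 int)"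
  where "\<And>x y. x \<in> R \<Longrightarrow> y \<in> R \<Longrightarrow> h (x \<otimes>\<^bsub>F\<^esub> y) = h x + h y"
    and "\<And>x. x \<in> R \<Longrightarrow> h x = 0 \<Longrightarrow> x \<in> derived (F\<lparr>carrier := R\<rparr>) R"
proof -
  interpret F: group F using F by (simp add: free_group_def)
  let ?G = "F\<lparr>carrier := R\<rparr>"
  interpret G: group ?G by (rule F.subgroup_imp_group[OF R])
  let ?D = "derived ?G R"
  interpret D: normal ?D ?G using G.derived_self_is_normal by simp
  have Q: "comm_group (?G Mod ?D)" using G.derived_quot_is_comm_group by simp
  interpret Q: comm_group "?G Mod ?D" by (rule Q)
  have coset: "?D #>\<^bsub>?G\<^esub> r \<in> carrier (?G Mod ?D)" if "r \<in> R" for r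
    using that D.r_coset_hom_Mod by (auto simp: hom_def)
  obtain p where p: "p \<in> hom (free_Abelian_group R) (?G Mod ?D)" "\<And>r. r \<in> R \<Longrightarrow> p (frag_of r) = ?D #>\<^bsub>?G\<^esub> r"
    by (rule Q.free_Abelian_group_universal[of "\<lambda>r. ?D #>\<^bsub>?G\<^esub> r" R]) (use coset in blast)+
  have surj: "p ` carrier (free_Abelian_group R) = carrier (?G Mod ?D)"
  proof
    show "p ` carrier (free_Abelian_group R) \<subseteq> carrier (?G Mod ?D)" using p(1) by (auto simp: hom_def)
    show "carrier (?G Mod ?D) \<subseteq> p ` carrier (free_Abelian_group R)"
    proof
      fix c assume "c \<in> carrier (?G Mod ?D)"
      then obtain r where r: "r \<in> R" "c = ?D #>\<^bsub>?G\<^esub> r" by (auto simp: FactGroup_def RCOSETS_def)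
      then have "c = p (frag_of r)" using p(2) by simp
      then show "c \<in> p ` carrier (free_Abelian_group R)" using r by auto
    qed
  qed
  obtain h where h: "h \<in> hom ?G (free_Abelian_group R)" "\<And>r. r \<in> R \<Longrightarrow> p (h r) = ?D #>\<^bsub>?G\<^esub> r"
    by (rule subgroup_of_free_group_projective[OF F R group_free_Abelian_group Q.is_group p(1) surj D.r_coset_hom_Mod]) (rule that)
  show ?thesis
  proof (rule that)
    show "h (x \<otimes>\<^bsub>F\<^esub> y) = h x + h y" if "x \<in> R" "y \<in> R" for x y
      using h(1) that by (simp add: hom_def)
    show "x \<in> ?D" if "x \<in> R" "h x = 0" for x
    proof -
      have "p 0 = \<one>\<^bsub>?G Mod ?D\<^esub>"
        using hom_one[OF p(1) group_free_Abelian_group Q.is_group] by simp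
      then have "?D #>\<^bsub>?G\<^esub> x = ?D" using h(2)[OF that(1)] that(2) by simp
      then show ?thesis using G.rcos_self[OF _ D.is_subgroup, of x] that(1) by simp
    qed
  qed
qed

text \<open>
  The homomorphism \<open>h\<close> combines the exponent sums in \<open>F\<close>, whose kernel on \<open>R\<close> is $R \cap F'$, with an
  embedding of $R/R'$ in a free abelian group. Elements of \<open>R\<close> whose image is supported in the second summand are
  those of $R \cap F'$, so a basis adapted to this summand splits in the required way.
\<close>

lemma split_basis_exists:
  fixes F :: "('a, 'b) monoid_scheme"
  assumes F: "free_group F" and R: "R \<lhd> F"
  shows "\<exists>A B f. split_basis (F\<lparr>carrier := R\<rparr>) (R \<inter> derived F (carrier F)) A B f"
proof -
  interpret F: group F using F by (simp add: free_group_def)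
  let ?G = "F\<lparr>carrier := R\<rparr>" and ?S = "R \<inter> derived F (carrier F)"
  have RF: "subgroup R F" using R by (rule normal_imp_subgroup)
  interpret R: subgroup R F by (rule RF)
  interpret G: group ?G by (rule F.subgroup_imp_group[OF RF])
  obtain h1 :: "'a \<Rightarrow> ('a \<Rightarrow>\<^sub>0 int)" where h1: "\<And>x y. x \<in> carrier F \<Longrightarrow> y \<in> carrier F \<Longrightarrow> h1 (x \<otimes>\<^bsub>F\<^esub> y) = h1 x + h1 y"
    "\<And>x. x \<in> carrier F \<Longrightarrow> h1 x = 0 \<longleftrightarrow> x \<in> derived F (carrier F)"
    by (rule free_group_abelianization[OF F]) (rule that)
  obtain h2 :: "'a \<Rightarrow> ('a \<Rightarrow>\<^sub>0 int)" where h2: "\<And>x y. x \<in> R \<Longrightarrow> y \<in> R \<Longrightarrow> h2 (x \<otimes>\<^bsub>F\<^esub> y) = h2 x + h2 y"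
    "\<And>x. x \<in> R \<Longrightarrow> h2 x = 0 \<Longrightarrow> x \<in> derived ?G R"
    by (rule subgroup_abelianization_embedding[OF F RF]) (rule that)
  define h :: "'a \<Rightarrow> ('a + 'a) \<Rightarrow>\<^sub>0 int"
    where "h x = frag_extend (frag_of \<circ> Inl) (h1 x) + frag_extend (frag_of \<circ> Inr) (h2 x)" for x
  let ?U = "range Inr :: ('a + 'a) set"
  have lookup_h: "Poly_Mapping.lookup (h x) (Inl k) = Poly_Mapping.lookup (h1 x) k"
    "Poly_Mapping.lookup (h x) (Inr k) = Poly_Mapping.lookup (h2 x) k" for x k
    using lookup_frag_extend_inj(2)[of Inr "Inl k" "h2 x"] lookup_frag_extend_inj(2)[of Inl "Inr k" "h1 x"]
    by (auto simp: h_def lookup_add lookup_frag_extend_inj(1))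
  have h_add: "h (x \<otimes>\<^bsub>?G\<^esub> y) = h x + h y" if "x \<in> carrier ?G" "y \<in> carrier ?G" for x y
    using that h1(1)[of x y] h2(1)[of x y] by (simp add: h_def frag_extend_add)
  have h_U: "Poly_Mapping.keys (h x) \<subseteq> ?U \<longleftrightarrow> x \<in> ?S" if "x \<in> R" for x
  proof -
    have "Poly_Mapping.keys (h x) \<subseteq> ?U \<longleftrightarrow> (\<forall>k. Poly_Mapping.lookup (h x) (Inl k) = 0)"
    proof
      assume "Poly_Mapping.keys (h x) \<subseteq> ?U"
      then show "\<forall>k. Poly_Mapping.lookup (h x) (Inl k) = 0" by (auto simp: in_keys_iff)
    next
      assume *: "\<forall>k. Poly_Mapping.lookup (h x) (Inl k) = 0"
      show "Poly_Mapping.keys (h x) \<subseteq> ?U"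
      proof
        fix k assume "k \<in> Poly_Mapping.keys (h x)"
        then show "k \<in> ?U" using * by (cases k) (auto simp: in_keys_iff)
      qed
    qed
    also have "\<dots> \<longleftrightarrow> h1 x = 0"
      unfolding lookup_h by (auto intro: poly_mapping_eqI)
    finally show ?thesis using h1(2)[of x] that by simp
  qed
  obtain Y and f :: "'a \<Rightarrow> 'a \<Rightarrow> int" where Y: "Y \<subseteq> carrier ?G"
    and f_add: "\<And>y g g'. y \<in> Y \<Longrightarrow> g \<in> carrier ?G \<Longrightarrow> g' \<in> carrier ?G \<Longrightarrow> f y (g \<otimes>\<^bsub>?G\<^esub> g') = f y g + f y g'"
    and f_dual: "\<And>y y'. y \<in> Y \<Longrightarrow> y' \<in> Y \<Longrightarrow> f y y' = (if y = y' then 1 else 0)"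
    and gen: "generate ?G (Y \<union> {g \<in> carrier ?G. h g = 0}) = carrier ?G"
    and f_U: "\<And>y g. y \<in> Y \<Longrightarrow> \<not> Poly_Mapping.keys (h y) \<subseteq> ?U \<Longrightarrow> g \<in> carrier ?G \<Longrightarrow>
            Poly_Mapping.keys (h g) \<subseteq> ?U \<Longrightarrow> f y g = 0"
    by (rule G.basis_modulo_kernel[of h ?U, OF h_add], assumption, assumption, rule that)
  let ?A = "Y \<inter> ?S" and ?B = "Y - ?S"
  have AB: "?A \<union> ?B = Y" by blast
  have "split_basis ?G ?S ?A ?B f"
  proof (intro split_basis.intro split_basis_axioms.intro G.is_group, unfold AB)
    show "?S \<lhd> ?G"
      using F.normal_Int_subgroup[OF RF F.derived_self_is_normal] by (simp add: Int_commute)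
    have "{g \<in> carrier ?G. h g = 0} \<subseteq> lower_central ?G 2"
    proof
      fix g assume "g \<in> {g \<in> carrier ?G. h g = 0}"
      then have g: "g \<in> R" "h g = 0" by auto
      then have "h2 g = 0" using lookup_h(2)[of g] by (auto intro: poly_mapping_eqI)
      then show "g \<in> lower_central ?G 2" using h2(2)[OF g(1)] by (simp add: lower_central_2)
    qed
    then show "carrier ?G \<subseteq> generate ?G (Y \<union> lower_central ?G 2)"
      using gen G.mono_generate[of "Y \<union> {g \<in> carrier ?G. h g = 0}" "Y \<union> lower_central ?G 2"] by blast
    show "f b s = 0" if "b \<in> ?B" "s \<in> ?S" for b s
      using that h_U Y by (intro f_U) auto
    show "\<exists>\<rho> \<in> hom ?G unitriangular. \<forall>g \<in> carrier ?G. \<forall>i. \<rho> g i (Suc i) = f (\<phi> i) g"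
      if "range \<phi> \<subseteq> Y" for \<phi> :: "nat \<Rightarrow> 'a"
    proof -
      have \<phi>: "\<phi> i \<in> Y" for i using that by auto
      obtain \<rho> where "\<rho> \<in> hom ?G unitriangular" "\<And>r i. r \<in> R \<Longrightarrow> \<rho> r i (Suc i) = f (\<phi> i) r"
        by (rule unitriangular_representation[OF F RF, of "\<lambda>i. f (\<phi> i)"]) (use f_add[OF \<phi>] in simp_all)
      then show ?thesis by auto
    qed
  qed (use Y f_add f_dual in auto)
  then show ?thesis by blast
qed

theorem proposition3p3:
  fixes F :: "('a, 'b) monoid_scheme" and R :: "'a set"
  assumes "free_group F" and "R \<lhd> F"
  shows "let G = F\<lparr>carrier := R\<rparr>;
             Z = group_ring G;
             S = R \<inter> derived F (carrier F);
             C = commutator_subgroup F R S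
         in {w \<in> R. frag_of w \<ominus>\<^bsub>Z\<^esub> \<one>\<^bsub>Z\<^esub> \<in>
                aug_power G 5
                <+>\<^bsub>Z\<^esub> additive_prod Z (aug_power G 3) (aug_ideal (F\<lparr>carrier := S\<rparr>))
                <+>\<^bsub>Z\<^esub> additive_prod Z (aug_power G 2) (aug_ideal (F\<lparr>carrier := C\<rparr>))}
            = lower_central G 5
              <#>\<^bsub>F\<^esub> commutator_subgroup F (commutator_subgroup F C S) S
              <#>\<^bsub>F\<^esub> commutator_subgroup F C C"
proof -
  interpret F: group F using assms by (simp add: free_group_def)
  have RF: "subgroup R F" using assms(2) by (rule normal_imp_subgroup)
  let ?G = "F\<lparr>carrier := R\<rparr>" and ?S = "R \<inter> derived F (carrier F)"
  let ?C = "commutator_subgroup F R ?S"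
  obtain A B f where "split_basis ?G ?S A B f"
    using split_basis_exists[OF assms] by blast
  then interpret split_basis ?G ?S A B f .
  note consistent = commutator_subgroup_consistent[OF F.is_group RF]
  have C: "commutator_subgroup ?G (carrier ?G) ?S = ?C"
    by (simp add: consistent)
  have CR: "?C \<subseteq> R" using C_G C by simp
  have CS: "commutator_subgroup ?G ?C ?S = commutator_subgroup F ?C ?S"
    by (rule consistent[OF CR]) simp
  have CSR: "commutator_subgroup F ?C ?S \<subseteq> R"
    using CS_lower_central lower_central_closed unfolding C CS by auto
  have CSS: "commutator_subgroup ?G (commutator_subgroup F ?C ?S) ?S = commutator_subgroup F (commutator_subgroup F ?C ?S) ?S"
    by (rule consistent[OF CSR]) simp
  have CC: "commutator_subgroup ?G ?C ?C = commutator_subgroup F ?C ?C"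
    by (rule consistent[OF CR CR])
  have minus: "frag_of w \<ominus>\<^bsub>group_ring ?G\<^esub> \<one>\<^bsub>group_ring ?G\<^esub> = frag_of w - frag_of \<one>\<^bsub>?G\<^esub>" if "w \<in> R" for w
    using a_minus_eq[of "frag_of w" "frag_of \<one>\<^bsub>?G\<^esub>"] that subgroup.one_closed[OF RF] by simp
  have "{w \<in> R. frag_of w - frag_of \<one>\<^bsub>?G\<^esub> \<in> augmentation_sum} =
      lower_central ?G 5 <#>\<^bsub>F\<^esub> commutator_subgroup F (commutator_subgroup F ?C ?S) ?S <#>\<^bsub>F\<^esub> commutator_subgroup F ?C ?C"
    using one_plus_augmentation_sum unfolding C CS CSS CC by simp
  moreover have "{w \<in> R. frag_of w \<ominus>\<^bsub>group_ring ?G\<^esub> \<one>\<^bsub>group_ring ?G\<^esub> \<in> augmentation_sum} =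
      {w \<in> R. frag_of w - frag_of \<one>\<^bsub>?G\<^esub> \<in> augmentation_sum}"
    using minus by auto
  ultimately show ?thesis
    unfolding Let_def augmentation_sum_def C by simp
qed

end
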